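(* Let $m,p,n$ be positive integers with $p\mid m$. For an element $g\in G(m,p,n)$ with $k$ cycles, of colors $a_1,\ldots,a_k$, let $d=\gcd(a_1,\ldots,a_k,p)$. Then, as formal power series in $z$, $$ F^{\mathrm{full}}_{m,p,n}(g;z)=\frac{1}{m^{n-1}}\cdot F^{\mathrm{full}}_{m,p,1}\big(\zeta_m^{\operatorname{col}(g)};\,n\cdot z\big)\cdot\sum_{r\,:\,r\mid d}\left(\mu(r)\cdot r^{\,n+k-2}\cdot F^{\mathrm{full}}_{\mathfrak S_n}\big(\pi_{m/1}(g);\,(m/r)\cdot z\big)\right), $$ where $\mu$ is the number-theoretic Möbius function and the sum is over positive divisors $r$ of $d$.
   Context: A (unitary) reflection on a finite-dimensional complex Hermitian space $V$ is a unitary map whose fixed space is a hyperplane (has codimension exactly 1). A complex reflection group is a finite subgroup $W\le U(V)$ generated by its set $\mathcal R$ of reflections. For $p\mid m$, put $\zeta_m=\exp(2\pi i/m)$ and let $G(m,p,n)$ be the group of $n\times n$ monomial matrices whose nonzero entries are $m$-th roots of unity with product an $(m/p)$-th root of unity. Its reflections are its elements with fixed space of codimension 1 in $\mathbb C^n$. In particular $G(m,p,1)$ is cyclic of order $m/p$ and all its non-identity elements are reflections; $G(m,m,1)$ is the trivial group with no reflections. $G(1,1,n)$ is the symmetric group $\mathfrak S_n$ (permutation matrices), and its reflections are the transpositions. An element $w\in G(m,1,n)$ is encoded as $[u;b]$ with $u\in\mathfrak S_n$ and $b=(b_1,\dots,b_n)\in(\mathbb Z/m\mathbb Z)^n$: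 the nonzero entry of column $j$ of $w$ is in row $u(j)$ and equals $\zeta_m^{b_j}$. The underlying permutation of $w$ is $u=:\pi_{m/1}(w)$. A cycle of $w$ is a cycle of $u$ (fixed points count as cycles); the color of a cycle with support $S\subseteq\{1,\dots,n\}$ is $\sum_{j\in S}b_j\in\mathbb Z/m\mathbb Z$; the color of $w$ is $\operatorname{col}(w)=b_1+\cdots+b_n\in\mathbb Z/m\mathbb Z$. Then $G(m,p,n)$ consists of those $w$ with $p\mid\operatorname{col}(w)$. The gcd $d$ is computed with any integer representatives of the $a_i$; it is well defined since $p\mid m$, and is a divisor of $p$. For a complex reflection group $W$ with set of reflections $\mathcal R$ and $g\in W$, a reflection factorization $t_1\cdots t_N=g$ ($t_i\in\mathcal R$) is full if $\langle t_1,\dots,t_N\rangle=W$, and $$F^{\mathrm{full}}_W(g;z)=\sum_{N\ge0}\#\{(t_1,\dots,t_N)\in\mathcal R^N: t_1\cdots t_N=g,\ \langle t_1,\dots,t_N\rangle=W\}\cdot\frac{z^N}{N!}.$$ One writes $F^{\mathrm{full}}_{m,p,n}$ for $F^{\mathrm{full}}_{G(m,p,n)}$. For the trivial group (with $\mathcal R=\emptyset$) the series is $1$.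
   Formalization: The case n = 1 with p > 1 is excluded: there d = p and the sum over r | p of μ(r) is 0, so the right-hand side vanishes, while the left-hand side is never 0 (e.g. m = p = 2, g = 1 gives 1 = 0). *)

theory Defs
  imports
    "HOL-Analysis.Analysis"
    "HOL-Algebra.Generated_Groups"
    "HOL-Combinatorics.Orbits"
    "HOL-Computational_Algebra.Formal_Power_Series"
    "HOL-Computational_Algebra.Squarefree"
begin

no_notation fps_nth (infixl "$" 75)

text \<open>
  The space is \<open>\<complex>\<^sup>n\<close> with \<open>n = CARD('n)\<close>; matrices are \<open>complex ^ 'n ^ 'n\<close>, with \<open>w $ i $ j\<close> the
  entry in row \<open>i\<close> and column \<open>j\<close>. Colors in \<open>\<int>/m\<int>\<close> are represented by their residues in
  \<open>{0..<m}\<close>.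
\<close>

definition zeta :: "nat \<Rightarrow> complex" where
  "zeta m = exp (2 * of_real pi * \<i> / of_nat m)"

definition monomial_mat :: "complex ^ 'n ^ 'n \<Rightarrow> bool" where
  "monomial_mat w \<longleftrightarrow>
     (\<forall>i. \<exists>!j. w $ i $ j \<noteq> 0) \<and> (\<forall>j. \<exists>!i. w $ i $ j \<noteq> 0)"

definition Gmpn :: "nat \<Rightarrow> nat \<Rightarrow> (complex ^ 'n ^ 'n) set" where
  "Gmpn m p =
     {w. monomial_mat w \<and>
         (\<forall>i j. w $ i $ j \<noteq> 0 \<longrightarrow> (w $ i $ j) ^ m = 1) \<and>
         (\<Prod>(i, j) \<in> {(i, j). w $ i $ j \<noteq> 0}. w $ i $ j) ^ (m div p) = 1}"

text \<open>The symmetric group, as the group of permutation matrices.\<close>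

abbreviation Sym_mats :: "(complex ^ 'n ^ 'n) set" where
  "Sym_mats \<equiv> Gmpn 1 1"

text \<open>
  The encoding \<open>[u;b]\<close> of a matrix of \<open>Gmpn m 1\<close>: the nonzero entry of column \<open>j\<close> is in row
  \<open>u j\<close> and equals \<open>zeta m ^ b j\<close>.
\<close>

definition und_perm :: "complex ^ 'n ^ 'n \<Rightarrow> 'n \<Rightarrow> 'n" where
  "und_perm w j = (THE i. w $ i $ j \<noteq> 0)"

definition entry_exp :: "nat \<Rightarrow> complex ^ 'n ^ 'n \<Rightarrow> 'n \<Rightarrow> nat" where
  "entry_exp m w j = (THE b. b < m \<and> w $ und_perm w j $ j = zeta m ^ b)"

text \<open>The projection \<open>\<pi>\<^bsub>m/1\<^esub>\<close>, with the underlying permutation written as a permutation matrix.\<close>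

definition perm_proj :: "complex ^ 'n ^ 'n \<Rightarrow> complex ^ 'n ^ 'n" where
  "perm_proj w = (\<chi> i j. if i = und_perm w j then 1 else 0)"

text \<open>The supports of the cycles; fixed points contribute singletons.\<close>

definition cycle_supports :: "complex ^ 'n ^ 'n \<Rightarrow> 'n set set" where
  "cycle_supports w = range (orbit (und_perm w))"

definition color_on :: "nat \<Rightarrow> complex ^ 'n ^ 'n \<Rightarrow> 'n set \<Rightarrow> nat" where
  "color_on m w S = (\<Sum>j\<in>S. entry_exp m w j) mod m"

abbreviation col :: "nat \<Rightarrow> complex ^ 'n ^ 'n \<Rightarrow> nat" where
  "col m w \<equiv> color_on m w UNIV"

text \<open>
  Elements of \<open>W\<close> whose fixed space has complex codimension exactly 1. This is the notion of
  reflection for a group \<open>W\<close> of unitary matrices, such as \<open>Gmpn m p\<close>.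
\<close>

definition reflections :: "(complex ^ 'n ^ 'n) set \<Rightarrow> (complex ^ 'n ^ 'n) set" where
  "reflections W = {t \<in> W. vec.dim {v. t *v v = v} + 1 = CARD('n)}"

definition mat_group :: "(complex ^ 'n ^ 'n) set \<Rightarrow> (complex ^ 'n ^ 'n) monoid" where
  "mat_group W = \<lparr>carrier = W, monoid.mult = (**), one = mat 1\<rparr>"

definition full_refl_facts ::
    "(complex ^ 'n ^ 'n) set \<Rightarrow> complex ^ 'n ^ 'n \<Rightarrow> nat \<Rightarrow> (complex ^ 'n ^ 'n) list set" where
  "full_refl_facts W g N =
     {ts. length ts = N \<and> set ts \<subseteq> reflections W \<and>
          foldr (**) ts (mat 1) = g \<and> generate (mat_group W) (set ts) = W}"

definition F_full :: "(complex ^ 'n ^ 'n) set \<Rightarrow> complex ^ 'n ^ 'n \<Rightarrow> rat fps" where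
  "F_full W g = Abs_fps (\<lambda>N. of_nat (card (full_refl_facts W g N)) / fact N)"

text \<open>The substitution \<open>F(c z)\<close>.\<close>

abbreviation fps_scale_arg :: "rat \<Rightarrow> rat fps \<Rightarrow> rat fps" where
  "fps_scale_arg c F \<equiv> F oo (fps_const c * fps_X)"

definition moebius_mu :: "nat \<Rightarrow> rat" where
  "moebius_mu r = (if squarefree r then (- 1) ^ card (prime_factors r) else 0)"

end

theory Submission
  imports Defs "HOL-Algebra.Multiplicative_Group"
begin

text \<open>
  Write \<open>[u;c]\<close> for the monomial matrix whose nonzero entry in column \<open>j\<close> is \<open>c j\<close>, in row \<open>u j\<close>. The
  reflections of \<open>G(m,p,n)\<close> are of two kinds (\<open>reflections_Gmpn\<close>): the colored transpositions
  \<open>tref a b x\<close>, whose underlying permutation is a transposition, and the diagonal reflections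
  \<open>dref a z\<close>, with \<open>z\<close> an \<open>m/p\<close>-th root of unity. Forgetting the colors of the transpositions, but
  not those of the diagonal reflections, turns a word \<open>ts\<close> of reflections into its skeleton
  \<open>map skel ts\<close>. The formula comes from counting the skeletons of the full factorizations of \<open>g\<close>, and
  then the full factorizations that have a given skeleton; the second number depends on the skeleton
  only through its number \<open>M\<close> of transpositions.

  A factorization is full iff three conditions hold (\<open>fullness_necessary\<close>,
  \<open>fullness_sufficient\<close>): the underlying transpositions generate \<open>S\<^sub>n\<close>; the colors of the diagonal
  reflections generate \<open>G(m,p,1)\<close>; and for no divisor \<open>r > 1\<close> of \<open>p\<close> can all colors of the
  transpositions be made \<open>m/r\<close>-th roots of unity by conjugating with one diagonal matrix
  (\<open>trivial_mod\<close>). The first two conditions concern the skeleton alone. They say that it is a shuffle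
  of a full factorization of the permutation of \<open>g\<close> in \<open>S\<^sub>n\<close> with a word of diagonal reflections whose
  colors form a full factorization of the color of \<open>g\<close> in \<open>G(m,p,1)\<close>. The shuffling is the product of
  exponential generating functions, and since each diagonal reflection may act on any of the \<open>n\<close>
  coordinates, the variable of the second series is scaled by \<open>n\<close>.

  For a fixed word \<open>ts\<close> satisfying the first condition, the \<open>r\<close> dividing \<open>p\<close> modulo which the
  colors can be trivialized are the divisors of a single number, so summing \<open>\<mu>(r)\<close> over them tests the
  third condition (\<open>sum_moebius_trivial_mod\<close>). It remains to count, for \<open>r\<close> dividing \<open>p\<close>, the
  colorings of a skeleton that have product \<open>g\<close> and are trivial modulo \<open>r\<close>
  (\<open>card_trivial_mod_colorings\<close>). Count pairs of such a coloring and a diagonal matrix, modulo \<open>m/r\<close>-th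
  roots of unity, that trivializes it. Each coloring has \<open>r\<close> of them, because the transpositions act
  transitively. A diagonal matrix that trivializes a coloring trivializes \<open>g\<close>; there are \<open>r\<^sup>k\<close> that do
  so if \<open>r\<close> divides the color of every cycle of \<open>g\<close>, and none otherwise. Given the diagonal matrix, each
  transposition has \<open>m/r\<close> possible colors, and the \<open>(m/r)\<^sup>M\<close> colorings are equidistributed over
  the \<open>(m/r)\<^bsup>n-1\<^esup>\<close> products that have the right permutation, total color and trivialization
  (\<open>card_colorings\<close>). Hence there are \<open>r\<^bsup>k-1\<^esup> (m/r)\<^bsup>M-n+1\<^esup>\<close> colorings, which is the
  coefficient in the formula.
\<close>

section \<open>Monomial matrices\<close>

definition cmat :: "('n \<Rightarrow> 'n) \<Rightarrow> ('n \<Rightarrow> complex) \<Rightarrow> complex ^ 'n ^ 'n" where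
  "cmat u c = (\<chi> i j. if i = u j then c j else 0)"

definition entry :: "complex ^ 'n ^ 'n \<Rightarrow> 'n \<Rightarrow> complex" where
  "entry w j = w $ und_perm w j $ j"

lemma cmat_mult:
  fixes u v :: "'n::finite \<Rightarrow> 'n"
  shows "cmat u c ** cmat v e = cmat (u \<circ> v) (\<lambda>j. c (v j) * e j)"
proof -
  have "(\<Sum>k\<in>UNIV. (if i = u k then c k else 0) * (if k = v j then e j else 0))
      = (if i = u (v j) then c (v j) * e j else 0)" for i j
  proof -
    have "(\<Sum>k\<in>UNIV. (if i = u k then c k else 0) * (if k = v j then e j else 0))
        = (\<Sum>k\<in>UNIV. if k = v j then (if i = u k then c k else 0) * e j else 0)"
      by (intro sum.cong) auto
    then show ?thesis by (simp add: sum.delta)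
  qed
  then show ?thesis
    by (simp add: cmat_def matrix_matrix_mult_def vec_eq_iff)
qed

lemma mat_1_eq_cmat: "mat 1 = cmat id (\<lambda>_. 1)"
  by (simp add: mat_def cmat_def vec_eq_iff)

lemma cmat_mult_vec:
  fixes u :: "'n::finite \<Rightarrow> 'n"
  assumes "inj u"
  shows "(cmat u c *v v) $ u k = c k * v $ k"
proof -
  have "(\<Sum>j\<in>UNIV. (if u k = u j then c j else 0) * v $ j)
      = (\<Sum>j\<in>UNIV. if j = k then c j * v $ j else 0)"
    using assms by (intro sum.cong) (auto simp: inj_eq)
  then show ?thesis
    by (simp add: cmat_def matrix_vector_mult_def sum.delta)
qed

lemma und_perm_cmat:
  assumes "\<And>j. c j \<noteq> 0"
  shows "und_perm (cmat u c) = u"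
  using assms by (auto simp: und_perm_def cmat_def fun_eq_iff)

lemma entry_cmat:
  assumes "\<And>j. c j \<noteq> 0"
  shows "entry (cmat u c) = c"
  using assms by (simp add: entry_def und_perm_cmat fun_eq_iff) (simp add: cmat_def)

lemma monomial_mat_cmat:
  fixes u :: "'n::finite \<Rightarrow> 'n"
  assumes "bij u" "\<And>j. c j \<noteq> 0"
  shows "monomial_mat (cmat u c)"
  using assms unfolding monomial_mat_def cmat_def
  by (auto simp: bij_iff) metis

lemma monomial_mat_iff:
  fixes w :: "complex ^ 'n ^ 'n"
  shows "monomial_mat w \<longleftrightarrow> bij (und_perm w) \<and> (\<forall>j. entry w j \<noteq> 0) \<and> w = cmat (und_perm w) (entry w)"
proof
  assume w: "monomial_mat w"
  have ex1: "\<exists>!i. w $ i $ j \<noteq> 0" for j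
    using w by (simp add: monomial_mat_def)
  have nz: "w $ i $ j \<noteq> 0 \<longleftrightarrow> i = und_perm w j" for i j
    using theI'[OF ex1[of j]] ex1[of j] unfolding und_perm_def by blast
  have "bij (und_perm w)"
    unfolding bij_iff using w by (metis nz monomial_mat_def)
  moreover have "entry w j \<noteq> 0" for j
    using nz by (simp add: entry_def)
  moreover have "w = cmat (und_perm w) (entry w)"
    using nz by (auto simp: vec_eq_iff cmat_def entry_def)
  ultimately show "bij (und_perm w) \<and> (\<forall>j. entry w j \<noteq> 0) \<and> w = cmat (und_perm w) (entry w)"
    by blast
next
  assume "bij (und_perm w) \<and> (\<forall>j. entry w j \<noteq> 0) \<and> w = cmat (und_perm w) (entry w)"
  then show "monomial_mat w" using monomial_mat_cmat by metis
qed

lemma monomial_matD: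
  fixes w :: "complex ^ 'n ^ 'n"
  assumes "monomial_mat w"
  shows "bij (und_perm w)" "inj (und_perm w)" "entry w j \<noteq> 0" "cmat (und_perm w) (entry w) = w"
  using assms by (auto simp: monomial_mat_iff bij_is_inj)

lemma monomial_mat_eqI:
  assumes "monomial_mat v" "monomial_mat w" "\<And>j. und_perm v j = und_perm w j" "\<And>j. entry v j = entry w j"
  shows "v = w"
  using assms by (metis ext monomial_mat_iff)

lemma
  fixes v w :: "complex ^ 'n ^ 'n"
  assumes "monomial_mat v" "monomial_mat w"
  shows monomial_mat_mult: "monomial_mat (v ** w)"
    and und_perm_mult: "und_perm (v ** w) = und_perm v \<circ> und_perm w"
    and entry_mult: "entry (v ** w) j = entry v (und_perm w j) * entry w j"
proof -
  have eq: "v ** w = cmat (und_perm v \<circ> und_perm w) (\<lambda>j. entry v (und_perm w j) * entry w j)"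
    using cmat_mult[of "und_perm v" "entry v" "und_perm w" "entry w"] monomial_matD(4) assms by metis
  have nz: "entry v (und_perm w j) * entry w j \<noteq> 0" for j
    using assms monomial_matD by auto
  show "monomial_mat (v ** w)" unfolding eq
    by (rule monomial_mat_cmat) (use nz assms in \<open>auto intro: bij_comp monomial_matD\<close>)
  show "und_perm (v ** w) = und_perm v \<circ> und_perm w"
    unfolding eq by (rule und_perm_cmat) (use nz in auto)
  show "entry (v ** w) j = entry v (und_perm w j) * entry w j"
    unfolding eq by (subst entry_cmat) (use nz in auto)
qed

lemma
  shows monomial_mat_1: "monomial_mat (mat 1 :: complex ^ 'n ^ 'n)"
    and und_perm_1: "und_perm (mat 1 :: complex ^ 'n ^ 'n) = id"
    and entry_1: "entry (mat 1 :: complex ^ 'n ^ 'n) j = 1"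
  by (auto simp: mat_1_eq_cmat und_perm_cmat entry_cmat monomial_mat_cmat)

text \<open>
  The inverse, written down explicitly so that its permutation and its entries can be read off.
\<close>

definition cinv :: "complex ^ 'n ^ 'n \<Rightarrow> complex ^ 'n ^ 'n" where
  "cinv w = cmat (inv_into UNIV (und_perm w)) (\<lambda>j. 1 / entry w (inv_into UNIV (und_perm w) j))"

lemma
  fixes w :: "complex ^ 'n ^ 'n"
  assumes "monomial_mat w"
  shows monomial_mat_cinv: "monomial_mat (cinv w)"
    and und_perm_cinv: "und_perm (cinv w) = inv_into UNIV (und_perm w)"
    and entry_cinv: "entry (cinv w) j = 1 / entry w (inv_into UNIV (und_perm w) j)"
    and cinv_mult: "cinv w ** w = mat 1" "w ** cinv w = mat 1"
proof -
  have nz: "1 / entry w (inv_into UNIV (und_perm w) j) \<noteq> 0" for j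
    using assms monomial_matD by auto
  show m: "monomial_mat (cinv w)" unfolding cinv_def
    by (rule monomial_mat_cmat) (use nz assms in \<open>auto intro: bij_imp_bij_inv monomial_matD\<close>)
  show u: "und_perm (cinv w) = inv_into UNIV (und_perm w)"
    unfolding cinv_def by (rule und_perm_cmat) (use nz in auto)
  have e: "entry (cinv w) j = 1 / entry w (inv_into UNIV (und_perm w) j)" for j
    unfolding cinv_def by (subst entry_cmat) (use nz in auto)
  then show "entry (cinv w) j = 1 / entry w (inv_into UNIV (und_perm w) j)" .
  have b: "bij (und_perm w)" using assms monomial_matD by auto
  note s = m assms u e monomial_mat_1 monomial_mat_mult und_perm_mult entry_mult und_perm_1 entry_1
  show "cinv w ** w = mat 1"
    by (rule monomial_mat_eqI) (use b monomial_matD[OF assms] in \<open>auto simp: s inv_f_f bij_is_inj\<close>)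
  show "w ** cinv w = mat 1"
    by (rule monomial_mat_eqI) (use b monomial_matD[OF assms] in \<open>auto simp: s surj_f_inv_f bij_is_surj\<close>)
qed

definition color_prod :: "complex ^ 'n ^ 'n \<Rightarrow> complex" where
  "color_prod w = (\<Prod>j\<in>UNIV. entry w j)"

text \<open>
  Multiplicative, because permuting the factors does not change the product: this is the color
  homomorphism from \<open>G(m,1,n)\<close> to the \<open>m\<close>-th roots of unity.
\<close>

lemma color_prod_mult:
  fixes v w :: "complex ^ 'n ^ 'n"
  assumes "monomial_mat v" "monomial_mat w"
  shows "color_prod (v ** w) = color_prod v * color_prod w"
proof -
  have "(\<Prod>j\<in>UNIV. entry v (und_perm w j)) = (\<Prod>j\<in>UNIV. entry v j)"
    using monomial_matD(1)[OF assms(2)] by (rule prod.reindex_bij_betw)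
  then show ?thesis
    by (simp add: color_prod_def entry_mult[OF assms] prod.distrib)
qed

lemma color_prod_1: "color_prod (mat 1 :: complex ^ 'n ^ 'n) = 1"
  by (simp add: color_prod_def entry_1)

lemma Gmpn_iff:
  fixes w :: "complex ^ 'n ^ 'n"
  shows "w \<in> Gmpn m p \<longleftrightarrow>
    monomial_mat w \<and> (\<forall>j. entry w j ^ m = 1) \<and> color_prod w ^ (m div p) = 1"
proof (cases "monomial_mat w")
  case True
  have nz: "w $ i $ j \<noteq> 0 \<longleftrightarrow> i = und_perm w j" for i j
  proof -
    have "w $ i $ j = cmat (und_perm w) (entry w) $ i $ j" using monomial_matD(4)[OF True] by simp
    then show ?thesis using monomial_matD(3)[OF True, of j] by (simp add: cmat_def)
  qed
  have "(\<Prod>(i, j) \<in> {(i, j). w $ i $ j \<noteq> 0}. w $ i $ j) = (\<Prod>j\<in>UNIV. entry w j)"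
    by (rule prod.reindex_bij_witness[of _ "\<lambda>j. (und_perm w j, j)" snd]) (auto simp: nz entry_def)
  then show ?thesis
    using True by (auto simp: Gmpn_def color_prod_def nz entry_def)
qed (simp add: Gmpn_def)

lemma GmpnD:
  fixes w :: "complex ^ 'n ^ 'n"
  assumes "w \<in> Gmpn m p"
  shows "monomial_mat w" "entry w j ^ m = 1" "color_prod w ^ (m div p) = 1"
  using assms by (auto simp: Gmpn_iff)

lemma color_prod_cinv:
  fixes w :: "complex ^ 'n ^ 'n"
  assumes "monomial_mat w"
  shows "color_prod (cinv w) = 1 / color_prod w"
proof -
  have "color_prod (cinv w) * color_prod w = 1"
    using color_prod_mult[OF monomial_mat_cinv[OF assms] assms] cinv_mult[OF assms] color_prod_1 by metis
  then show ?thesis by (metis mult_zero_right nonzero_mult_div_cancel_right zero_neq_one)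
qed

lemma Gmpn_mult:
  fixes v w :: "complex ^ 'n ^ 'n"
  assumes "v \<in> Gmpn m p" "w \<in> Gmpn m p"
  shows "v ** w \<in> Gmpn m p"
  using assms by (simp add: Gmpn_iff monomial_mat_mult entry_mult color_prod_mult power_mult_distrib)

lemma Gmpn_1: "(mat 1 :: complex ^ 'n ^ 'n) \<in> Gmpn m p"
  by (simp add: Gmpn_iff monomial_mat_1 entry_1 color_prod_1)

lemma Gmpn_cinv:
  fixes w :: "complex ^ 'n ^ 'n"
  assumes "w \<in> Gmpn m p"
  shows "cinv w \<in> Gmpn m p"
  using assms by (simp add: Gmpn_iff monomial_mat_cinv entry_cinv color_prod_cinv power_divide)

lemma group_Gmpn: "Group.group (mat_group (Gmpn m p :: (complex ^ 'n ^ 'n) set))"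
proof (rule groupI)
  fix x :: "complex ^ 'n ^ 'n"
  assume "x \<in> carrier (mat_group (Gmpn m p))"
  then have "x \<in> Gmpn m p" by (simp add: mat_group_def)
  then show "\<exists>y\<in>carrier (mat_group (Gmpn m p)). y \<otimes>\<^bsub>mat_group (Gmpn m p)\<^esub> x = \<one>\<^bsub>mat_group (Gmpn m p)\<^esub>"
    using Gmpn_cinv[of x m p] cinv_mult[OF GmpnD(1), of x m p] by (auto simp: mat_group_def)
qed (auto simp: mat_group_def Gmpn_mult Gmpn_1 matrix_mul_assoc)

lemma finite_Gmpn:
  assumes "m > 0"
  shows "finite (Gmpn m p :: (complex ^ 'n ^ 'n) set)"
proof (rule finite_subset)
  show "Gmpn m p \<subseteq> (\<lambda>(u, c). cmat u c) ` (UNIV \<times> (PiE (UNIV :: 'n set) (\<lambda>_. {z. z ^ m = 1})))"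
  proof
    fix w :: "complex ^ 'n ^ 'n"
    assume w: "w \<in> Gmpn m p"
    then have "w = cmat (und_perm w) (entry w)" using monomial_matD(4)[OF GmpnD(1)] by metis
    then show "w \<in> (\<lambda>(u, c). cmat u c) ` (UNIV \<times> (PiE (UNIV :: 'n set) (\<lambda>_. {z. z ^ m = 1})))"
      using GmpnD(2)[OF w] by (intro image_eqI[where x = "(und_perm w, entry w)"]) auto
  qed
  show "finite ((\<lambda>(u, c). cmat u c) ` (UNIV \<times> (PiE (UNIV :: 'n set) (\<lambda>_. {z::complex. z ^ m = 1}))))"
    using assms by (intro finite_imageI finite_cartesian_product finite_PiE finite_roots_unity) auto
qed

section \<open>Subgroups generated by monomial matrices\<close>

abbreviation mprod :: "(complex ^ 'n ^ 'n) list \<Rightarrow> complex ^ 'n ^ 'n" where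
  "mprod ts \<equiv> foldr (**) ts (mat 1)"

lemma mprod_append: "mprod (xs @ ys) = mprod xs ** mprod ys"
  by (induction xs) (simp_all add: matrix_mul_assoc)

text \<open>
  In a finite group inverses are powers, so that products of generators suffice. Statements about a
  generated subgroup then follow by induction on a list of generators.
\<close>

lemma generate_Gmpn_eq_mprods:
  fixes T :: "(complex ^ 'n ^ 'n) set"
  assumes "m > 0" "T \<subseteq> Gmpn m p"
  shows "generate (mat_group (Gmpn m p)) T = {mprod ts | ts. set ts \<subseteq> T}"
proof -
  let ?G = "mat_group (Gmpn m p :: (complex ^ 'n ^ 'n) set)"
  interpret Group.group ?G by (rule group_Gmpn)
  have T: "T \<subseteq> carrier ?G" using assms by (simp add: mat_group_def)
  have sub: "mprod ts \<in> generate ?G T" if "set ts \<subseteq> T" for ts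
    using that
  proof (induction ts)
    case Nil
    then show ?case using generate.one[of ?G T] by (simp add: mat_group_def)
  next
    case (Cons t ts)
    then show ?case using generate.eng[of t ?G T "mprod ts"] generate.incl[of t T ?G]
      by (simp add: mat_group_def)
  qed
  have pow: "x [^]\<^bsub>?G\<^esub> (k::nat) = mprod (replicate k x)" for x k
  proof (induction k)
    case 0
    then show ?case by (simp add: mat_group_def)
  next
    case (Suc k)
    then show ?case
      using mprod_append[of "replicate k x" "[x]"]
      by (simp add: replicate_append_same mat_group_def)
  qed
  have "h \<in> {mprod ts | ts. set ts \<subseteq> T}" if "h \<in> generate ?G T" for h
    using that
  proof (induction rule: generate.induct)
    case one
    then show ?case by (auto simp: mat_group_def intro!: exI[of _ "[]"])
  next
    case (incl h)
    then show ?case by (auto intro!: exI[of _ "[h]"])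
  next
    case (inv h)
    have h: "h \<in> carrier ?G" using inv T by blast
    have fin: "finite (carrier ?G)" using finite_Gmpn[OF assms(1)] by (simp add: mat_group_def)
    have "inv\<^bsub>?G\<^esub> h \<in> generate ?G {h}" by (simp add: generate.inv)
    also have "\<dots> = {h [^]\<^bsub>?G\<^esub> k |k. k \<in> (UNIV :: nat set)}"
      by (rule generate_pow_on_finite_carrier[OF fin h])
    finally obtain k :: nat where "inv\<^bsub>?G\<^esub> h = mprod (replicate k h)" by (auto simp: pow)
    moreover have "set (replicate k h) \<subseteq> T" using inv by (auto simp: set_replicate_conv_if)
    ultimately show ?case by blast
  next
    case (eng h1 h2)
    then obtain a b where "h1 = mprod a" "h2 = mprod b" "set a \<subseteq> T" "set b \<subseteq> T" by auto
    then have "h1 ** h2 = mprod (a @ b)" "set (a @ b) \<subseteq> T" by (simp_all only: mprod_append set_append Un_subset_iff simp_thms)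
    moreover have "h1 \<otimes>\<^bsub>?G\<^esub> h2 = h1 ** h2" by (simp add: mat_group_def)
    ultimately show ?case by (metis (mono_tags, lifting) mem_Collect_eq)
  qed
  then show ?thesis using sub by blast
qed

section \<open>The reflections of \<open>G(m,p,n)\<close>\<close>

definition tref :: "'n \<Rightarrow> 'n \<Rightarrow> complex \<Rightarrow> complex ^ 'n ^ 'n" where
  "tref a b x = cmat (Transposition.transpose a b) (\<lambda>j. if j = a then x else if j = b then 1 / x else 1)"

definition dref :: "'n \<Rightarrow> complex \<Rightarrow> complex ^ 'n ^ 'n" where
  "dref a z = cmat id (\<lambda>j. if j = a then z else 1)"

lemma
  fixes a b :: "'n::finite"
  assumes "x \<noteq> 0"
  shows monomial_mat_tref: "monomial_mat (tref a b x)"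
    and und_perm_tref: "und_perm (tref a b x) = Transposition.transpose a b"
    and entry_tref: "entry (tref a b x) j = (if j = a then x else if j = b then 1 / x else 1)"
  using assms unfolding tref_def
  by (simp_all add: monomial_mat_cmat und_perm_cmat entry_cmat bij_transpose)

lemma
  fixes a :: "'n::finite"
  assumes "z \<noteq> 0"
  shows monomial_mat_dref: "monomial_mat (dref a z)"
    and und_perm_dref: "und_perm (dref a z) = id"
    and entry_dref: "entry (dref a z) j = (if j = a then z else 1)"
  using assms unfolding dref_def
  by (simp_all add: monomial_mat_cmat und_perm_cmat entry_cmat)

lemma prod_two_points:
  fixes a b :: "'n::finite" and x y :: "'a::comm_monoid_mult"
  assumes "a \<noteq> b"
  shows "(\<Prod>j\<in>UNIV. if j = a then x else if j = b then y else 1) = x * y"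
proof -
  have "(\<Prod>j\<in>UNIV. if j = a then x else if j = b then y else 1)
      = (\<Prod>j\<in>UNIV. (if j = a then x else 1) * (if j = b then y else 1))"
    using assms by (intro prod.cong) auto
  then show ?thesis by (simp add: prod.distrib)
qed

lemma color_prod_tref:
  fixes a b :: "'n::finite"
  assumes "x \<noteq> 0" "a \<noteq> b"
  shows "color_prod (tref a b x) = 1"
  using assms prod_two_points[OF assms(2), of x "1 / x"] by (simp add: color_prod_def entry_tref)

lemma color_prod_dref:
  fixes a :: "'n::finite"
  assumes "z \<noteq> 0"
  shows "color_prod (dref a z) = z"
  using assms by (simp add: color_prod_def entry_dref)

text \<open>
  The coordinates other than \<open>a\<close> and \<open>b\<close> determine the vectors of such a subspace, so the projection
  to them is injective. This is how elements are shown not to be reflections.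
\<close>

lemma dim_le_two_missing_coords:
  fixes S :: "('a::field ^ 'n) set"
  assumes S: "vec.subspace S" and "a \<noteq> b"
    and vanish: "\<And>v. v \<in> S \<Longrightarrow> (\<And>i. i \<noteq> a \<Longrightarrow> i \<noteq> b \<Longrightarrow> v $ i = 0) \<Longrightarrow> v = 0"
  shows "vec.dim S + 2 \<le> CARD('n)"
proof -
  define f :: "'a ^ 'n \<Rightarrow> 'a ^ 'n" where "f v = (\<chi> i. if i = a \<or> i = b then 0 else v $ i)" for v
  have lin: "Vector_Spaces.linear (*s) (*s) f"
    by unfold_locales (auto simp: f_def vec_eq_iff)
  have inj: "inj_on f S"
  proof (rule inj_onI)
    fix v w assume vw: "v \<in> S" "w \<in> S" "f v = f w"
    have "v - w = 0"
    proof (rule vanish)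
      show "v - w \<in> S" using S vw by (simp add: vec.subspace_diff)
      show "(v - w) $ i = 0" if "i \<noteq> a" "i \<noteq> b" for i
        using that arg_cong[OF vw(3), of "\<lambda>x. x $ i"] by (simp add: f_def)
    qed
    then show "v = w" by simp
  qed
  have "vec.dim S = vec.dim (f ` S)"
    by (rule vec.dim_image_eq[symmetric, OF lin]) (use inj S in \<open>simp add: vec.span_eq_iff[THEN iffD2]\<close>)
  also have "\<dots> \<le> vec.dim {x::'a ^ 'n. \<forall>i. i \<notin> UNIV - {a, b} \<longrightarrow> x $ i = 0}"
    by (rule vec.dim_subset) (auto simp: f_def)
  also have "\<dots> = card (UNIV - {a, b})" by (rule dim_substandard_cart)
  also have "\<dots> = CARD('n) - 2" using assms(2) by (subst card_Diff_subset) auto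
  finally have "vec.dim S \<le> CARD('n) - 2" .
  moreover have "card {a, b} \<le> CARD('n)" by (intro card_mono) auto
  ultimately show ?thesis using assms(2) by simp
qed

lemma fixed_vec_iff:
  fixes w :: "complex ^ 'n ^ 'n"
  assumes "monomial_mat w"
  shows "w *v v = v \<longleftrightarrow> (\<forall>k. v $ und_perm w k = entry w k * v $ k)"
proof -
  have *: "(w *v v) $ und_perm w k = entry w k * v $ k" for k
    using cmat_mult_vec[OF monomial_matD(2)[OF assms], of "entry w" v k] monomial_matD(4)[OF assms] by simp
  show ?thesis
  proof
    show "\<forall>k. v $ und_perm w k = entry w k * v $ k" if "w *v v = v"
      using * that by metis
    show "w *v v = v" if "\<forall>k. v $ und_perm w k = entry w k * v $ k"
      using * that monomial_matD(1)[OF assms] by (metis bij_pointE vec_eq_iff)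
  qed
qed

lemma subspace_fixed: "vec.subspace {v. (w :: complex ^ 'n ^ 'n) *v v = v}"
  by (auto simp: vec.subspace_def matrix_vector_right_distrib vector_scalar_commute)

text \<open>
  A vector fixed by \<open>w\<close> satisfies \<open>v (u k) = c k * v k\<close>: its coordinates on a cycle of \<open>u\<close> are determined
  by a single one of them, and vanish if the color of the cycle is nontrivial. For \<open>w\<close> other than the identity, two
  coordinates are redundant unless there is only one transposition, of color 1, and all else is fixed with
  trivial color, or all points are fixed and just one of them has nontrivial color.
\<close>

lemma codim_1_cases:
  fixes w :: "complex ^ 'n ^ 'n"
  assumes w: "monomial_mat w" and dim: "vec.dim {v. w *v v = v} + 1 = CARD('n)"
  shows "(\<exists>a b. a \<noteq> b \<and> w = tref a b (entry w a)) \<or> (\<exists>a. entry w a \<noteq> 1 \<and> w = dref a (entry w a))"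
proof -
  let ?u = "und_perm w" and ?c = "entry w"
  let ?S = "{v. w *v v = v}"
  note D = monomial_matD[OF w]
  have inj: "?u i = ?u j \<longleftrightarrow> i = j" for i j using D(2) by (simp add: inj_eq)
  have no_pair: False
    if ab: "a \<noteq> b"
      and van: "\<And>v. \<lbrakk>\<And>i. i \<noteq> a \<Longrightarrow> i \<noteq> b \<Longrightarrow> v $ i = 0; \<And>k. v $ ?u k = ?c k * v $ k\<rbrakk>
        \<Longrightarrow> v $ a = 0 \<and> v $ b = 0" for a b
  proof -
    have "vec.dim ?S + 2 \<le> CARD('n)"
    proof (rule dim_le_two_missing_coords[OF subspace_fixed ab])
      fix v assume v: "v \<in> ?S" and off: "\<And>i. i \<noteq> a \<Longrightarrow> i \<noteq> b \<Longrightarrow> v $ i = 0"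
      have "v $ a = 0 \<and> v $ b = 0"
        using van[OF off] v by (simp add: fixed_vec_iff[OF w])
      then show "v = 0" using off by (simp add: vec_eq_iff) metis
    qed
    then show False using dim by simp
  qed
  show ?thesis
  proof (cases "\<exists>i. ?u i \<noteq> i")
    case True
    then obtain i where i: "?u i \<noteq> i" by blast
    define j where "j = ?u i"
    have ij: "i \<noteq> j" using i by (simp add: j_def)
    have uj: "?u j = i"
    proof (rule ccontr)
      assume ne: "?u j \<noteq> i"
      show False
      proof (rule no_pair[of j "?u j"])
        show "j \<noteq> ?u j" using i inj by (simp add: j_def)
        fix v :: "complex ^ 'n"
        assume off: "\<And>k. k \<noteq> j \<Longrightarrow> k \<noteq> ?u j \<Longrightarrow> v $ k = 0" and f: "\<And>k. v $ ?u k = ?c k * v $ k"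
        have "v $ i = 0" using off ij ne by auto
        then show "v $ j = 0 \<and> v $ ?u j = 0" using f[of i] f[of j] by (simp add: j_def)
      qed
    qed
    have rest: "?u k = k \<and> ?c k = 1" if k: "k \<noteq> i" "k \<noteq> j" for k
    proof (rule ccontr)
      assume "\<not> ?thesis"
      then consider "?u k \<noteq> k" | "?u k = k" "?c k \<noteq> 1" by blast
      then show False
      proof cases
        case 1
        show False
        proof (rule no_pair[of j "?u k"])
          show "j \<noteq> ?u k" using inj k by (auto simp: j_def)
          fix v :: "complex ^ 'n"
          assume off: "\<And>l. l \<noteq> j \<Longrightarrow> l \<noteq> ?u k \<Longrightarrow> v $ l = 0" and f: "\<And>l. v $ ?u l = ?c l * v $ l"
          have "i \<noteq> ?u k" using inj[of j k] uj k by auto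
          then have "v $ i = 0" "v $ k = 0" using off ij 1 k by auto
          then show "v $ j = 0 \<and> v $ ?u k = 0" using f[of i] f[of k] by (simp add: j_def)
        qed
      next
        case 2
        show False
        proof (rule no_pair[of j k])
          show "j \<noteq> k" using k by simp
          fix v :: "complex ^ 'n"
          assume off: "\<And>l. l \<noteq> j \<Longrightarrow> l \<noteq> k \<Longrightarrow> v $ l = 0" and f: "\<And>l. v $ ?u l = ?c l * v $ l"
          have "v $ i = 0" using off ij k by auto
          then show "v $ j = 0 \<and> v $ k = 0" using f[of i] f[of k] 2 by (simp add: j_def)
        qed
      qed
    qed
    have cc: "?c i * ?c j = 1"
    proof (rule ccontr)
      assume ne: "?c i * ?c j \<noteq> 1"
      show False
      proof (rule no_pair[OF ij])
        fix v :: "complex ^ 'n"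
        assume f: "\<And>l. v $ ?u l = ?c l * v $ l"
        have "v $ j = ?c i * v $ i" "v $ i = ?c j * v $ j" using f[of i] f[of j] uj by (simp_all add: j_def)
        then have "v $ i = (?c i * ?c j) * v $ i" by (metis mult.assoc mult.commute)
        then have "v $ i = 0" using ne by simp
        then show "v $ i = 0 \<and> v $ j = 0" using \<open>v $ j = ?c i * v $ i\<close> by simp
      qed
    qed
    have "w = tref i j (?c i)"
    proof (rule monomial_mat_eqI[OF w])
      show "monomial_mat (tref i j (?c i))" by (rule monomial_mat_tref) (use D in auto)
      fix k
      show "?u k = und_perm (tref i j (?c i)) k"
        using D rest uj by (auto simp: und_perm_tref Transposition.transpose_def j_def)
      show "?c k = entry (tref i j (?c i)) k"
        using D rest cc ij by (auto simp: entry_tref field_simps)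
    qed
    then show ?thesis using ij by blast
  next
    case False
    then have uid: "?u = id" by auto
    have "\<exists>a. ?c a \<noteq> 1"
    proof (rule ccontr)
      assume "\<nexists>a. ?c a \<noteq> 1"
      then have "?S = {x. \<forall>i. i \<notin> UNIV \<longrightarrow> x$i = 0}" by (auto simp: fixed_vec_iff[OF w] uid)
      then show False using dim dim_substandard_cart[of "UNIV :: 'n set", where ?'a = complex] by simp
    qed
    then obtain a where a: "?c a \<noteq> 1" by blast
    have b: "?c b = 1" if "b \<noteq> a" for b
    proof (rule ccontr)
      assume cb: "?c b \<noteq> 1"
      show False
      proof (rule no_pair[OF that])
        fix v :: "complex ^ 'n"
        assume f: "\<And>l. v $ ?u l = ?c l * v $ l"
        show "v $ b = 0 \<and> v $ a = 0" using f[of a] f[of b] a cb by (simp add: uid)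
      qed
    qed
    have "w = dref a (?c a)"
    proof (rule monomial_mat_eqI[OF w])
      show "monomial_mat (dref a (?c a))" by (rule monomial_mat_dref) (use D in auto)
      fix k
      show "?u k = und_perm (dref a (?c a)) k" using D by (simp add: und_perm_dref uid)
      show "?c k = entry (dref a (?c a)) k" using D b by (auto simp: entry_dref)
    qed
    then show ?thesis using a by blast
  qed
qed

lemma dim_fixed_dref:
  fixes a :: "'n::finite"
  assumes "z \<noteq> 0" "z \<noteq> 1"
  shows "vec.dim {v. dref a z *v v = v} + 1 = CARD('n)"
proof -
  have "{v. dref a z *v v = v} = {x. \<forall>i. i \<notin> UNIV - {a} \<longrightarrow> x$i = 0}"
    using assms by (auto simp: fixed_vec_iff monomial_mat_dref und_perm_dref entry_dref)
  then show ?thesis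
    using dim_substandard_cart[of "UNIV - {a}", where ?'a = complex]
    by (simp add: card_Diff_subset)
qed

text \<open>
  The fixed space is the hyperplane \<open>v b = x * v a\<close>, a linear image of the hyperplane \<open>v b = 0\<close>.
\<close>

lemma dim_fixed_tref:
  fixes a b :: "'n::finite"
  assumes x: "x \<noteq> 0" and ab: "a \<noteq> b"
  shows "vec.dim {v. tref a b x *v v = v} + 1 = CARD('n)"
proof -
  let ?E = "{v :: complex ^ 'n. \<forall>i. i \<notin> UNIV - {b} \<longrightarrow> v$i = 0}"
  define f :: "complex ^ 'n \<Rightarrow> complex ^ 'n" where "f v = (\<chi> i. if i = b then x * v $ a else v $ i)" for v
  have lin: "Vector_Spaces.linear (*s) (*s) f"
    by unfold_locales (auto simp: f_def vec_eq_iff algebra_simps)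
  have E: "vec.subspace ?E" by (auto simp: vec.subspace_def)
  have inj: "inj_on f ?E"
  proof (rule inj_onI)
    fix v w assume "v \<in> ?E" "w \<in> ?E" "f v = f w"
    then have "v $ i = w $ i" for i
    proof (cases "i = b")
      case True
      then show ?thesis using \<open>v \<in> ?E\<close> \<open>w \<in> ?E\<close> by simp
    next
      case False
      have "f v $ i = f w $ i" using \<open>f v = f w\<close> by simp
      then show ?thesis using False by (simp add: f_def)
    qed
    then show "v = w" by (simp add: vec_eq_iff)
  qed
  have fix_iff: "tref a b x *v v = v \<longleftrightarrow> v $ b = x * v $ a" for v :: "complex ^ 'n"
  proof
    assume "tref a b x *v v = v"
    then have "v $ und_perm (tref a b x) a = entry (tref a b x) a * v $ a"
      using fixed_vec_iff[OF monomial_mat_tref[OF x]] by blast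
    then show "v $ b = x * v $ a" using x by (simp add: und_perm_tref entry_tref)
  next
    assume "v $ b = x * v $ a"
    then show "tref a b x *v v = v"
      using x ab by (auto simp: fixed_vec_iff monomial_mat_tref und_perm_tref entry_tref
          Transposition.transpose_def)
  qed
  have img: "f ` ?E = {v. tref a b x *v v = v}"
  proof (intro equalityI subsetI)
    fix v assume "v \<in> f ` ?E"
    then show "v \<in> {v. tref a b x *v v = v}" using ab by (auto simp: fix_iff f_def)
  next
    fix v assume "v \<in> {v. tref a b x *v v = v}"
    then have "v $ b = x * v $ a" by (simp only: fix_iff mem_Collect_eq)
    then have "v = f (\<chi> i. if i = b then 0 else v $ i)"
      using ab by (simp add: f_def vec_eq_iff)
    then show "v \<in> f ` ?E" by (intro image_eqI) auto
  qed
  have "vec.span ?E = ?E" using E by (rule vec.span_eq_iff[THEN iffD2])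
  then have "vec.dim (f ` ?E) = vec.dim ?E"
    using inj by (intro vec.dim_image_eq[OF lin]) (simp only:)
  then have "vec.dim {v. tref a b x *v v = v} = vec.dim ?E" by (simp only: img)
  then show ?thesis
    using dim_substandard_cart[of "UNIV - {b}", where ?'a = complex]
    by (simp add: card_Diff_subset)
qed

lemma reflections_Gmpn:
  assumes "m > 0"
  shows "reflections (Gmpn m p :: (complex ^ 'n ^ 'n) set) =
    {tref a b x | a b x. a \<noteq> b \<and> x ^ m = 1} \<union> {dref a z | a z. z \<noteq> 1 \<and> z ^ m = 1 \<and> z ^ (m div p) = 1}"
    (is "?R = ?T \<union> ?D")
proof (intro equalityI subsetI)
  fix w :: "complex ^ 'n ^ 'n"
  assume "w \<in> ?R"
  then have w: "w \<in> Gmpn m p" and dim: "vec.dim {v. w *v v = v} + 1 = CARD('n)"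
    by (auto simp: reflections_def)
  note c = GmpnD(2)[OF w]
  from codim_1_cases[OF GmpnD(1)[OF w] dim] show "w \<in> ?T \<union> ?D"
  proof (elim disjE exE conjE)
    fix a b assume "a \<noteq> b" "w = tref a b (entry w a)"
    then show ?thesis using c[of a] by blast
  next
    fix a assume a: "entry w a \<noteq> 1" "w = dref a (entry w a)"
    have "color_prod w = entry w a"
      using color_prod_dref[of "entry w a" a] a(2) monomial_matD(3)[OF GmpnD(1)[OF w]] by simp
    then have "entry w a ^ (m div p) = 1" using GmpnD(3)[OF w] by simp
    then show ?thesis using a c[of a] by blast
  qed
next
  fix w :: "complex ^ 'n ^ 'n"
  assume "w \<in> ?T \<union> ?D"
  then consider a b x where "a \<noteq> b" "x ^ m = 1" "w = tref a b x"
    | a z where "z \<noteq> 1" "z ^ m = 1" "z ^ (m div p) = 1" "w = dref a z" by blast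
  then show "w \<in> ?R"
  proof cases
    case 1
    then have x: "x \<noteq> 0" using assms by (auto simp: zero_power)
    show ?thesis using x 1
      by (simp add: reflections_def dim_fixed_tref[simplified] Gmpn_iff monomial_mat_tref
          entry_tref color_prod_tref power_divide)
  next
    case 2
    then have x: "z \<noteq> 0" using assms by (auto simp: zero_power)
    show ?thesis using x 2
      by (simp add: reflections_def dim_fixed_dref[simplified] Gmpn_iff monomial_mat_dref
          entry_dref color_prod_dref)
  qed
qed

section \<open>Roots of unity, shuffles, Moebius sums and cycles\<close>

abbreviation unity_roots :: "nat \<Rightarrow> complex set" where
  "unity_roots m \<equiv> {z. z ^ m = 1}"

lemma zeta_power_eq_1_iff:
  assumes "m > 0"
  shows "zeta m ^ a = 1 \<longleftrightarrow> m dvd a"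
proof -
  have "zeta m ^ a = exp (2 * of_real pi * \<i> * of_nat a / of_nat m)"
    unfolding zeta_def by (simp add: exp_of_nat_mult[symmetric] algebra_simps)
  then show ?thesis using assms by (simp add: complex_root_unity_eq_1)
qed

lemma zeta_nonzero: "zeta m \<noteq> 0"
  by (simp add: zeta_def)

lemma unity_roots_subset_iff:
  assumes "k > 0"
  shows "unity_roots k \<subseteq> unity_roots m \<longleftrightarrow> k dvd m"
proof
  assume "unity_roots k \<subseteq> unity_roots m"
  moreover have "zeta k \<in> unity_roots k" using zeta_power_eq_1_iff[OF assms, of k] by simp
  ultimately show "k dvd m" using zeta_power_eq_1_iff[OF assms, of m] by blast
qed (auto simp: power_mult)

lemma unity_roots_nonzero:
  assumes "m > 0" "z ^ m = (1 :: complex)"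
  shows "z \<noteq> 0"
  using assms by (auto simp: zero_power)

text \<open>
  If \<open>K\<close> has \<open>k\<close> elements, multiplying all of them by \<open>z \<in> K\<close> permutes \<open>K\<close>. Comparing the products over
  \<open>K\<close> gives \<open>z ^ k = 1\<close>, and there are only \<open>k\<close> such numbers.
\<close>

lemma unity_roots_closed_subset:
  assumes "m > 0" and K: "K \<subseteq> unity_roots m" "1 \<in> K" "\<And>x y. x \<in> K \<Longrightarrow> y \<in> K \<Longrightarrow> x * y \<in> K"
  obtains k where "k dvd m" "k > 0" "K = unity_roots k"
proof -
  have fin: "finite K" using K(1) finite_roots_unity[of m] assms(1) by (auto intro: finite_subset)
  define k where "k = card K"
  have k: "k > 0" using fin K(2) by (auto simp: k_def card_gt_0_iff)
  have nz: "x \<noteq> 0" if "x \<in> K" for x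
    using that K(1) unity_roots_nonzero[OF assms(1)] by auto
  have "z ^ k = 1" if z: "z \<in> K" for z
  proof -
    have inj: "inj_on ((*) z) K" using nz[OF z] by (auto simp: inj_on_def)
    have "(*) z ` K = K"
      using inj K(3) z fin by (intro card_subset_eq) (auto simp: card_image)
    then have "bij_betw ((*) z) K K" using inj by (simp add: bij_betw_def)
    then have "(\<Prod>x\<in>K. z * x) = \<Prod>K" by (rule prod.reindex_bij_betw)
    then have "z ^ k * \<Prod>K = \<Prod>K" by (simp add: prod.distrib k_def)
    then show ?thesis using nz fin by auto
  qed
  then have "K \<subseteq> unity_roots k" by blast
  then have eq: "K = unity_roots k"
    using k card_roots_unity_eq[OF k] finite_roots_unity[of k] by (intro card_subset_eq) (auto simp: k_def)
  then have "k dvd m" using K(1) unity_roots_subset_iff[OF k] by blast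
  then show ?thesis using that k eq by blast
qed

lemma card_lists_map_eq:
  assumes "finite A"
  shows "card {xs. set xs \<subseteq> A \<and> map f xs = ys} = (\<Prod>y\<leftarrow>ys. card {x \<in> A. f x = y})"
proof (induction ys)
  case Nil
  have "{xs. set xs \<subseteq> A \<and> map f xs = []} = {[]}" by auto
  then show ?case by simp
next
  case (Cons y ys)
  have "{xs. set xs \<subseteq> A \<and> map f xs = y # ys}
      = (\<lambda>(x, xs). x # xs) ` ({x \<in> A. f x = y} \<times> {xs. set xs \<subseteq> A \<and> map f xs = ys})"
    by (auto simp: image_def map_eq_Cons_conv)
  moreover have "inj_on (\<lambda>(x, xs). x # xs) ({x \<in> A. f x = y} \<times> {xs. set xs \<subseteq> A \<and> map f xs = ys})"
    by (auto simp: inj_on_def)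
  ultimately show ?case
    using Cons.IH by (simp add: card_image card_cartesian_product)
qed

lemma finite_lists_map_eq:
  assumes "finite A"
  shows "finite {xs. set xs \<subseteq> A \<and> map f xs = ys}"
  by (rule finite_subset[OF _ finite_lists_length_eq[OF assms, of "length ys"]]) auto

text \<open>
  Splitting a word over \<open>A \<union> B\<close> into its two subwords has the set of their shuffles as its fibre. Hence
  the counts of the subwords are combined as in a product of exponential generating functions.
\<close>

lemma card_shuffled_lists:
  assumes "A \<inter> B = {}"
    and X: "finite X" "\<And>xs. xs \<in> X \<Longrightarrow> length xs = L \<and> set xs \<subseteq> A"
    and Y: "finite Y" "\<And>ys. ys \<in> Y \<Longrightarrow> length ys = M \<and> set ys \<subseteq> B"
  shows "card {ws. set ws \<subseteq> A \<union> B \<and> filter (\<lambda>w. w \<in> A) ws \<in> X \<and> filter (\<lambda>w. w \<in> B) ws \<in> Y}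
    = ((L + M) choose L) * card X * card Y"
proof -
  let ?W = "{ws. set ws \<subseteq> A \<union> B \<and> filter (\<lambda>w. w \<in> A) ws \<in> X \<and> filter (\<lambda>w. w \<in> B) ws \<in> Y}"
  have notin: "filter (\<lambda>w. w \<in> B) ws = filter (\<lambda>w. w \<notin> A) ws" if "set ws \<subseteq> A \<union> B" for ws
    using that assms(1) by (intro filter_cong) auto
  have unshuffle: "filter (\<lambda>w. w \<in> A) zs = xs \<and> filter (\<lambda>w. w \<in> B) zs = ys \<and> set zs \<subseteq> A \<union> B"
    if "xs \<in> X" "ys \<in> Y" "zs \<in> shuffles xs ys" for xs ys zs
  proof -
    have set_zs: "set zs = set xs \<union> set ys" using that(3) by (rule set_shuffles)
    have sub: "set xs \<subseteq> A" "set ys \<subseteq> B" using that X Y by auto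
    have disj: "set xs \<inter> set ys = {}" using sub assms(1) by auto
    have "filter (\<lambda>w. w \<in> A) zs = filter (\<lambda>w. w \<in> set xs) zs"
      using set_zs sub assms(1) by (intro filter_cong) auto
    moreover have "filter (\<lambda>w. w \<in> B) zs = filter (\<lambda>w. w \<in> set ys) zs"
      using set_zs sub assms(1) by (intro filter_cong) auto
    ultimately show ?thesis
      using filter_shuffles_disjoint1(1)[OF disj that(3)] filter_shuffles_disjoint2(1)[OF disj that(3)] set_zs sub
      by auto
  qed
  have "?W = (\<Union>q\<in>X \<times> Y. shuffles (fst q) (snd q))"
  proof (intro equalityI subsetI)
    fix ws assume ws: "ws \<in> ?W"
    then have "ws \<in> shuffles (filter (\<lambda>w. w \<in> A) ws) (filter (\<lambda>w. w \<in> B) ws)"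
      using partition_in_shuffles[of ws "\<lambda>w. w \<in> A"] by (simp add: notin)
    then show "ws \<in> (\<Union>q\<in>X \<times> Y. shuffles (fst q) (snd q))" using ws by force
  next
    fix ws assume "ws \<in> (\<Union>q\<in>X \<times> Y. shuffles (fst q) (snd q))"
    then show "ws \<in> ?W" using unshuffle by fastforce
  qed
  also have "card \<dots> = (\<Sum>q\<in>X \<times> Y. card (shuffles (fst q) (snd q)))"
  proof (rule card_UN_disjoint)
    show "finite (X \<times> Y)" using X Y by blast
    show "\<forall>q\<in>X \<times> Y. finite (shuffles (fst q) (snd q))" by simp
    show "\<forall>q\<in>X \<times> Y. \<forall>q'\<in>X \<times> Y. q \<noteq> q' \<longrightarrow> shuffles (fst q) (snd q) \<inter> shuffles (fst q') (snd q') = {}"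
    proof (intro ballI impI equals0I)
      fix q q' zs assume "q \<in> X \<times> Y" "q' \<in> X \<times> Y" "q \<noteq> q'"
        and "zs \<in> shuffles (fst q) (snd q) \<inter> shuffles (fst q') (snd q')"
      then show False
        using unshuffle[of "fst q" "snd q" zs] unshuffle[of "fst q'" "snd q'" zs] by (auto simp: prod_eq_iff)
    qed
  qed
  also have "\<dots> = (\<Sum>q\<in>X \<times> Y. (L + M) choose L)"
  proof (rule sum.cong[OF refl])
    fix q assume "q \<in> X \<times> Y"
    then have q: "length (fst q) = L" "set (fst q) \<subseteq> A" "length (snd q) = M" "set (snd q) \<subseteq> B"
      using X(2)[of "fst q"] Y(2)[of "snd q"] by auto
    then have "set (fst q) \<inter> set (snd q) = {}" using assms(1) by blast
    then show "card (shuffles (fst q) (snd q)) = (L + M) choose L"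
      using q by (simp add: card_disjoint_shuffles)
  qed
  finally show ?thesis by (simp add: card_cartesian_product)
qed

text \<open>
  For a prime \<open>q\<close> dividing \<open>e\<close>, multiplication by \<open>q\<close> pairs the squarefree divisors of \<open>e\<close> that are prime to
  \<open>q\<close> with those divisible by \<open>q\<close>, and reverses the sign.
\<close>

lemma sum_moebius_mu_divisors:
  assumes "e > 0"
  shows "(\<Sum>r | r dvd e. moebius_mu r) = (if e = 1 then 1 else 0)"
proof (cases "e = 1")
  case True
  then have "{r. r dvd e} = {1}" by auto
  then show ?thesis using True by (simp add: moebius_mu_def)
next
  case False
  then obtain q where q: "prime q" "q dvd e" using prime_factor_nat by blast
  have q0: "q > 0" using prime_gt_0_nat[OF q(1)] .
  let ?A = "{r. r dvd e \<and> squarefree r \<and> \<not> q dvd r}" and ?B = "{r. r dvd e \<and> squarefree r \<and> q dvd r}"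
  have fin: "finite {r. r dvd e}" using assms by simp
  have B: "?B = (*) q ` ?A"
  proof (intro equalityI subsetI)
    fix r assume r: "r \<in> ?B"
    then obtain s where s: "r = q * s" by blast
    have "\<not> q dvd s"
    proof
      assume "q dvd s"
      then have "q ^ 2 dvd r" by (simp add: s power2_eq_square)
      then have "q dvd 1" using r squarefreeD by blast
      then show False using q(1) by simp
    qed
    moreover have "s dvd e" "squarefree s"
      using r s dvd_mult_right squarefree_multD by blast+
    ultimately show "r \<in> (*) q ` ?A" using s by blast
  next
    fix r assume "r \<in> (*) q ` ?A"
    then obtain s where s: "r = q * s" "s dvd e" "squarefree s" "\<not> q dvd s" by blast
    then have "coprime q s" using q(1) prime_imp_coprime by blast
    then show "r \<in> ?B"
      using s q squarefree_mult_coprime[of q s] squarefree_prime[of q] divides_mult[of q e s] by simp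
  qed
  have mu: "moebius_mu (q * r) = - moebius_mu r" if "r \<in> ?A" for r
  proof -
    have r0: "r \<noteq> 0"
    proof
      assume "r = 0"
      with that show False by simp
    qed
    have "prime_factors (q * r) = insert q (prime_factors r)"
      using q(1) r0 q0 by (simp add: prime_factorization_mult prime_factorization_prime)
    moreover have "q \<notin> prime_factors r" using that by auto
    moreover have "q * r \<in> ?B" using B that by blast
    ultimately show ?thesis using that by (simp add: moebius_mu_def)
  qed
  have "(\<Sum>r | r dvd e. moebius_mu r) = (\<Sum>r\<in>?A \<union> ?B. moebius_mu r)"
    using fin by (intro sum.mono_neutral_right) (auto simp: moebius_mu_def)
  also have "\<dots> = (\<Sum>r\<in>?A. moebius_mu r) + (\<Sum>r\<in>?B. moebius_mu r)"
    using fin by (intro sum.union_disjoint) auto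
  also have "(\<Sum>r\<in>?B. moebius_mu r) = (\<Sum>r\<in>?A. moebius_mu (q * r))"
    unfolding B using q0 by (subst sum.reindex) (auto simp: inj_on_def)
  also have "\<dots> = - (\<Sum>r\<in>?A. moebius_mu r)"
    using mu by (simp add: sum_negf)
  finally show ?thesis using False by simp
qed

lemma orbit_const:
  assumes "\<And>j. z (u j) = z j" "i \<in> orbit u j"
  shows "z i = z j"
  using assms(2) by induction (use assms(1) in auto)

lemma bij_imp_permutation: "bij (u :: 'n::finite \<Rightarrow> 'n) \<Longrightarrow> permutation u"
  by (simp add: permutation)

lemma orbit_eq_orbit:
  fixes u :: "'n::finite \<Rightarrow> 'n"
  assumes "bij u" "i \<in> orbit u j"
  shows "orbit u i = orbit u j"
  using assms(2)
  by induction (simp_all add: permutation_orbit_step bij_imp_permutation[OF assms(1)])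

lemma card_functions_constant_on_orbits:
  fixes u :: "'n::finite \<Rightarrow> 'n"
  assumes "bij u" "finite A"
  shows "card {z. (\<forall>j. z j \<in> A) \<and> (\<forall>j. z (u j) = z j)} = card A ^ card (range (orbit u))"
proof -
  let ?Z = "{z. (\<forall>j. z j \<in> A) \<and> (\<forall>j. z (u j) = z j)}"
  note perm = bij_imp_permutation[OF assms(1)]
  have self: "j \<in> orbit u j" for j using perm by (rule permutation_self_in_orbit)
  have "bij_betw (\<lambda>h j. h (orbit u j)) (PiE (range (orbit u)) (\<lambda>_. A)) ?Z"
  proof (rule bij_betwI')
    fix h h' assume h: "h \<in> PiE (range (orbit u)) (\<lambda>_. A)" "h' \<in> PiE (range (orbit u)) (\<lambda>_. A)"
    show "((\<lambda>j. h (orbit u j)) = (\<lambda>j. h' (orbit u j))) = (h = h')"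
    proof
      assume eq: "(\<lambda>j. h (orbit u j)) = (\<lambda>j. h' (orbit u j))"
      then have "h S = h' S" if "S \<in> range (orbit u)" for S
        using that fun_cong[OF eq] by (elim rangeE) (simp only:)
      then show "h = h'" using h by (intro PiE_ext) auto
    qed simp
  next
    fix h assume "h \<in> PiE (range (orbit u)) (\<lambda>_. A)"
    then show "(\<lambda>j. h (orbit u j)) \<in> ?Z"
      by (auto simp: permutation_orbit_step[OF perm] dest: PiE_mem)
  next
    fix z assume z: "z \<in> ?Z"
    define h where "h = restrict (\<lambda>S. z (SOME j. orbit u j = S)) (range (orbit u))"
    have "z j = h (orbit u j)" for j
    proof -
      define i where "i = (SOME i. orbit u i = orbit u j)"
      have "orbit u i = orbit u j" unfolding i_def by (rule someI) simp
      with self[of i] have "i \<in> orbit u j" by (rule subst[rotated])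
      then have "z i = z j" by (rule orbit_const[rotated]) (use z in blast)
      then show ?thesis by (simp add: h_def i_def)
    qed
    moreover have "h \<in> PiE (range (orbit u)) (\<lambda>_. A)" using z by (auto simp: h_def)
    ultimately show "\<exists>h\<in>PiE (range (orbit u)) (\<lambda>_. A). z = (\<lambda>j. h (orbit u j))" by blast
  qed
  then have "card ?Z = card (PiE (range (orbit u)) (\<lambda>_. A))" by (rule bij_betw_same_card[symmetric])
  then show ?thesis by (simp add: card_PiE)
qed

text \<open>
  Choose \<open>y = 1\<close> at one point of each cycle and multiply by the values of \<open>C\<close> while walking along the
  cycle. The hypothesis on the products over cycles says that the value is 1 again after a full turn.
\<close>

lemma orbit_coboundary_exists:
  fixes u :: "'n::finite \<Rightarrow> 'n" and C :: "'n \<Rightarrow> 'a::comm_monoid_mult"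
  assumes u: "bij u" and cyc: "\<And>S. S \<in> range (orbit u) \<Longrightarrow> (\<Prod>j\<in>S. C j) = 1"
    and A: "1 \<in> A" "\<And>j. C j \<in> A" "\<And>x y. x \<in> A \<Longrightarrow> y \<in> A \<Longrightarrow> x * y \<in> A"
  shows "\<exists>y. \<forall>j. y j \<in> A \<and> y (u j) = C j * y j"
proof -
  note perm = bij_imp_permutation[OF u]
  have self: "j \<in> orbit u j" for j using perm by (rule permutation_self_in_orbit)
  define rep where "rep j = (SOME i. i \<in> orbit u j)" for j
  define y where "y j = (\<Prod>t<funpow_dist u (rep j) j. C ((u ^^ t) (rep j)))" for j
  have rep_in: "rep j \<in> orbit u j" for j unfolding rep_def by (rule someI) (rule self)
  have rep_eq: "rep i = rep j" if "i \<in> orbit u j" for i j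
    by (simp add: rep_def orbit_eq_orbit[OF u that])
  have A_prod: "(\<Prod>t<n. C (g t)) \<in> A" for n :: nat and g
    by (induction n) (auto simp: A mult.commute[of _ "C _"])
  have "y (u j) = C j * y j" for j
  proof -
    define i where "i = rep j"
    have ij: "orbit u i = orbit u j" using rep_in[of j] by (simp add: i_def orbit_eq_orbit[OF u])
    define L where "L = funpow_dist1 u i i"
    have inj: "inj_on (\<lambda>n. (u ^^ n) i) {0..<L}" unfolding L_def by (rule inj_on_funpow_dist1[OF self])
    have orb: "orbit u i = (\<lambda>n. (u ^^ n) i) ` {0..<L}" unfolding L_def by (rule orbit_conv_funpow_dist1[OF self])
    have L: "(u ^^ L) i = i" unfolding L_def by (rule funpow_dist1_prop[OF self])
    have dist: "funpow_dist u i ((u ^^ n) i) = n" if "n < L" for n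
      unfolding funpow_dist_def
    proof (rule Least_equality)
      fix k assume k: "(u ^^ k) i = (u ^^ n) i"
      show "n \<le> k"
      proof (rule ccontr)
        assume "\<not> n \<le> k"
        then have "k = n" using inj_onD[OF inj k] that by simp
        then show False using \<open>\<not> n \<le> k\<close> by simp
      qed
    qed simp
    have yn: "y ((u ^^ n) i) = (\<Prod>t<n. C ((u ^^ t) i))" if "n < L" for n
    proof -
      have "(u ^^ n) i \<in> orbit u j" using that orb ij by auto
      then have "rep ((u ^^ n) i) = i" using rep_eq i_def by blast
      then show ?thesis by (simp add: y_def dist[OF that])
    qed
    obtain n where n: "n < L" "j = (u ^^ n) i" using self[of j] orb ij by auto
    show ?thesis
    proof (cases "Suc n < L")
      case True
      have "u j = (u ^^ Suc n) i" by (simp add: n)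
      then show ?thesis using yn[OF True] yn[OF n(1)] by (simp add: n(2) mult.commute)
    next
      case False
      then have "Suc n = L" using n by simp
      have uj: "u j = (u ^^ 0) i" using L unfolding n(2) \<open>Suc n = L\<close>[symmetric] by simp
      have "C j * y j = (\<Prod>t<L. C ((u ^^ t) i))"
        using yn[OF n(1)] by (simp add: n(2) \<open>Suc n = L\<close>[symmetric] mult.commute)
      also have "\<dots> = (\<Prod>j\<in>orbit u i. C j)"
        unfolding orb by (simp add: prod.reindex[OF inj] lessThan_atLeast0)
      also have "\<dots> = 1" by (rule cyc) simp
      finally show ?thesis using yn[of 0] uj n by simp
    qed
  qed
  moreover have "y j \<in> A" for j by (simp add: y_def A_prod)
  ultimately show ?thesis by blast
qed

lemma orbit_coboundary_prod:
  fixes u :: "'n::finite \<Rightarrow> 'n" and C :: "'n \<Rightarrow> 'a::field"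
  assumes u: "bij u" and y: "\<And>j. y j \<noteq> 0" "\<And>j. y (u j) = C j * y j" and S: "S \<in> range (orbit u)"
  shows "(\<Prod>j\<in>S. C j) = 1"
proof -
  obtain i where i: "S = orbit u i" using S by blast
  have "u ` S \<subseteq> S" unfolding i by (auto intro: orbit.step)
  then have "bij_betw u S S"
    using endo_inj_surj[of S u] bij_is_inj[OF u] by (auto simp: bij_betw_def inj_on_def)
  then have "(\<Prod>j\<in>S. y (u j)) = (\<Prod>j\<in>S. y j)" by (rule prod.reindex_bij_betw)
  then have "(\<Prod>j\<in>S. C j) * (\<Prod>j\<in>S. y j) = (\<Prod>j\<in>S. y j)" by (simp add: y(2) prod.distrib)
  then show ?thesis using y(1) by simp
qed

section \<open>Balanced diagonal matrices and uncolored reflections\<close>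

text \<open>
  The factors make this the identity matrix for \<open>a = b\<close>, so that \<open>bal a b h ** bal b c h = bal a c h\<close> without
  side conditions on the positions.
\<close>

definition bal :: "'n \<Rightarrow> 'n \<Rightarrow> complex \<Rightarrow> complex ^ 'n ^ 'n" where
  "bal a b h = cmat id (\<lambda>j. (if j = a then h else 1) * (if j = b then 1 / h else 1))"

lemma
  fixes a b :: "'n::finite"
  assumes "h \<noteq> 0"
  shows monomial_mat_bal: "monomial_mat (bal a b h)"
    and und_perm_bal: "und_perm (bal a b h) = id"
    and entry_bal: "entry (bal a b h) j = (if j = a then h else 1) * (if j = b then 1 / h else 1)"
  using assms unfolding bal_def
  by (simp_all add: monomial_mat_cmat und_perm_cmat entry_cmat)

lemma color_prod_bal:
  fixes a b :: "'n::finite"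
  assumes "h \<noteq> 0"
  shows "color_prod (bal a b h) = 1"
  using assms by (simp add: color_prod_def entry_bal prod.distrib)

lemma bal_same: "h \<noteq> 0 \<Longrightarrow> bal a a h = (mat 1 :: complex ^ 'n ^ 'n)"
  by (auto simp: bal_def mat_1_eq_cmat intro!: arg_cong[of _ _ "cmat id"])

lemma bal_swap: "h \<noteq> 0 \<Longrightarrow> bal b a h = bal a b (1 / h)"
  by (auto simp: bal_def intro!: arg_cong[of _ _ "cmat id"])

lemma bal_trans:
  fixes a b c :: "'n::finite"
  shows "h \<noteq> 0 \<Longrightarrow> bal a b h ** bal b c h = bal a c h"
  by (auto simp: bal_def cmat_mult intro!: arg_cong[of _ _ "cmat id"])

lemma bal_inverse:
  fixes a b :: "'n::finite"
  shows "h \<noteq> 0 \<Longrightarrow> bal a b (1 / h) ** bal a b h = mat 1"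
  by (auto simp: bal_def cmat_mult mat_1_eq_cmat intro!: arg_cong[of _ _ "cmat id"])

lemma mult_bal_commute:
  fixes w :: "complex ^ 'n ^ 'n"
  assumes "monomial_mat w" "h \<noteq> 0"
  shows "w ** bal a b h = bal (und_perm w a) (und_perm w b) h ** w"
proof -
  note inj = inj_eq[OF monomial_matD(2)[OF assms(1)]]
  show ?thesis
    by (rule monomial_mat_eqI)
       (use assms inj in \<open>auto simp: monomial_mat_mult monomial_mat_bal und_perm_mult und_perm_bal entry_mult entry_bal\<close>)
qed

text \<open>
  A diagonal matrix \<open>c\<close> of determinant 1 is the product over \<open>a \<noteq> i0\<close> of the matrices \<open>bal a i0 (c a)\<close>, for
  any fixed \<open>i0\<close>. With \<open>\<Gamma>\<close> an arbitrary set, the lemma serves both for generated groups and as an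
  induction principle for properties invariant under multiplication by balanced matrices.
\<close>

lemma diagonal_mem_of_balanced:
  fixes c :: "'n::finite \<Rightarrow> complex" and \<Gamma> :: "(complex ^ 'n ^ 'n) set"
  assumes one: "mat 1 \<in> \<Gamma>"
    and mult: "\<And>a b v. v \<in> \<Gamma> \<Longrightarrow> a \<noteq> b \<Longrightarrow> bal a b (c a) ** v \<in> \<Gamma>"
    and c: "\<And>j. c j \<noteq> 0" "(\<Prod>j\<in>UNIV. c j) = 1"
  shows "cmat id c \<in> \<Gamma>"
proof -
  obtain i0 :: 'n where True by blast
  define D where "D S = cmat id (\<lambda>j. if j \<in> S then c j else if j = i0 then 1 / (\<Prod>i\<in>S. c i) else 1)" for S
  have "S \<subseteq> UNIV - {i0} \<Longrightarrow> D S \<in> \<Gamma>" if "finite S" for S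
    using that
  proof (induction S)
    case empty
    have "D {} = mat 1" by (simp add: D_def mat_1_eq_cmat cong: if_cong)
    then show ?case using one by simp
  next
    case (insert a S)
    have "D (insert a S) = bal a i0 (c a) ** D S"
      unfolding D_def bal_def cmat_mult
      using insert.hyps insert.prems c(1) by (intro arg_cong2[of _ _ _ _ cmat]) (auto simp: fun_eq_iff)
    then show ?case using insert mult by auto
  qed
  then have "D (UNIV - {i0}) \<in> \<Gamma>" by simp
  moreover have "c i0 = 1 / (\<Prod>i\<in>UNIV - {i0}. c i)"
  proof -
    have "(\<Prod>j\<in>UNIV. c j) = c i0 * (\<Prod>i\<in>UNIV - {i0}. c i)" by (rule prod.remove) auto
    then show ?thesis using c by (simp add: field_simps)
  qed
  then have "D (UNIV - {i0}) = cmat id c"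
    unfolding D_def by (intro arg_cong2[of _ _ _ _ cmat]) auto
  ultimately show ?thesis by simp
qed

text \<open>
  All values but one can be chosen freely.
\<close>

lemma card_functions_prod_1:
  assumes "q > 0"
  shows "card {c :: 'n::finite \<Rightarrow> complex. (\<forall>j. c j ^ q = 1) \<and> (\<Prod>j\<in>UNIV. c j) = 1} = q ^ (CARD('n) - 1)"
proof -
  obtain i0 :: 'n where True by blast
  let ?Z = "{c :: 'n \<Rightarrow> complex. (\<forall>j. c j ^ q = 1) \<and> (\<Prod>j\<in>UNIV. c j) = 1}"
  have split: "(\<Prod>j\<in>UNIV. c j) = c i0 * (\<Prod>i\<in>UNIV - {i0}. c i)" for c :: "'n \<Rightarrow> complex"
    by (rule prod.remove) auto
  have "bij_betw (\<lambda>c. restrict c (UNIV - {i0})) ?Z (PiE (UNIV - {i0}) (\<lambda>_. unity_roots q))"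
  proof (rule bij_betwI')
    fix c c' assume c: "c \<in> ?Z" "c' \<in> ?Z"
    show "(restrict c (UNIV - {i0}) = restrict c' (UNIV - {i0})) = (c = c')"
    proof
      assume eq: "restrict c (UNIV - {i0}) = restrict c' (UNIV - {i0})"
      have off: "c j = c' j" if "j \<noteq> i0" for j
        using fun_cong[OF eq, of j] that by simp
      then have "(\<Prod>i\<in>UNIV - {i0}. c i) = (\<Prod>i\<in>UNIV - {i0}. c' i)" by (intro prod.cong) auto
      then have one: "c i0 * (\<Prod>i\<in>UNIV - {i0}. c' i) = 1" "c' i0 * (\<Prod>i\<in>UNIV - {i0}. c' i) = 1"
        using c split[of c] split[of c'] by simp_all
      then have "(\<Prod>i\<in>UNIV - {i0}. c' i) \<noteq> 0" by (metis mult_zero_right zero_neq_one)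
      then have "c i0 = c' i0" using one by (metis mult_cancel_right)
      then show "c = c'" using off by (intro ext) (case_tac "x = i0", simp_all)
    qed simp
  next
    fix c assume "c \<in> ?Z"
    then show "restrict c (UNIV - {i0}) \<in> PiE (UNIV - {i0}) (\<lambda>_. unity_roots q)" by auto
  next
    fix f assume f: "f \<in> PiE (UNIV - {i0}) (\<lambda>_. unity_roots q)"
    define P where "P = (\<Prod>i\<in>UNIV - {i0}. f i)"
    have fq: "f j ^ q = 1" if "j \<noteq> i0" for j using f that by auto
    have "P ^ q = (\<Prod>i\<in>UNIV - {i0}. f i ^ q)" by (simp add: P_def prod_power_distrib)
    also have "\<dots> = 1" using fq by (intro prod.neutral) auto
    finally have P: "P ^ q = 1" .
    then have "P \<noteq> 0" using assms by (auto simp: zero_power)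
    define c where "c = f(i0 := 1 / P)"
    have "(\<Prod>i\<in>UNIV - {i0}. c i) = P" unfolding P_def by (intro prod.cong) (auto simp: c_def)
    then have "(\<Prod>j\<in>UNIV. c j) = 1" using split[of c] \<open>P \<noteq> 0\<close> by (simp add: c_def)
    moreover have "c j ^ q = 1" for j using fq P by (simp add: c_def power_divide)
    moreover have "f = restrict c (UNIV - {i0})" 
    proof (rule ext)
      fix j
      show "f j = restrict c (UNIV - {i0}) j"
        using PiE_arb[OF f, of j] by (cases "j = i0") (simp_all add: c_def)
    qed
    ultimately show "\<exists>c\<in>?Z. f = restrict c (UNIV - {i0})" by blast
  qed
  then have "card ?Z = card (PiE (UNIV - {i0}) (\<lambda>_. unity_roots q))" by (rule bij_betw_same_card)
  then show ?thesis using assms by (simp add: card_PiE card_roots_unity_eq card_Diff_subset)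
qed

lemma perm_proj_cmat: "perm_proj w = cmat (und_perm w) (\<lambda>_. 1)"
  by (simp add: perm_proj_def cmat_def)

text \<open>
  Diagonal reflections keep their colors, since these decide on the color of the product and on whether
  the colors generate \<open>G(m,p,1)\<close>, whatever the colors of the transpositions are.
\<close>

definition skel :: "complex ^ 'n ^ 'n \<Rightarrow> complex ^ 'n ^ 'n" where
  "skel t = (if und_perm t = id then t else perm_proj t)"

lemma
  fixes w :: "complex ^ 'n ^ 'n"
  assumes "monomial_mat w"
  shows monomial_mat_perm_proj: "monomial_mat (perm_proj w)"
    and und_perm_perm_proj: "und_perm (perm_proj w) = und_perm w"
    and entry_perm_proj: "entry (perm_proj w) j = 1"
  using assms unfolding perm_proj_cmat
  by (auto simp: monomial_matD monomial_mat_cmat und_perm_cmat entry_cmat)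

lemma
  fixes t :: "complex ^ 'n ^ 'n"
  assumes "monomial_mat t"
  shows monomial_mat_skel: "monomial_mat (skel t)"
    and und_perm_skel: "und_perm (skel t) = und_perm t"
  using assms by (auto simp: skel_def monomial_mat_perm_proj und_perm_perm_proj)

text \<open>
  With \<open>q = m/r\<close>, the map \<open>c \<mapsto> c ^ q\<close> on the entries is the reduction of colors modulo \<open>r\<close>. The condition
  says that the reduction of \<open>w\<close> is the conjugate of its permutation matrix by the diagonal matrix with
  entries \<open>y\<close>; it is closed under products.
\<close>

definition potential :: "nat \<Rightarrow> ('n \<Rightarrow> complex) \<Rightarrow> complex ^ 'n ^ 'n \<Rightarrow> bool" where
  "potential q y w \<longleftrightarrow> (\<forall>j. entry w j ^ q * y j = y (und_perm w j))"

lemma potential_1: "potential q y (mat 1 :: complex ^ 'n ^ 'n)"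
  by (simp add: potential_def entry_1 und_perm_1)

lemma potential_mult:
  fixes v w :: "complex ^ 'n ^ 'n"
  assumes "monomial_mat v" "monomial_mat w" "potential q y v" "potential q y w"
  shows "potential q y (v ** w)"
  using assms by (simp add: potential_def entry_mult und_perm_mult power_mult_distrib mult.assoc)

lemma monomial_mat_mprod:
  fixes ts :: "(complex ^ 'n ^ 'n) list"
  shows "(\<And>t. t \<in> set ts \<Longrightarrow> monomial_mat t) \<Longrightarrow> monomial_mat (mprod ts)"
  by (induction ts) (simp_all add: monomial_mat_1 monomial_mat_mult)

lemma potential_mprod:
  fixes ts :: "(complex ^ 'n ^ 'n) list"
  shows "(\<And>t. t \<in> set ts \<Longrightarrow> monomial_mat t \<and> potential q y t) \<Longrightarrow> potential q y (mprod ts)"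
  by (induction ts) (simp_all add: potential_1 potential_mult monomial_mat_mprod)

lemma mult_left_eq_iff:
  fixes t v g :: "complex ^ 'n ^ 'n"
  assumes "monomial_mat t"
  shows "t ** v = g \<longleftrightarrow> v = cinv t ** g"
  using cinv_mult[OF assms] by (metis matrix_mul_assoc matrix_mul_lid)

lemma reflections_Gmpn_cases:
  fixes t :: "complex ^ 'n ^ 'n"
  assumes "m > 0" "t \<in> reflections (Gmpn m p)"
  obtains (tref) a b x where "a \<noteq> b" "x ^ m = 1" "x \<noteq> 0" "t = tref a b x"
    | (dref) a z where "z \<noteq> 1" "z \<noteq> 0" "z ^ m = 1" "z ^ (m div p) = 1" "t = dref a z"
  using assms unity_roots_nonzero[OF assms(1)] by (auto simp: reflections_Gmpn)

section \<open>Colorings of a word with given product\<close>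

lemma tref_swap: "a \<noteq> b \<Longrightarrow> tref b a x = tref a b (1 / x)"
  by (auto simp: tref_def transpose_commute intro!: arg_cong2[of _ _ _ _ cmat])

lemma skel_tref:
  fixes a b :: "'n::finite"
  shows "a \<noteq> b \<Longrightarrow> x \<noteq> 0 \<Longrightarrow> skel (tref a b x) = tref a b 1"
  by (auto simp: skel_def und_perm_tref perm_proj_cmat tref_def[of _ _ 1] transpose_eq_id_iff
      intro!: arg_cong2[of _ _ _ _ cmat])

lemma skel_dref:
  fixes a :: "'n::finite"
  shows "z \<noteq> 0 \<Longrightarrow> skel (dref a z) = dref a z"
  by (simp add: skel_def und_perm_dref)

lemma transpose_neq_id:
  assumes "a \<noteq> b"
  shows "Transposition.transpose a b \<noteq> id"
  using assms by (metis id_apply transpose_apply_first)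

lemma color_prod_skel:
  fixes t :: "complex ^ 'n ^ 'n"
  assumes "m > 0" "t \<in> reflections (Gmpn m p)"
  shows "color_prod (skel t) = color_prod t"
  using assms
  by (cases rule: reflections_Gmpn_cases[OF assms]) (simp_all add: skel_tref skel_dref color_prod_tref)

lemma monomial_reflection:
  fixes t :: "complex ^ 'n ^ 'n"
  shows "t \<in> reflections (Gmpn m p) \<Longrightarrow> monomial_mat t"
  by (auto simp: reflections_def GmpnD)

lemma finite_reflections:
  "m > 0 \<Longrightarrow> finite (reflections (Gmpn m p) :: (complex ^ 'n ^ 'n) set)"
  by (rule finite_subset[OF _ finite_Gmpn[of m p]]) (auto simp: reflections_def)

lemma und_perm_mprod_skel:
  fixes ts :: "(complex ^ 'n ^ 'n) list"
  shows "(\<And>t. t \<in> set ts \<Longrightarrow> monomial_mat t) \<Longrightarrow> und_perm (mprod (map skel ts)) = und_perm (mprod ts)"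
proof (induction ts)
  case (Cons t ts)
  have "monomial_mat (mprod (map skel ts))" "monomial_mat (mprod ts)"
    by (rule monomial_mat_mprod, use Cons.prems monomial_mat_skel in fastforce)+
  then show ?case using Cons by (simp add: und_perm_mult monomial_mat_skel und_perm_skel)
qed simp

lemma color_prod_mprod_skel:
  fixes ts :: "(complex ^ 'n ^ 'n) list"
  assumes "m > 0"
  shows "set ts \<subseteq> reflections (Gmpn m p) \<Longrightarrow> color_prod (mprod (map skel ts)) = color_prod (mprod ts)"
proof (induction ts)
  case (Cons t ts)
  have "monomial_mat (mprod (map skel ts))" "monomial_mat (mprod ts)"
    by (rule monomial_mat_mprod, use Cons.prems monomial_reflection monomial_mat_skel in fastforce)+
  moreover have "monomial_mat t" using Cons.prems monomial_reflection by auto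
  ultimately show ?case
    using Cons color_prod_skel[OF assms, of t p] by (simp add: color_prod_mult monomial_mat_skel)
qed simp

text \<open>
  The function \<open>y\<close> is a fixed trivialization modulo \<open>r\<close>. The letters are the reflections that it
  trivializes, and the colorings of a word \<open>ws\<close> replace every letter of \<open>ws\<close> by one of its lifts. The aim
  is \<open>card_colorings\<close>: all admissible products occur equally often. It is shown by finding the shifts
  \<open>g \<mapsto> bal i j h ** g\<close> of the product that preserve the number of colorings.
\<close>

locale colored_words =
  fixes m p q r :: nat and y :: "'n::finite \<Rightarrow> complex"
  assumes m: "m > 0" and p: "p dvd m" and r: "r dvd p" and qr: "q * r = m"
    and y: "\<And>j. y j ^ r = 1"
begin

definition letters :: "(complex ^ 'n ^ 'n) set" where
  "letters = {t \<in> reflections (Gmpn m p). potential q y t}"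

definition lifts :: "complex ^ 'n ^ 'n \<Rightarrow> (complex ^ 'n ^ 'n) set" where
  "lifts w = {t \<in> letters. skel t = w}"

definition colorings :: "(complex ^ 'n ^ 'n) list \<Rightarrow> complex ^ 'n ^ 'n \<Rightarrow> (complex ^ 'n ^ 'n) list set" where
  "colorings ws g = {ts. set ts \<subseteq> letters \<and> map skel ts = ws \<and> mprod ts = g}"

definition shift_inv :: "(complex ^ 'n ^ 'n) list \<Rightarrow> 'n \<Rightarrow> 'n \<Rightarrow> bool" where
  "shift_inv ws i j \<longleftrightarrow> (\<forall>h g. h ^ q = 1 \<longrightarrow> monomial_mat g \<longrightarrow>
     card (colorings ws (bal i j h ** g)) = card (colorings ws g))"

lemma q_pos: "q > 0" and r_pos: "r > 0" and y_nonzero: "y j \<noteq> 0"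
  using m qr y[of j] by (auto simp: zero_power intro: Nat.gr0I)

lemma letters_reflections: "letters \<subseteq> reflections (Gmpn m p)"
  by (auto simp: letters_def)

lemma finite_letters: "finite letters"
  using finite_subset[OF letters_reflections finite_reflections[OF m]] .

lemma finite_lifts: "finite (lifts w)"
  using finite_letters by (simp add: lifts_def)

lemma finite_colorings: "finite (colorings ws g)"
  by (rule finite_subset[OF _ finite_lists_map_eq[OF finite_letters, of skel ws]]) (auto simp: colorings_def)

lemma lifts_monomial: "t \<in> lifts w \<Longrightarrow> monomial_mat t"
  using letters_reflections monomial_reflection by (auto simp: lifts_def)

lemma und_perm_lifts: "t \<in> lifts w \<Longrightarrow> und_perm t = und_perm w"
  using und_perm_skel[OF lifts_monomial] by (auto simp: lifts_def)

lemma card_colorings_Cons: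
  assumes "monomial_mat g"
  shows "card (colorings (w # ws) g) = (\<Sum>t\<in>lifts w. card (colorings ws (cinv t ** g)))"
proof -
  have iff: "t ** v = g \<longleftrightarrow> v = cinv t ** g" if "t \<in> lifts w" for t v
    using mult_left_eq_iff[OF lifts_monomial[OF that]] .
  have "colorings (w # ws) g = (\<Union>t\<in>lifts w. (#) t ` colorings ws (cinv t ** g))"
  proof (intro equalityI subsetI)
    fix ts assume "ts \<in> colorings (w # ws) g"
    then obtain t ts' where t: "ts = t # ts'" "t \<in> lifts w" "set ts' \<subseteq> letters" "map skel ts' = ws"
      "t ** mprod ts' = g"
      by (auto simp: colorings_def lifts_def map_eq_Cons_conv)
    then have "ts' \<in> colorings ws (cinv t ** g)" using iff[OF t(2)] by (simp add: colorings_def)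
    then show "ts \<in> (\<Union>t\<in>lifts w. (#) t ` colorings ws (cinv t ** g))" using t by blast
  next
    fix ts assume "ts \<in> (\<Union>t\<in>lifts w. (#) t ` colorings ws (cinv t ** g))"
    then obtain t ts' where t: "ts = t # ts'" "t \<in> lifts w" "ts' \<in> colorings ws (cinv t ** g)" by blast
    then have "t ** mprod ts' = g" using iff[OF t(2)] by (simp add: colorings_def)
    then show "ts \<in> colorings (w # ws) g" using t by (simp add: colorings_def lifts_def)
  qed
  also have "card \<dots> = (\<Sum>t\<in>lifts w. card ((#) t ` colorings ws (cinv t ** g)))"
    by (rule card_UN_disjoint) (use finite_lifts finite_colorings in auto)
  finally show ?thesis by (simp add: card_image)
qed

lemma shift_inv_refl: "shift_inv ws i i"
  using unity_roots_nonzero[OF q_pos] by (auto simp: shift_inv_def bal_same)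

lemma shift_inv_sym: "shift_inv ws i j \<Longrightarrow> shift_inv ws j i"
  using unity_roots_nonzero[OF q_pos] by (auto simp: shift_inv_def bal_swap[of _ j i] power_divide)

lemma shift_inv_trans:
  assumes "shift_inv ws i j" "shift_inv ws j k"
  shows "shift_inv ws i k"
  unfolding shift_inv_def
proof (intro allI impI)
  fix h :: complex and g :: "complex ^ 'n ^ 'n"
  assume h: "h ^ q = 1" and g: "monomial_mat g"
  have nz: "h \<noteq> 0" using unity_roots_nonzero[OF q_pos h] .
  have "bal i k h ** g = bal i j h ** (bal j k h ** g)"
    using bal_trans[OF nz, of i j k] by (simp add: matrix_mul_assoc)
  moreover have "monomial_mat (bal j k h ** g)" using g nz by (simp add: monomial_mat_mult monomial_mat_bal)
  ultimately show "card (colorings ws (bal i k h ** g)) = card (colorings ws g)"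
    using assms h g by (simp add: shift_inv_def)
qed

text \<open>
  A shift of the product of the remaining letters becomes, behind the first letter, the shift at the
  positions permuted by that letter.
\<close>

lemma shift_inv_Cons_old:
  assumes "shift_inv ws i j"
  shows "shift_inv (w # ws) (und_perm w i) (und_perm w j)"
  unfolding shift_inv_def
proof (intro allI impI)
  fix h :: complex and g :: "complex ^ 'n ^ 'n"
  assume h: "h ^ q = 1" and g: "monomial_mat g"
  have nz: "h \<noteq> 0" using unity_roots_nonzero[OF q_pos h] .
  let ?B = "bal (und_perm w i) (und_perm w j) h"
  have Bg: "monomial_mat (?B ** g)" using g nz by (simp add: monomial_mat_mult monomial_mat_bal)
  have "card (colorings ws (cinv t ** (?B ** g))) = card (colorings ws (cinv t ** g))" if t: "t \<in> lifts w" for t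
  proof -
    have mt: "monomial_mat t" by (rule lifts_monomial[OF t])
    have "?B ** t = t ** bal i j h"
      using mult_bal_commute[OF mt nz, of i j] und_perm_lifts[OF t] by simp
    then have "cinv t ** ?B = bal i j h ** cinv t"
      using cinv_mult[OF mt] by (metis matrix_mul_assoc matrix_mul_lid matrix_mul_rid)
    then have "cinv t ** (?B ** g) = bal i j h ** (cinv t ** g)" by (simp add: matrix_mul_assoc)
    moreover have "monomial_mat (cinv t ** g)" using g mt by (simp add: monomial_mat_mult monomial_mat_cinv)
    ultimately show ?thesis using assms h by (simp add: shift_inv_def)
  qed
  then show "card (colorings (w # ws) (?B ** g)) = card (colorings (w # ws) g)"
    by (simp add: card_colorings_Cons[OF g] card_colorings_Cons[OF Bg])
qed

text \<open>
  The reduction modulo \<open>r\<close> of the color of a transposition is not affected by a \<open>q\<close>-th root of unity, so \<open>y\<close>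
  still trivializes the result.
\<close>

lemma bal_lifts:
  assumes t: "t \<in> lifts w" and h: "h ^ q = 1" and w: "und_perm w \<noteq> id"
  shows "bal (und_perm w i) i h ** t \<in> lifts w"
proof -
  have nz: "h \<noteq> 0" using unity_roots_nonzero[OF q_pos h] .
  have hm: "h ^ m = 1" using h qr by (metis power_mult power_one)
  have tl: "t \<in> reflections (Gmpn m p)" "potential q y t" "skel t = w"
    using t by (auto simp: lifts_def letters_def)
  have u: "und_perm t = und_perm w" by (rule und_perm_lifts[OF t])
  show ?thesis
    using m tl(1)
  proof (cases rule: reflections_Gmpn_cases)
    case (tref a b x)
    have "\<exists>x'. bal (und_perm w i) i h ** t = tref a b x' \<and> x' ^ m = 1 \<and> x' \<noteq> 0"
    proof -
      have ut: "und_perm w = Transposition.transpose a b" using u tref by (simp add: und_perm_tref)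
      consider "i \<noteq> a" "i \<noteq> b" | "i = a" | "i = b" by blast
      then show ?thesis
      proof cases
        case 1
        then show ?thesis using \<open>t = tref a b x\<close> \<open>x ^ m = 1\<close> \<open>x \<noteq> 0\<close> ut nz by (auto simp: bal_same)
      next
        case 2
        then have "bal (und_perm w i) i h ** t = tref a b (x * h)"
          using \<open>t = tref a b x\<close> \<open>x \<noteq> 0\<close> ut nz \<open>a \<noteq> b\<close>
          by (auto simp: bal_def tref_def cmat_mult intro!: arg_cong2[of _ _ _ _ cmat])
        then show ?thesis using \<open>x ^ m = 1\<close> hm \<open>x \<noteq> 0\<close> nz by (auto simp: power_mult_distrib)
      next
        case 3
        then have "bal (und_perm w i) i h ** t = tref a b (x / h)"
          using \<open>t = tref a b x\<close> \<open>x \<noteq> 0\<close> ut nz \<open>a \<noteq> b\<close>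
          by (auto simp: bal_def tref_def cmat_mult intro!: arg_cong2[of _ _ _ _ cmat])
        then show ?thesis using \<open>x ^ m = 1\<close> hm \<open>x \<noteq> 0\<close> nz by (auto simp: power_divide)
      qed
    qed
    then obtain x' where x': "bal (und_perm w i) i h ** t = tref a b x'" "x' ^ m = 1" "x' \<noteq> 0" by blast
    have "bal (und_perm w i) i h ** t \<in> reflections (Gmpn m p)"
      using x' tref by (auto simp: reflections_Gmpn[OF m])
    moreover have "potential q y (bal (und_perm w i) i h ** t)"
    proof (rule potential_mult)
      show "potential q y (bal (und_perm w i) i h)"
        using nz h by (simp add: potential_def entry_bal und_perm_bal power_mult_distrib power_divide)
    qed (use tl(2) nz lifts_monomial[OF t] in \<open>simp_all add: monomial_mat_bal\<close>)
    moreover have "skel (bal (und_perm w i) i h ** t) = w"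
      using x' tref tl(3) by (simp add: skel_tref)
    ultimately show ?thesis by (simp add: lifts_def letters_def)
  next
    case (dref a z)
    then show ?thesis using u w by (simp add: und_perm_dref)
  qed
qed

text \<open>
  If the first letter is a transposition, recoloring it is a bijection between the colorings with
  product \<open>g\<close> and those with a shifted product.
\<close>

lemma shift_inv_Cons_new: "shift_inv (w # ws) (und_perm w i) i"
proof (cases "und_perm w = id")
  case True
  then show ?thesis by (simp add: shift_inv_refl)
next
  case False
  show ?thesis
    unfolding shift_inv_def
  proof (intro allI impI)
    fix h :: complex and g :: "complex ^ 'n ^ 'n"
    assume h: "h ^ q = 1" and g: "monomial_mat g"
    have nz: "h \<noteq> 0" using unity_roots_nonzero[OF q_pos h] .
    let ?B = "bal (und_perm w i) i h" and ?C = "bal (und_perm w i) i (1 / h)"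
    have mB: "monomial_mat ?B" "monomial_mat ?C" using nz by (simp_all add: monomial_mat_bal)
    have Bg: "monomial_mat (?B ** g)" using g mB by (simp add: monomial_mat_mult)
    have CB: "?C ** ?B = mat 1" "?B ** ?C = mat 1"
      using bal_inverse[OF nz, of "und_perm w i" i] bal_inverse[of "1 / h" "und_perm w i" i] nz by simp_all
    have "(\<Sum>t\<in>lifts w. card (colorings ws (cinv t ** (?B ** g))))
        = (\<Sum>t\<in>lifts w. card (colorings ws (cinv t ** g)))"
    proof (rule sum.reindex_bij_witness[of _ "\<lambda>t. ?B ** t" "\<lambda>t. ?C ** t"])
      fix t assume t: "t \<in> lifts w"
      show "?B ** (?C ** t) = t" "?C ** (?B ** t) = t" using CB by (simp_all add: matrix_mul_assoc)
      show "?C ** t \<in> lifts w" "?B ** t \<in> lifts w"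
        using bal_lifts[OF t _ False] h by (simp_all add: power_divide)
      have mt: "monomial_mat t" by (rule lifts_monomial[OF t])
      have "(?C ** t) ** (cinv t ** (?B ** g)) = ?C ** ((t ** cinv t) ** (?B ** g))"
        by (simp only: matrix_mul_assoc)
      also have "\<dots> = (?C ** ?B) ** g" by (simp only: cinv_mult[OF mt] matrix_mul_assoc matrix_mul_rid matrix_mul_lid)
      also have "\<dots> = g" by (simp add: CB)
      finally have "cinv t ** (?B ** g) = cinv (?C ** t) ** g"
        using mult_left_eq_iff[of "?C ** t"] mt mB by (simp add: monomial_mat_mult)
      then show "card (colorings ws (cinv (?C ** t) ** g)) = card (colorings ws (cinv t ** (?B ** g)))"
        by simp
    qed
    then show "card (colorings (w # ws) (?B ** g)) = card (colorings (w # ws) g)"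
      by (simp add: card_colorings_Cons[OF g] card_colorings_Cons[OF Bg])
  qed
qed

text \<open>
  The relation \<open>shift_inv ws\<close> is an equivalence relation. For a later letter \<open>w\<close>, the induction hypothesis and
  \<open>shift_inv_Cons_old\<close> relate \<open>v (w i)\<close> to \<open>v i\<close>, where \<open>v\<close> is the first letter; and \<open>v\<close> itself relates each
  of these points to its image. Hence the orbits of the group generated by the letters lie in single
  classes, and a transitive word admits all shifts.
\<close>

lemma shift_inv_letter:
  "w \<in> set ws \<Longrightarrow> shift_inv ws (und_perm w i) i"
proof (induction ws arbitrary: i)
  case (Cons v ws)
  show ?case
  proof (cases "w = v")
    case True
    then show ?thesis by (simp add: shift_inv_Cons_new)
  next
    case False
    then have "shift_inv ws (und_perm w i) i" using Cons by simp
    then have "shift_inv (v # ws) (und_perm v (und_perm w i)) (und_perm v i)" by (rule shift_inv_Cons_old)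
    then show ?thesis using shift_inv_Cons_new shift_inv_sym shift_inv_trans by meson
  qed
qed simp

lemma shift_inv_mprod:
  assumes "set vs \<subseteq> set ws" "\<And>w. w \<in> set ws \<Longrightarrow> monomial_mat w"
  shows "shift_inv ws (und_perm (mprod vs) i) i"
  using assms(1)
proof (induction vs)
  case Nil
  then show ?case by (simp add: und_perm_1 shift_inv_refl)
next
  case (Cons v vs)
  have "monomial_mat v" "monomial_mat (mprod vs)"
    using Cons.prems assms(2) by (auto intro: monomial_mat_mprod)
  then have "und_perm (mprod (v # vs)) i = und_perm v (und_perm (mprod vs) i)"
    by (simp add: und_perm_mult)
  moreover have "v \<in> set ws" "set vs \<subseteq> set ws" using Cons.prems by auto
  ultimately show ?case
    using Cons.IH shift_inv_letter[of v ws "und_perm (mprod vs) i"] shift_inv_trans by metis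
qed

lemma card_colorings_same_target:
  assumes all: "\<And>i j. shift_inv ws i j" and g: "monomial_mat g"
    and c: "\<And>j. c j ^ q = 1" "(\<Prod>j\<in>UNIV. c j) = 1"
  shows "card (colorings ws (cmat id c ** g)) = card (colorings ws g)"
proof -
  have "cmat id c \<in> {v. monomial_mat v \<and> card (colorings ws (v ** g)) = card (colorings ws g)}"
  proof (rule diagonal_mem_of_balanced)
    fix a b v
    assume "v \<in> {v. monomial_mat v \<and> card (colorings ws (v ** g)) = card (colorings ws g)}"
    then have v: "monomial_mat v" "card (colorings ws (v ** g)) = card (colorings ws g)" by auto
    have "monomial_mat (v ** g)" using v g by (simp add: monomial_mat_mult)
    then have "card (colorings ws (bal a b (c a) ** (v ** g))) = card (colorings ws (v ** g))"
      using all c(1) by (simp add: shift_inv_def)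
    moreover have "c a \<noteq> 0" using unity_roots_nonzero[OF q_pos c(1)] .
    ultimately show "bal a b (c a) ** v \<in> {v. monomial_mat v \<and> card (colorings ws (v ** g)) = card (colorings ws g)}"
      using v by (simp add: monomial_mat_mult monomial_mat_bal matrix_mul_assoc)
  qed (use c unity_roots_nonzero[OF q_pos] in \<open>auto simp: monomial_mat_1\<close>)
  then show ?thesis by simp
qed

text \<open>
  The color \<open>x\<close> of a lift of the transposition of \<open>a\<close> and \<open>b\<close> is subject to the only condition
  \<open>x ^ q = y b / y a\<close>.
\<close>

lemma card_lifts:
  assumes "w \<in> skel ` reflections (Gmpn m p)"
  shows "card (lifts w) = (if und_perm w = id then 1 else q)"
proof -
  obtain t where t: "t \<in> reflections (Gmpn m p)" "w = skel t" using assms by blast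
  show ?thesis
    using m t(1)
  proof (cases rule: reflections_Gmpn_cases)
    case (tref a b x)
    have w: "w = tref a b 1" "und_perm w = Transposition.transpose a b" using t(2) tref by (simp_all add: skel_tref und_perm_tref)
    have q_root: "z ^ m = 1 \<and> z \<noteq> 0" if "z ^ q = y b / y a" for z
    proof -
      have "z ^ m = (y b / y a) ^ r" using that qr by (metis power_mult)
      then have "z ^ m = 1" using y by (simp add: power_divide)
      then show ?thesis using unity_roots_nonzero[OF m] by blast
    qed
    have "lifts w = tref a b ` {z. z ^ q = y b / y a}"
    proof (intro equalityI subsetI)
      fix s assume s: "s \<in> lifts w"
      then have sl: "s \<in> reflections (Gmpn m p)" "potential q y s" by (auto simp: lifts_def letters_def)
      have us: "und_perm s = Transposition.transpose a b" using und_perm_lifts[OF s] w by simp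
      from m sl(1) show "s \<in> tref a b ` {z. z ^ q = y b / y a}"
      proof (cases rule: reflections_Gmpn_cases)
        case (tref a' b' x')
        have tr: "Transposition.transpose a' b' = Transposition.transpose a b"
          using us tref by (simp add: und_perm_tref)
        have "Transposition.transpose a' b' a = b" "a \<noteq> b" using tr \<open>a \<noteq> b\<close> by simp_all
        then have "(a' = a \<and> b' = b) \<or> (a' = b \<and> b' = a)"
          by (auto simp: Transposition.transpose_def split: if_splits)
        then obtain z where z: "s = tref a b z" "z \<noteq> 0"
          using tref \<open>a \<noteq> b\<close> tref_swap[of a b x'] by auto
        have "entry s a ^ q * y a = y (und_perm s a)" using sl(2) by (simp add: potential_def)
        then have "z ^ q * y a = y b" using z by (simp add: entry_tref und_perm_tref)
        then have "z ^ q = y b / y a" using y_nonzero by (simp add: field_simps)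
        then show ?thesis using z by blast
      next
        case (dref a' z')
        then show ?thesis using us transpose_neq_id[OF \<open>a \<noteq> b\<close>] by (simp add: und_perm_dref)
      qed
    next
      fix s assume "s \<in> tref a b ` {z. z ^ q = y b / y a}"
      then obtain z where z: "s = tref a b z" "z ^ q = y b / y a" by blast
      note qz = q_root[OF z(2)]
      have "z ^ q * y a = y b" using z y_nonzero by simp
      then have "potential q y s"
        using z qz \<open>a \<noteq> b\<close> y_nonzero
        by (auto simp: potential_def entry_tref und_perm_tref Transposition.transpose_def power_divide field_simps)
      then show "s \<in> lifts w"
        using qz z(1) w(1) \<open>a \<noteq> b\<close> by (auto simp: lifts_def letters_def reflections_Gmpn[OF m] skel_tref)
    qed
    moreover have "inj_on (tref a b) {z. z ^ q = y b / y a}"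
    proof (rule inj_onI)
      fix z z' assume z: "z \<in> {z. z ^ q = y b / y a}" "z' \<in> {z. z ^ q = y b / y a}" "tref a b z = tref a b z'"
      have "entry (tref a b z) a = entry (tref a b z') a" using z(3) by simp
      then show "z = z'" using q_root z(1,2) by (simp add: entry_tref)
    qed
    ultimately have "card (lifts w) = card {z. z ^ q = y b / y a}" by (simp add: card_image)
    also have "\<dots> = q" using y_nonzero q_pos by (intro card_nth_roots) auto
    finally show ?thesis using w transpose_neq_id[OF \<open>a \<noteq> b\<close>] by simp
  next
    case (dref a z)
    have w: "w = dref a z" "und_perm w = id" using t(2) dref by (simp_all add: skel_dref und_perm_dref)
    have zq: "z ^ q = 1"
    proof -
      obtain s where s: "p = r * s" using r by blast
      obtain l where l: "m = p * l" using p by blast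
      have "p > 0" using p m by (auto intro: Nat.gr0I)
      then have "m div p = l" using l by simp
      moreover have "q = s * l" using l s qr r_pos by (simp add: algebra_simps)
      ultimately show ?thesis using dref by (metis mult.commute power_mult power_one)
    qed
    have "lifts w = {w}"
    proof (intro equalityI subsetI)
      fix s assume s: "s \<in> lifts w"
      then have "und_perm s = id" "skel s = w" using und_perm_lifts[OF s] w by (auto simp: lifts_def)
      then show "s \<in> {w}" by (simp add: skel_def)
    next
      fix s assume "s \<in> {w}"
      moreover have "potential q y w" using dref zq w by (simp add: potential_def entry_dref und_perm_dref)
      moreover have "skel w = w" using w by (simp add: skel_def)
      moreover have "w \<in> reflections (Gmpn m p)" using t(1) dref w by simp
      ultimately show "s \<in> lifts w" by (simp add: lifts_def letters_def)
    qed
    then show ?thesis using w by simp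
  qed
qed

text \<open>
  There are \<open>q\<close> lifts for every transposition. The product of each coloring differs from \<open>g\<close> by a diagonal
  matrix of determinant 1 whose entries are \<open>q\<close>-th roots of unity; there are \<open>q ^ (n - 1)\<close> of these, and each
  of them occurs equally often.
\<close>

lemma card_colorings:
  assumes ws: "set ws \<subseteq> skel ` reflections (Gmpn m p)" and all: "\<And>i j. shift_inv ws i j"
    and g: "monomial_mat g" "potential q y g"
    and gws: "und_perm g = und_perm (mprod ws)" "color_prod g = color_prod (mprod ws)"
  shows "card (colorings ws g) * q ^ (CARD('n) - 1) = q ^ length (filter (\<lambda>w. und_perm w \<noteq> id) ws)"
proof -
  define C where "C = {c :: 'n \<Rightarrow> complex. (\<forall>j. c j ^ q = 1) \<and> (\<Prod>j\<in>UNIV. c j) = 1}"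
  have finC: "finite C"
    using card_functions_prod_1[OF q_pos, where ?'n = 'n] q_pos by (intro card_ge_0_finite) (simp add: C_def)
  have Cnz: "c j \<noteq> 0" if "c \<in> C" for c j
    using that unity_roots_nonzero[OF q_pos] by (auto simp: C_def)
  let ?all = "{ts. set ts \<subseteq> letters \<and> map skel ts = ws}"
  have "?all = (\<Union>c\<in>C. colorings ws (cmat id c ** g))"
  proof (intro equalityI subsetI)
    fix ts assume ts: "ts \<in> ?all"
    have refl: "set ts \<subseteq> reflections (Gmpn m p)" using ts letters_reflections by auto
    have mono: "monomial_mat t" if "t \<in> set ts" for t using that refl monomial_reflection by blast
    have P: "monomial_mat (mprod ts)" using mono by (rule monomial_mat_mprod)
    have uP: "und_perm (mprod ts) = und_perm g"
      using und_perm_mprod_skel[of ts, OF mono] ts gws by simp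
    have cP: "color_prod (mprod ts) = color_prod g"
      using color_prod_mprod_skel[OF m refl] ts gws by simp
    have pP: "potential q y (mprod ts)"
      using ts mono by (intro potential_mprod) (auto simp: letters_def)
    define v where "v = mprod ts ** cinv g"
    have v: "monomial_mat v" using P g by (simp add: v_def monomial_mat_mult monomial_mat_cinv)
    have vg: "v ** g = mprod ts" unfolding v_def using cinv_mult[OF g(1)] by (metis matrix_mul_assoc matrix_mul_rid)
    have "und_perm v \<circ> und_perm g = und_perm g" using und_perm_mult[OF v g(1)] vg uP by simp
    then have uv: "und_perm v = id"
      using monomial_matD(1)[OF g(1)] by (metis bij_is_surj comp_assoc comp_id id_comp surj_iff)
    have ev: "entry v (und_perm g j) * entry g j = entry (mprod ts) j" for j
      using entry_mult[OF v g(1)] vg by simp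
    have "entry v j ^ q = 1" for j
    proof -
      obtain i where i: "j = und_perm g i" using monomial_matD(1)[OF g(1)] by (metis bij_pointE)
      have "entry (mprod ts) i ^ q * y i = entry g i ^ q * y i"
        using pP g(2) uP by (simp add: potential_def)
      then have "entry (mprod ts) i ^ q = entry g i ^ q" using y_nonzero by simp
      then have "entry v j ^ q * entry g i ^ q = entry g i ^ q" using ev[of i] by (simp add: i power_mult_distrib[symmetric])
      then show ?thesis using monomial_matD(3)[OF g(1), of i] by simp
    qed
    moreover have "color_prod v * color_prod g = color_prod g" using color_prod_mult[OF v g(1)] vg cP by simp
    then have "color_prod v = 1" using monomial_matD(3)[OF g(1)] by (simp add: color_prod_def)
    ultimately have "entry v \<in> C" by (simp add: C_def color_prod_def)
    moreover have "v = cmat id (entry v)" using monomial_matD(4)[OF v] uv by simp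
    then have "ts \<in> colorings ws (cmat id (entry v) ** g)" using ts vg by (simp add: colorings_def)
    ultimately show "ts \<in> (\<Union>c\<in>C. colorings ws (cmat id c ** g))" by blast
  qed (auto simp: colorings_def)
  then have "card ?all = card (\<Union>c\<in>C. colorings ws (cmat id c ** g))" by simp
  also have "\<dots> = (\<Sum>c\<in>C. card (colorings ws (cmat id c ** g)))"
  proof (rule card_UN_disjoint[OF finC])
    show "\<forall>c\<in>C. finite (colorings ws (cmat id c ** g))" using finite_colorings by blast
    show "\<forall>c\<in>C. \<forall>c'\<in>C. c \<noteq> c' \<longrightarrow> colorings ws (cmat id c ** g) \<inter> colorings ws (cmat id c' ** g) = {}"
    proof (intro ballI impI equals0I)
      fix c c' ts assume c: "c \<in> C" "c' \<in> C" "c \<noteq> c'"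
        and "ts \<in> colorings ws (cmat id c ** g) \<inter> colorings ws (cmat id c' ** g)"
      then have "mprod ts = cmat id c ** g" "mprod ts = cmat id c' ** g"
        unfolding colorings_def by blast+
      then have "cmat id c ** g = cmat id c' ** g" by (rule subst)
      then have "cmat id c = cmat id c'"
        using cinv_mult(2)[OF g(1)] by (metis matrix_mul_assoc matrix_mul_rid)
      then have "entry (cmat id c) = entry (cmat id c')" by simp
      then show False using c Cnz by (simp add: entry_cmat)
    qed
  qed
  also have "\<dots> = (\<Sum>c\<in>C. card (colorings ws g))"
    by (rule sum.cong[OF refl], rule card_colorings_same_target[OF all g(1)]) (auto simp: C_def)
  also have "\<dots> = card (colorings ws g) * q ^ (CARD('n) - 1)"
    using card_functions_prod_1[OF q_pos, where ?'n = 'n] by (simp add: C_def)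
  finally have "card ?all = card (colorings ws g) * q ^ (CARD('n) - 1)" .
  moreover have "card ?all = (\<Prod>w\<leftarrow>ws. card (lifts w))"
    using card_lists_map_eq[OF finite_letters] by (simp add: lifts_def)
  moreover have "(\<Prod>w\<leftarrow>ws. card (lifts w)) = q ^ length (filter (\<lambda>w. und_perm w \<noteq> id) ws)"
    using ws by (induction ws) (simp_all add: card_lifts)
  ultimately show ?thesis by simp
qed

end

section \<open>Colorings that are trivial modulo a divisor\<close>

text \<open>
  For \<open>r\<close> dividing \<open>m\<close> and \<open>T\<close> in \<open>G(m,1,n)\<close> this means that \<open>T\<close> is conjugate, by a diagonal matrix of
  \<open>G(m,1,n)\<close>, to a subset of \<open>G(m/r,1,n)\<close>: the colors become trivial modulo \<open>r\<close>.
\<close>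

definition trivial_mod :: "nat \<Rightarrow> nat \<Rightarrow> (complex ^ 'n ^ 'n) set \<Rightarrow> bool" where
  "trivial_mod m r T \<longleftrightarrow> (\<exists>y. (\<forall>j. y j ^ r = 1) \<and> (\<forall>t\<in>T. potential (m div r) y t))"

abbreviation mprods :: "(complex ^ 'n ^ 'n) set \<Rightarrow> (complex ^ 'n ^ 'n) set" where
  "mprods T \<equiv> {mprod vs | vs. set vs \<subseteq> T}"

lemma mprods_mult: "v \<in> mprods T \<Longrightarrow> w \<in> mprods T \<Longrightarrow> v ** w \<in> mprods T"
proof -
  assume "v \<in> mprods T" "w \<in> mprods T"
  then obtain a b where "v = mprod a" "w = mprod b" "set a \<subseteq> T" "set b \<subseteq> T" by blast
  then have "v ** w = mprod (a @ b)" "set (a @ b) \<subseteq> T" by (simp_all only: mprod_append set_append Un_subset_iff simp_thms)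
  then show ?thesis by blast
qed

lemma mprods_incl: "t \<in> T \<Longrightarrow> t \<in> mprods T"
proof -
  assume "t \<in> T"
  then have "t = mprod [t]" "set [t] \<subseteq> T" by simp_all
  then show ?thesis by blast
qed

lemma mprods_1: "mat 1 \<in> mprods T"
proof -
  have "mat 1 = mprod []" "set [] \<subseteq> T" by simp_all
  then show ?thesis by blast
qed

lemma map_preimage_list:
  assumes "set vs \<subseteq> f ` A"
  obtains us where "vs = map f us" "set us \<subseteq> A"
proof -
  have "vs \<in> lists (f ` A)" using assms by (simp add: in_lists_conv_set subset_iff)
  then obtain us where "vs = map f us" "us \<in> lists A" by (auto simp: lists_image)
  then show ?thesis using that by (auto simp: in_lists_conv_set)
qed

definition transitive_on_indices :: "(complex ^ 'n ^ 'n) set \<Rightarrow> bool" where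
  "transitive_on_indices T \<longleftrightarrow> (\<forall>i j. \<exists>\<gamma>\<in>mprods T. und_perm \<gamma> i = j)"

lemma und_perm_invariant_mprod:
  fixes vs :: "(complex ^ 'n ^ 'n) list"
  assumes "\<And>v j. v \<in> set vs \<Longrightarrow> z (und_perm v j) = z j" "\<And>v. v \<in> set vs \<Longrightarrow> monomial_mat v"
  shows "z (und_perm (mprod vs) j) = z j"
  using assms
  by (induction vs) (simp_all add: und_perm_1 und_perm_mult monomial_mat_mprod)

text \<open>
  The quotient of two trivializations is constant along every permutation of \<open>T\<close>, hence constant.
\<close>

lemma card_potentials_transitive:
  fixes T :: "(complex ^ 'n ^ 'n) set"
  assumes r: "r > 0" and T: "\<And>t. t \<in> T \<Longrightarrow> monomial_mat t" "transitive_on_indices T"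
  shows "card {y. (\<forall>j. y j ^ r = 1) \<and> (\<forall>t\<in>T. potential q y t)}
    = (if \<exists>y. (\<forall>j. y j ^ r = 1) \<and> (\<forall>t\<in>T. potential q y t) then r else 0)"
proof (cases "\<exists>y. (\<forall>j. y j ^ r = 1) \<and> (\<forall>t\<in>T. potential q y t)")
  case True
  then obtain y0 where y0: "\<And>j. y0 j ^ r = 1" "\<And>t. t \<in> T \<Longrightarrow> potential q y0 t" by blast
  have nz: "y0 j \<noteq> 0" for j using unity_roots_nonzero[OF r y0(1)] .
  let ?Y = "{y. (\<forall>j. y j ^ r = 1) \<and> (\<forall>t\<in>T. potential q y t)}"
  have "?Y = (\<lambda>\<omega> j. \<omega> * y0 j) ` unity_roots r"
  proof (intro equalityI subsetI)
    fix y assume y: "y \<in> ?Y"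
    define z where "z j = y j / y0 j" for j
    have inv: "z (und_perm t j) = z j" if "t \<in> T" for t j
    proof -
      have "entry t j ^ q * y j = y (und_perm t j)" "entry t j ^ q * y0 j = y0 (und_perm t j)"
        using y y0 that by (auto simp: potential_def)
      moreover have "entry t j ^ q \<noteq> 0" using monomial_matD(3)[OF T(1)[OF that]] by simp
      ultimately show ?thesis unfolding z_def by (metis mult_divide_mult_cancel_left)
    qed
    obtain i0 :: 'n where True by blast
    have const: "z j = z i0" for j
    proof -
      obtain vs where vs: "set vs \<subseteq> T" "und_perm (mprod vs) i0 = j"
        using T(2) unfolding transitive_on_indices_def by blast
      then have "z (und_perm (mprod vs) i0) = z i0"
        using inv T(1) by (intro und_perm_invariant_mprod) auto
      then show ?thesis using vs by simp
    qed
    have "y j = z i0 * y0 j" for j using const[of j] nz by (simp add: z_def field_simps)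
    moreover have "z i0 ^ r = 1" using y y0 by (simp add: z_def power_divide)
    ultimately show "y \<in> (\<lambda>\<omega> j. \<omega> * y0 j) ` unity_roots r" by blast
  next
    fix y assume "y \<in> (\<lambda>\<omega> j. \<omega> * y0 j) ` unity_roots r"
    then show "y \<in> ?Y" using y0 by (auto simp: power_mult_distrib potential_def algebra_simps)
  qed
  moreover have "inj_on (\<lambda>\<omega> j. \<omega> * y0 j) (unity_roots r)"
  proof (rule inj_onI)
    fix a b assume "(\<lambda>j. a * y0 j) = (\<lambda>j. b * y0 j)"
    then have "a * y0 undefined = b * y0 undefined" by meson
    then show "a = b" using nz by simp
  qed
  ultimately have "card ?Y = r" using card_roots_unity_eq[OF r] by (simp add: card_image)
  then show ?thesis using True by simp
next
  case False
  then have "{y. (\<forall>j. y j ^ r = 1) \<and> (\<forall>t\<in>T. potential q y t)} = {}" by blast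
  then have "card {y. (\<forall>j. y j ^ r = 1) \<and> (\<forall>t\<in>T. potential q y t)} = 0" by (simp only: card.empty)
  then show ?thesis using False by (simp only: if_False)
qed

text \<open>
  The quotient of two trivializations of \<open>g\<close> is constant along its cycles, and by
  \<open>orbit_coboundary_exists\<close> one exists iff the color of every cycle is trivial modulo \<open>r\<close>.
\<close>

lemma card_potentials_single:
  fixes g :: "complex ^ 'n ^ 'n"
  assumes r: "r > 0" and qr: "q * r = m" and g: "monomial_mat g" "\<And>j. entry g j ^ m = 1"
  shows "card {y. (\<forall>j. y j ^ r = 1) \<and> potential q y g}
    = (if \<forall>S\<in>cycle_supports g. (\<Prod>j\<in>S. entry g j) ^ q = 1 then r ^ card (cycle_supports g) else 0)"
proof -
  let ?u = "und_perm g"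
  let ?Y = "{y. (\<forall>j. y j ^ r = 1) \<and> potential q y g}"
  note u = monomial_matD(1)[OF g(1)]
  have ex: "(\<exists>y. y \<in> ?Y) \<longleftrightarrow> (\<forall>S\<in>cycle_supports g. (\<Prod>j\<in>S. entry g j) ^ q = 1)"
  proof
    assume "\<exists>y. y \<in> ?Y"
    then obtain y where Y: "y \<in> ?Y" by blast
    have y: "y j ^ r = 1" "y (?u j) = entry g j ^ q * y j" for j
      using Y by (auto simp: potential_def)
    have "(\<Prod>j\<in>S. entry g j ^ q) = 1" if "S \<in> cycle_supports g" for S
      using u unity_roots_nonzero[OF r y(1)] y(2) that[unfolded cycle_supports_def]
      by (rule orbit_coboundary_prod)
    then show "\<forall>S\<in>cycle_supports g. (\<Prod>j\<in>S. entry g j) ^ q = 1" by (simp add: prod_power_distrib)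
  next
    assume *: "\<forall>S\<in>cycle_supports g. (\<Prod>j\<in>S. entry g j) ^ q = 1"
    have "\<exists>y. \<forall>j. y j \<in> unity_roots r \<and> y (?u j) = entry g j ^ q * y j"
    proof (rule orbit_coboundary_exists[OF u])
      show "(\<Prod>j\<in>S. entry g j ^ q) = 1" if "S \<in> range (orbit ?u)" for S
        using * that by (auto simp: cycle_supports_def prod_power_distrib)
      show "entry g j ^ q \<in> unity_roots r" for j
        using g(2)[of j] by (simp add: qr[symmetric] power_mult)
    qed (simp_all add: power_mult_distrib)
    then obtain y where "\<forall>j. y j \<in> unity_roots r \<and> y (?u j) = entry g j ^ q * y j" by blast
    then have "y \<in> ?Y" by (simp add: potential_def)
    then show "\<exists>y. y \<in> ?Y" by blast
  qed
  show ?thesis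
  proof (cases "\<exists>y. y \<in> ?Y")
    case True
    then obtain y0 where y0: "\<And>j. y0 j ^ r = 1" "potential q y0 g" by blast
    have nz: "y0 j \<noteq> 0" for j using unity_roots_nonzero[OF r y0(1)] .
    let ?Z = "{z. (\<forall>j. z j \<in> unity_roots r) \<and> (\<forall>j. z (?u j) = z j)}"
    have "bij_betw (\<lambda>z j. z j * y0 j) ?Z ?Y"
    proof (rule bij_betw_byWitness[of _ "\<lambda>y j. y j / y0 j"])
      show "\<forall>z\<in>?Z. (\<lambda>j. z j * y0 j / y0 j) = z" using nz by simp
      show "\<forall>y\<in>?Y. (\<lambda>j. y j / y0 j * y0 j) = y" using nz by simp
      show "(\<lambda>z j. z j * y0 j) ` ?Z \<subseteq> ?Y"
        using y0 by (auto simp: potential_def power_mult_distrib mult.left_commute)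
      show "(\<lambda>y j. y j / y0 j) ` ?Y \<subseteq> ?Z"
      proof (rule image_subsetI)
        fix y assume y: "y \<in> ?Y"
        have "y (?u j) / y0 (?u j) = y j / y0 j" for j
        proof -
          have "y (?u j) = entry g j ^ q * y j" "y0 (?u j) = entry g j ^ q * y0 j"
            using y y0(2) by (auto simp: potential_def)
          then show ?thesis using monomial_matD(3)[OF g(1), of j] by simp
        qed
        then show "(\<lambda>j. y j / y0 j) \<in> ?Z" using y y0 by (simp add: power_divide)
      qed
    qed
    then have "card ?Y = card ?Z" by (rule bij_betw_same_card[symmetric])
    also have "\<dots> = r ^ card (cycle_supports g)"
      using card_functions_constant_on_orbits[OF u, of "unity_roots r"] r finite_roots_unity[of r] card_roots_unity_eq[OF r]
      by (simp add: cycle_supports_def)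
    finally show ?thesis using ex True by simp
  next
    case False
    then have "?Y = {}" by blast
    then have "card ?Y = 0" by (simp only: card.empty)
    moreover have "\<not> (\<forall>S\<in>cycle_supports g. (\<Prod>j\<in>S. entry g j) ^ q = 1)" using ex False by blast
    ultimately show ?thesis by (simp only: if_False)
  qed
qed

lemma Sym_mats_generated_perm:
  fixes T :: "(complex ^ 'n ^ 'n) set"
  assumes T: "T \<subseteq> Sym_mats" and gen: "generate (mat_group Sym_mats) T = Sym_mats" and u: "bij u"
  shows "\<exists>\<gamma>\<in>mprods T. und_perm \<gamma> = u"
proof -
  have "cmat u (\<lambda>_. 1) \<in> Sym_mats"
    using u by (simp add: Gmpn_iff monomial_mat_cmat entry_cmat color_prod_def)
  then have "cmat u (\<lambda>_. 1) \<in> mprods T"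
    using generate_Gmpn_eq_mprods[of 1 T 1] T gen by simp
  moreover have "und_perm (cmat u (\<lambda>_. 1)) = u" by (rule und_perm_cmat) simp
  ultimately show ?thesis by (rule bexI[rotated])
qed

lemma Sym_mats_generated_transitive:
  fixes T :: "(complex ^ 'n ^ 'n) set"
  assumes T: "T \<subseteq> Sym_mats" and gen: "generate (mat_group Sym_mats) T = Sym_mats"
  shows "transitive_on_indices T"
  unfolding transitive_on_indices_def
proof (intro allI)
  fix i j :: 'n
  obtain \<gamma> where \<gamma>: "\<gamma> \<in> mprods T" "und_perm \<gamma> = Transposition.transpose i j"
    using Sym_mats_generated_perm[OF T gen bij_transpose] by blast
  then have "und_perm \<gamma> i = j" by simp
  with \<gamma>(1) show "\<exists>\<gamma>\<in>mprods T. und_perm \<gamma> i = j" by (rule bexI[rotated])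
qed

abbreviation moved :: "(complex ^ 'n ^ 'n) list \<Rightarrow> (complex ^ 'n ^ 'n) list" where
  "moved ws \<equiv> filter (\<lambda>w. und_perm w \<noteq> id) ws"

lemma skel_moved_Sym:
  fixes ts :: "(complex ^ 'n ^ 'n) list"
  assumes "\<And>t. t \<in> set ts \<Longrightarrow> monomial_mat t"
  shows "set (moved (map skel ts)) \<subseteq> Sym_mats"
  using assms
  by (auto simp: skel_def und_perm_skel Gmpn_iff monomial_mat_perm_proj entry_perm_proj color_prod_def)

lemma transitive_of_skeleton:
  fixes ts :: "(complex ^ 'n ^ 'n) list"
  assumes mono: "\<And>t. t \<in> set ts \<Longrightarrow> monomial_mat t"
    and gen: "generate (mat_group Sym_mats) (set (moved (map skel ts))) = Sym_mats"
  shows "transitive_on_indices (set ts)"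
  unfolding transitive_on_indices_def
proof (intro allI)
  fix i j
  have "set (moved (map skel ts)) \<subseteq> Sym_mats" using mono by (rule skel_moved_Sym)
  then have "transitive_on_indices (set (moved (map skel ts)))"
    using gen by (rule Sym_mats_generated_transitive)
  then obtain vs where vs: "set vs \<subseteq> set (moved (map skel ts))" "und_perm (mprod vs) i = j"
    unfolding transitive_on_indices_def by blast
  have "set vs \<subseteq> skel ` set ts" using vs by auto
  then obtain ts' where ts': "vs = map skel ts'" "set ts' \<subseteq> set ts"
    using map_preimage_list by blast
  have "und_perm (mprod ts') = und_perm (mprod vs)"
    unfolding ts' using ts' mono by (intro und_perm_mprod_skel[symmetric]) blast
  then have "und_perm (mprod ts') i = j" using vs(2) by (simp only:)
  moreover have "mprod ts' \<in> mprods (set ts)" using ts'(2) by blast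
  ultimately show "\<exists>\<gamma>\<in>mprods (set ts). und_perm \<gamma> i = j" by (rule bexI)
qed

text \<open>
  Double counting of the pairs of a coloring \<open>ts\<close> of \<open>ws\<close> with product \<open>g\<close> and a trivialization \<open>y\<close> of \<open>ts\<close>.
  Both sides are multiplied by \<open>q ^ (n - 1)\<close>, with \<open>q = m div r\<close>, so that no quotient of natural numbers occurs.
\<close>

lemma card_trivial_mod_colorings:
  fixes g :: "complex ^ 'n ^ 'n"
  assumes m: "m > 0" and p: "p dvd m" and r: "r dvd p"
    and g: "g \<in> Gmpn m p"
    and ws: "set ws \<subseteq> skel ` reflections (Gmpn m p)"
    and gen: "generate (mat_group Sym_mats) (set (moved ws)) = Sym_mats"
    and gws: "und_perm g = und_perm (mprod ws)" "color_prod g = color_prod (mprod ws)"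
  shows "card {ts. set ts \<subseteq> reflections (Gmpn m p) \<and> map skel ts = ws \<and> mprod ts = g \<and> trivial_mod m r (set ts)}
      * r * (m div r) ^ (CARD('n) - 1)
    = (if \<forall>S\<in>cycle_supports g. (\<Prod>j\<in>S. entry g j) ^ (m div r) = 1
       then r ^ card (cycle_supports g) * (m div r) ^ length (moved ws) else 0)"
proof -
  define q where "q = m div r"
  have "r dvd m" using r p dvd_trans by blast
  then have qr: "q * r = m" by (simp add: q_def)
  have r0: "r > 0" using qr m by (auto intro: Nat.gr0I)
  let ?R = "reflections (Gmpn m p) :: (complex ^ 'n ^ 'n) set"
  let ?L = "{ts. set ts \<subseteq> ?R \<and> map skel ts = ws \<and> mprod ts = g}"
  let ?Y = "{y :: 'n \<Rightarrow> complex. \<forall>j. y j ^ r = 1}"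
  let ?P = "\<lambda>ts y. \<forall>t\<in>set ts. potential q y t"
  have ws_mono: "monomial_mat w" if "w \<in> set ws" for w
    using that ws monomial_mat_skel monomial_reflection by blast
  have moved_Sym: "set (moved ws) \<subseteq> Sym_mats"
  proof -
    obtain ts where ts: "ws = map skel ts" "set ts \<subseteq> ?R"
      using map_preimage_list[OF ws] by blast
    have "monomial_mat t" if "t \<in> set ts" for t using that ts(2) monomial_reflection by blast
    then show ?thesis unfolding ts(1) by (rule skel_moved_Sym)
  qed
  have finL: "finite ?L"
    by (rule finite_subset[OF _ finite_lists_map_eq[OF finite_reflections[OF m, of p], of skel ws]]) auto
  have finY: "finite ?Y"
  proof (rule finite_subset)
    show "?Y \<subseteq> PiE UNIV (\<lambda>_. unity_roots r)" by auto
    show "finite (PiE (UNIV :: 'n set) (\<lambda>_. unity_roots r))"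
      using r0 by (intro finite_PiE finite_roots_unity) auto
  qed
  have trans_ws: "transitive_on_indices (set (moved ws))"
    by (rule Sym_mats_generated_transitive[OF moved_Sym gen])
  have trans: "transitive_on_indices (set ts)" if ts: "ts \<in> ?L" for ts
  proof (rule transitive_of_skeleton)
    show "monomial_mat t" if "t \<in> set ts" for t using that ts monomial_reflection by blast
    show "generate (mat_group Sym_mats) (set (moved (map skel ts))) = Sym_mats" using ts gen by blast
  qed
  have one: "card {y \<in> ?Y. ?P ts y} = (if trivial_mod m r (set ts) then r else 0)" if ts: "ts \<in> ?L" for ts
  proof -
    have "t \<in> set ts \<Longrightarrow> monomial_mat t" for t using ts monomial_reflection by blast
    from card_potentials_transitive[OF r0 this trans[OF ts], of q] show ?thesis
      by (simp add: trivial_mod_def q_def)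
  qed
  define N where "N y = card {ts \<in> ?L. ?P ts y}" for y
  have N: "N y * q ^ (CARD('n) - 1) = (if potential q y g then q ^ length (moved ws) else 0)" if y: "y \<in> ?Y" for y
  proof (cases "potential q y g")
    case True
    interpret colored_words m p q r y
      using m p r qr y by unfold_locales auto
    have "{ts \<in> ?L. ?P ts y} = colorings ws g"
      by (auto simp: colorings_def letters_def)
    then have eq: "N y = card (colorings ws g)" unfolding N_def by (simp only:)
    have "shift_inv ws i j" for i j
    proof -
      obtain vs where vs: "set vs \<subseteq> set (moved ws)" "und_perm (mprod vs) j = i"
        using trans_ws unfolding transitive_on_indices_def by blast
      then have "set vs \<subseteq> set ws" by auto
      then show ?thesis using shift_inv_mprod[of vs ws j] vs ws_mono by simp
    qed
    then show ?thesis
      using card_colorings[OF ws _ GmpnD(1)[OF g] True gws] True by (simp add: eq)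
  next
    case False
    have "{ts \<in> ?L. ?P ts y} = {}"
    proof (intro equals0I)
      fix ts assume ts: "ts \<in> {ts \<in> ?L. ?P ts y}"
      then have "potential q y (mprod ts)"
        using monomial_reflection by (intro potential_mprod) blast
      then show False using False ts by simp
    qed
    then have "N y = 0" unfolding N_def by (simp only: card.empty)
    then show ?thesis using False by simp
  qed
  have "(\<Sum>ts\<in>?L. card {y \<in> ?Y. ?P ts y}) = (\<Sum>y\<in>?Y. N y)"
    by (rule sum_multicount_gen[OF finL finY]) (simp add: N_def)
  moreover have "(\<Sum>ts\<in>?L. card {y \<in> ?Y. ?P ts y}) = r * card {ts \<in> ?L. trivial_mod m r (set ts)}"
  proof -
    have "(\<Sum>ts\<in>?L. card {y \<in> ?Y. ?P ts y}) = (\<Sum>ts\<in>?L. if trivial_mod m r (set ts) then r else 0)"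
      by (rule sum.cong[OF refl one])
    also have "\<dots> = (\<Sum>ts\<in>{ts \<in> ?L. trivial_mod m r (set ts)}. r)"
      by (rule sum.inter_filter[OF finL, symmetric])
    finally show ?thesis by simp
  qed
  ultimately have "r * card {ts \<in> ?L. trivial_mod m r (set ts)} * q ^ (CARD('n) - 1)
      = (\<Sum>y\<in>?Y. N y * q ^ (CARD('n) - 1))"
    by (simp only: sum_distrib_right[symmetric])
  also have "\<dots> = (\<Sum>y\<in>?Y. if potential q y g then q ^ length (moved ws) else 0)"
    by (rule sum.cong[OF refl N])
  also have "\<dots> = (\<Sum>y\<in>{y \<in> ?Y. potential q y g}. q ^ length (moved ws))"
    by (rule sum.inter_filter[OF finY, symmetric])
  also have "\<dots> = card {y. (\<forall>j. y j ^ r = 1) \<and> potential q y g} * q ^ length (moved ws)"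
    by simp
  also have "card {y. (\<forall>j. y j ^ r = 1) \<and> potential q y g}
      = (if \<forall>S\<in>cycle_supports g. (\<Prod>j\<in>S. entry g j) ^ q = 1 then r ^ card (cycle_supports g) else 0)"
    by (rule card_potentials_single[OF r0 qr GmpnD(1,2)[OF g]])
  finally have fin: "card {ts \<in> ?L. trivial_mod m r (set ts)} * r * q ^ (CARD('n) - 1)
      = (if \<forall>S\<in>cycle_supports g. (\<Prod>j\<in>S. entry g j) ^ q = 1 then r ^ card (cycle_supports g) else 0)
        * q ^ length (moved ws)"
    by (simp only: mult.commute[of r])
  have eq: "{ts \<in> ?L. trivial_mod m r (set ts)}
      = {ts. set ts \<subseteq> ?R \<and> map skel ts = ws \<and> mprod ts = g \<and> trivial_mod m r (set ts)}"
    by auto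
  have "(if P then a else 0) * b = (if P then a * b else 0)" for P and a b :: nat by simp
  with fin show ?thesis unfolding eq q_def by (simp only:)
qed

text \<open>
  Let \<open>H\<close> be the set of entries at a point \<open>i0\<close> of those elements of the generated group whose permutation fixes
  \<open>i0\<close>. Conjugation with diagonal matrices does not affect it, and a family of group elements that move
  \<open>i0\<close> to each other point shows that \<open>T\<close> is trivial modulo \<open>r\<close> iff \<open>h ^ (m div r) = 1\<close> for all \<open>h \<in> H\<close>. As
  \<open>H\<close> is the group of \<open>k\<close>-th roots of unity for some \<open>k\<close>, this means that \<open>k\<close> divides \<open>m div r\<close>.
\<close>

lemma trivial_mod_iff_divisor:
  fixes T :: "(complex ^ 'n ^ 'n) set"
  assumes m: "m > 0" and T: "T \<subseteq> Gmpn m 1" and trans: "transitive_on_indices T"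
  shows "\<exists>e>0. \<forall>r. r dvd m \<longrightarrow> (trivial_mod m r T \<longleftrightarrow> r dvd e)"
proof -
  obtain i0 :: 'n where True by blast
  have W: "\<gamma> \<in> Gmpn m 1" if \<gamma>: "\<gamma> \<in> mprods T" for \<gamma>
  proof -
    obtain vs where "\<gamma> = mprod vs" "set vs \<subseteq> T" using \<gamma> by blast
    moreover have "set vs \<subseteq> T \<Longrightarrow> mprod vs \<in> Gmpn m 1"
      using T by (induction vs) (auto simp: Gmpn_1 intro: Gmpn_mult)
    ultimately show ?thesis by simp
  qed
  note mono = GmpnD(1)[OF W]
  define H where "H = {entry \<gamma> i0 | \<gamma>. \<gamma> \<in> mprods T \<and> und_perm \<gamma> i0 = i0}"
  have H_mult: "entry \<gamma> i0 \<in> H" if "\<gamma> \<in> mprods T" "und_perm \<gamma> i0 = i0" for \<gamma>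
    unfolding H_def using that by blast
  have "\<exists>k. k dvd m \<and> k > 0 \<and> H = unity_roots k"
  proof -
    have sub: "H \<subseteq> unity_roots m" using GmpnD(2)[OF W] by (auto simp: H_def)
    have one: "1 \<in> H"
      using H_mult[OF mprods_1] by (simp add: und_perm_1 entry_1)
    have mult: "a * b \<in> H" if ab: "a \<in> H" "b \<in> H" for a b
    proof -
      obtain \<gamma> \<delta> where *: "\<gamma> \<in> mprods T" "und_perm \<gamma> i0 = i0" "a = entry \<gamma> i0"
        "\<delta> \<in> mprods T" "und_perm \<delta> i0 = i0" "b = entry \<delta> i0"
        using ab unfolding H_def by blast
      have "entry (\<gamma> ** \<delta>) i0 = a * b" "und_perm (\<gamma> ** \<delta>) i0 = i0"
        using * mono by (simp_all add: entry_mult und_perm_mult)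
      then show ?thesis using H_mult[OF mprods_mult[OF *(1,4)]] by simp
    qed
    show ?thesis using unity_roots_closed_subset[OF m sub one mult] by metis
  qed
  then obtain k where k: "k dvd m" "k > 0" "H = unity_roots k" by blast
  have "trivial_mod m r T \<longleftrightarrow> r dvd m div k" if rm: "r dvd m" for r
  proof -
    define q where "q = m div r"
    have qr: "q * r = m" using rm by (simp add: q_def)
    have r0: "r > 0" using qr m by (auto intro: Nat.gr0I)
    have "trivial_mod m r T \<longleftrightarrow> H \<subseteq> unity_roots q"
    proof
      assume "trivial_mod m r T"
      then obtain y where y: "\<And>j. y j ^ r = 1" "\<And>t. t \<in> T \<Longrightarrow> potential q y t"
        by (auto simp: trivial_mod_def q_def)
      show "H \<subseteq> unity_roots q"
      proof
        fix h assume "h \<in> H"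
        then obtain vs where vs: "set vs \<subseteq> T" "und_perm (mprod vs) i0 = i0" "h = entry (mprod vs) i0"
          unfolding H_def by blast
        have "potential q y (mprod vs)"
          using vs y(2) T GmpnD(1) by (intro potential_mprod) blast
        then have "h ^ q * y i0 = y i0" using vs unfolding potential_def by metis
        then show "h \<in> unity_roots q" using unity_roots_nonzero[OF r0 y(1)] by simp
      qed
    next
      assume H: "H \<subseteq> unity_roots q"
      define \<gamma> where "\<gamma> j = (SOME \<gamma>. \<gamma> \<in> mprods T \<and> und_perm \<gamma> i0 = j)" for j
      have \<gamma>: "\<gamma> j \<in> mprods T \<and> und_perm (\<gamma> j) i0 = j" for j
        unfolding \<gamma>_def by (rule someI_ex) (use trans in \<open>unfold transitive_on_indices_def, blast\<close>)
      define y where "y j = entry (\<gamma> j) i0 ^ q" for j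
      have "y j ^ r = 1" for j
        using GmpnD(2)[OF W[of "\<gamma> j"]] \<gamma> by (simp add: y_def power_mult[symmetric] qr)
      moreover have "potential q y t" if t: "t \<in> T" for t
        unfolding potential_def
      proof
        fix j
        let ?k = "und_perm t j"
        \<comment> \<open>Closing both paths from \<open>i0\<close> to \<open>?k\<close> with the same \<open>\<delta>\<close> avoids inverses.\<close>
        obtain \<delta> where \<delta>: "\<delta> \<in> mprods T" "und_perm \<delta> ?k = i0"
          using trans unfolding transitive_on_indices_def by blast
        have tW: "t \<in> mprods T" by (rule mprods_incl[OF t])
        have m3: "monomial_mat \<delta>" "monomial_mat t" "monomial_mat (\<gamma> j)" "monomial_mat (\<gamma> ?k)"
          using mono \<delta>(1) tW \<gamma> by blast+
        have 1: "entry (\<delta> ** (t ** \<gamma> j)) i0 \<in> H"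
        proof (rule H_mult)
          show "\<delta> ** (t ** \<gamma> j) \<in> mprods T"
            using mprods_mult[OF \<delta>(1) mprods_mult[OF tW \<gamma>[of j, THEN conjunct1]]] .
          show "und_perm (\<delta> ** (t ** \<gamma> j)) i0 = i0"
            using \<delta>(2) \<gamma>[of j, THEN conjunct2] m3 by (simp add: und_perm_mult monomial_mat_mult)
        qed
        have 2: "entry (\<delta> ** \<gamma> ?k) i0 \<in> H"
        proof (rule H_mult)
          show "\<delta> ** \<gamma> ?k \<in> mprods T"
            using mprods_mult[OF \<delta>(1) \<gamma>[of ?k, THEN conjunct1]] .
          show "und_perm (\<delta> ** \<gamma> ?k) i0 = i0"
            using \<delta>(2) \<gamma>[of ?k, THEN conjunct2] m3 by (simp add: und_perm_mult)
        qed
        have "entry (\<delta> ** (t ** \<gamma> j)) i0 = entry \<delta> ?k * (entry t j * entry (\<gamma> j) i0)"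
          using m3 \<gamma>[of j] by (simp add: entry_mult und_perm_mult monomial_mat_mult)
        then have 3: "entry \<delta> ?k ^ q * (entry t j ^ q * y j) = 1" using 1 H by (auto simp: y_def power_mult_distrib)
        have "entry (\<delta> ** \<gamma> ?k) i0 = entry \<delta> ?k * entry (\<gamma> ?k) i0"
          using m3 \<gamma>[of ?k] by (simp add: entry_mult)
        then have 4: "entry \<delta> ?k ^ q * y ?k = 1" using 2 H by (auto simp: y_def power_mult_distrib)
        show "entry t j ^ q * y j = y ?k"
          using 3 4 monomial_matD(3)[OF m3(1), of ?k] by (metis mult_left_cancel power_not_zero)
      qed
      ultimately show "trivial_mod m r T" unfolding trivial_mod_def q_def[symmetric] by blast
    qed
    also have "\<dots> \<longleftrightarrow> k dvd q" unfolding k(3) by (rule unity_roots_subset_iff[OF k(2)])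
    also have "\<dots> \<longleftrightarrow> r dvd m div k"
    proof -
      obtain l where l: "m = k * l" using k(1) by blast
      have "k dvd q \<longleftrightarrow> k * r dvd q * r" using r0 by simp
      also have "\<dots> \<longleftrightarrow> k * r dvd k * l" using l qr by simp
      also have "\<dots> \<longleftrightarrow> r dvd m div k" using k(2) l by simp
      finally show ?thesis .
    qed
    finally show ?thesis .
  qed
  moreover have "m div k > 0" using k m by (auto elim: dvdE)
  ultimately show ?thesis by blast
qed

lemma sum_moebius_trivial_mod:
  fixes T :: "(complex ^ 'n ^ 'n) set"
  assumes m: "m > 0" and p: "p dvd m" and T: "T \<subseteq> Gmpn m 1" and trans: "transitive_on_indices T"
  shows "(\<Sum>r | r dvd p \<and> trivial_mod m r T. moebius_mu r) = (if \<forall>r. r dvd p \<longrightarrow> trivial_mod m r T \<longrightarrow> r = 1 then 1 else 0)"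
proof -
  obtain e where e: "e > 0" "\<And>r. r dvd m \<Longrightarrow> trivial_mod m r T \<longleftrightarrow> r dvd e"
    using trivial_mod_iff_divisor[OF m T trans] by blast
  have iff: "r dvd p \<and> trivial_mod m r T \<longleftrightarrow> r dvd gcd p e" for r
    using e(2) p dvd_trans by auto
  have "gcd p e > 0" using e(1) by simp
  then have "(\<Sum>r | r dvd p \<and> trivial_mod m r T. moebius_mu r) = (if gcd p e = 1 then 1 else 0)"
    unfolding iff by (rule sum_moebius_mu_divisors)
  moreover have "gcd p e = 1 \<longleftrightarrow> (\<forall>r. r dvd p \<longrightarrow> trivial_mod m r T \<longrightarrow> r = 1)"
    using iff by (metis dvd_refl nat_dvd_1_iff_1)
  ultimately show ?thesis by simp
qed

section \<open>Full families of reflections\<close>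

definition color_mat :: "complex ^ 'n ^ 'n \<Rightarrow> complex ^ 1 ^ 1" where
  "color_mat t = mat (color_prod t)"

lemma mat_eq_cmat_1: "(mat z :: complex ^ 1 ^ 1) = cmat id (\<lambda>_. z)"
  by (simp add: mat_def cmat_def vec_eq_iff)

lemma mat_1_mult: "(mat x :: complex ^ 1 ^ 1) ** mat z = mat (x * z)"
  by (simp add: mat_eq_cmat_1 cmat_mult)

lemma mat_1_inj: "(mat x :: complex ^ 1 ^ 1) = mat z \<longleftrightarrow> x = z"
  by (simp add: mat_def vec_eq_iff)

lemma Gmpn_dim_1:
  assumes "m > 0"
  shows "(Gmpn m p :: (complex ^ 1 ^ 1) set) = {mat z | z. z ^ m = 1 \<and> z ^ (m div p) = 1}"
proof (intro equalityI subsetI)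
  fix w :: "complex ^ 1 ^ 1"
  assume w: "w \<in> Gmpn m p"
  have "w = cmat (und_perm w) (entry w)" using monomial_matD(4)[OF GmpnD(1)[OF w]] by simp
  moreover have "und_perm w = id" by (simp add: fun_eq_iff)
  moreover have "entry w = (\<lambda>_. entry w 1)" by (intro ext arg_cong[of _ _ "entry w"] num1_eqI)
  ultimately have "w = mat (entry w 1)" unfolding mat_eq_cmat_1 by metis
  moreover have "color_prod w = entry w 1" by (simp add: color_prod_def)
  ultimately show "w \<in> {mat z | z. z ^ m = 1 \<and> z ^ (m div p) = 1}" using GmpnD(2,3)[OF w] by auto
next
  fix w :: "complex ^ 1 ^ 1"
  assume "w \<in> {mat z | z. z ^ m = 1 \<and> z ^ (m div p) = 1}"
  then obtain z where z: "w = mat z" "z ^ m = 1" "z ^ (m div p) = 1" by blast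
  moreover have nz: "z \<noteq> 0" using unity_roots_nonzero[OF assms z(2)] .
  ultimately show "w \<in> Gmpn m p"
    by (simp add: mat_eq_cmat_1 Gmpn_iff monomial_mat_cmat entry_cmat color_prod_def)
qed

lemma reflections_dim_1:
  assumes "m > 0"
  shows "reflections (Gmpn m p :: (complex ^ 1 ^ 1) set) = {mat z | z. z \<noteq> 1 \<and> z ^ m = 1 \<and> z ^ (m div p) = 1}"
proof -
  have "dref a z = (mat z :: complex ^ 1 ^ 1)" for a :: 1 and z
    unfolding dref_def mat_eq_cmat_1 by (intro arg_cong2[of _ _ _ _ cmat] ext) (simp_all add: num1_eq_iff)
  then show ?thesis unfolding reflections_Gmpn[OF assms] by auto
qed

abbreviation diags :: "(complex ^ 'n ^ 'n) list \<Rightarrow> (complex ^ 'n ^ 'n) list" where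
  "diags ws \<equiv> filter (\<lambda>w. und_perm w = id) ws"

lemma mprod_Cons: "mprod (v # vs) = v ** mprod vs"
  by simp

lemma perm_proj_mprod:
  fixes vs :: "(complex ^ 'n ^ 'n) list"
  assumes "\<And>v. v \<in> set vs \<Longrightarrow> monomial_mat v"
  shows "perm_proj (mprod vs) = mprod (map skel (moved vs))"
  using assms
proof (induction vs)
  case Nil
  have "perm_proj (mat 1) = cmat id (\<lambda>_. 1)" unfolding perm_proj_cmat by (simp only: und_perm_1)
  then show ?case by (simp add: mat_1_eq_cmat)
next
  case (Cons v vs)
  have m: "monomial_mat v" "monomial_mat (mprod vs)" using Cons.prems by (auto intro: monomial_mat_mprod)
  have *: "perm_proj (v ** mprod vs) = perm_proj v ** perm_proj (mprod vs)"
    by (simp add: perm_proj_cmat cmat_mult und_perm_mult[OF m])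
  have one: "perm_proj v = mat 1" if "und_perm v = id" using that by (simp add: perm_proj_cmat mat_1_eq_cmat)
  have IH: "perm_proj (mprod vs) = mprod (map skel (moved vs))"
    using Cons.prems by (intro Cons.IH) simp
  show ?case
  proof (cases "und_perm v = id")
    case True
    then have "moved (v # vs) = moved vs" by simp
    then show ?thesis using * one[OF True] IH by (simp only: mprod_Cons matrix_mul_lid)
  next
    case False
    then have "moved (v # vs) = v # moved vs" "skel v = perm_proj v" by (simp_all add: skel_def)
    then show ?thesis using * IH by (simp only: mprod_Cons list.map)
  qed
qed

lemma color_mat_mprod:
  fixes vs :: "(complex ^ 'n ^ 'n) list"
  assumes "m > 0" "set vs \<subseteq> reflections (Gmpn m p)"
  shows "color_mat (mprod vs) = mprod (map color_mat (diags vs))"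
  using assms(2)
proof (induction vs)
  case Nil
  then show ?case by (simp add: color_mat_def color_prod_1)
next
  case (Cons v vs)
  have v: "v \<in> reflections (Gmpn m p)" using Cons.prems by simp
  have "monomial_mat t" if "t \<in> set vs" for t using Cons.prems that monomial_reflection by auto
  then have mm: "monomial_mat v" "monomial_mat (mprod vs)"
    using v monomial_reflection by (auto intro: monomial_mat_mprod)
  have *: "color_mat (v ** mprod vs) = color_mat v ** color_mat (mprod vs)"
    by (simp add: color_mat_def color_prod_mult[OF mm] mat_1_mult)
  have IH: "color_mat (mprod vs) = mprod (map color_mat (diags vs))"
    using Cons.prems by (intro Cons.IH) simp
  have one: "color_mat v = mat 1" if ne: "und_perm v \<noteq> id"
    using assms(1) v
  proof (cases rule: reflections_Gmpn_cases)
    case (tref a b x)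
    then show ?thesis by (simp add: color_mat_def color_prod_tref)
  next
    case (dref a z)
    then show ?thesis using ne by (simp add: und_perm_dref)
  qed
  show ?case
  proof (cases "und_perm v = id")
    case True
    then have "diags (v # vs) = v # diags vs" by simp
    then show ?thesis using * IH by (simp only: mprod_Cons list.map)
  next
    case False
    then have "diags (v # vs) = diags vs" by simp
    then show ?thesis using * one[OF False] IH by (simp only: mprod_Cons matrix_mul_lid)
  qed
qed

lemma diagonal_reflection:
  fixes t :: "complex ^ 'n ^ 'n"
  assumes "m > 0" "t \<in> reflections (Gmpn m p)" "und_perm t = id"
  obtains a z where "z \<noteq> 1" "z \<noteq> 0" "z ^ m = 1" "z ^ (m div p) = 1" "t = dref a z"
  using assms(1,2)
proof (cases rule: reflections_Gmpn_cases)
  case (tref a b x)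
  then show ?thesis using assms(3) transpose_neq_id[of a b] by (simp add: und_perm_tref)
qed (rule that)

lemma color_mat_diagonal_in_Gmpn:
  fixes t :: "complex ^ 'n ^ 'n"
  assumes "m > 0" "t \<in> reflections (Gmpn m p)" "und_perm t = id"
  shows "color_mat t \<in> Gmpn m p"
proof -
  obtain a z where "z \<noteq> 0" "z ^ m = 1" "z ^ (m div p) = 1" "t = dref a z"
    using diagonal_reflection[OF assms] by metis
  then show ?thesis by (auto simp: color_mat_def color_prod_dref Gmpn_dim_1[OF assms(1)])
qed

lemma mprods_subset_Gmpn:
  fixes T :: "(complex ^ 'n ^ 'n) set"
  assumes "T \<subseteq> Gmpn m p"
  shows "mprods T \<subseteq> Gmpn m p"
proof
  fix \<gamma> assume "\<gamma> \<in> mprods T"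
  then obtain vs where "\<gamma> = mprod vs" "set vs \<subseteq> T" by blast
  moreover have "set vs \<subseteq> T \<Longrightarrow> mprod vs \<in> Gmpn m p"
    using assms by (induction vs) (auto simp: Gmpn_1 intro: Gmpn_mult)
  ultimately show "\<gamma> \<in> Gmpn m p" by simp
qed

lemma mprods_cinv:
  fixes T :: "(complex ^ 'n ^ 'n) set"
  assumes m: "m > 0" and T: "T \<subseteq> Gmpn m p" and \<gamma>: "\<gamma> \<in> mprods T"
  shows "cinv \<gamma> \<in> mprods T"
proof -
  let ?G = "mat_group (Gmpn m p :: (complex ^ 'n ^ 'n) set)"
  interpret Group.group ?G by (rule group_Gmpn)
  have TG: "T \<subseteq> carrier ?G" using T by (simp add: mat_group_def)
  have gen: "generate ?G T = mprods T" by (rule generate_Gmpn_eq_mprods[OF m T])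
  have \<gamma>G: "\<gamma> \<in> Gmpn m p" using mprods_subset_Gmpn[OF T] \<gamma> by blast
  then have c: "\<gamma> \<in> carrier ?G" by (simp add: mat_group_def)
  have "inv\<^bsub>?G\<^esub> \<gamma> \<in> mprods T" using generate_m_inv_closed[OF TG] \<gamma> by (simp only: gen)
  moreover have "inv\<^bsub>?G\<^esub> \<gamma> = cinv \<gamma>"
  proof (rule inv_equality)
    show "cinv \<gamma> \<otimes>\<^bsub>?G\<^esub> \<gamma> = \<one>\<^bsub>?G\<^esub>" using cinv_mult[OF GmpnD(1)[OF \<gamma>G]] by (simp add: mat_group_def)
    show "cinv \<gamma> \<in> carrier ?G" using Gmpn_cinv[OF \<gamma>G] by (simp add: mat_group_def)
  qed (rule c)
  ultimately show ?thesis by simp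
qed

lemma conj_tref:
  fixes \<gamma> :: "complex ^ 'n ^ 'n"
  assumes \<gamma>: "monomial_mat \<gamma>" and "a \<noteq> b" "x \<noteq> 0"
  shows "\<gamma> ** tref a b x ** cinv \<gamma>
    = tref (und_perm \<gamma> a) (und_perm \<gamma> b) (x * entry \<gamma> b / entry \<gamma> a)"
proof -
  note inj = inj_eq[OF monomial_matD(2)[OF \<gamma>]]
  note nz = monomial_matD(3)[OF \<gamma>]
  let ?x = "x * entry \<gamma> b / entry \<gamma> a"
  have x: "?x \<noteq> 0" using nz assms by simp
  have "\<gamma> ** tref a b x = tref (und_perm \<gamma> a) (und_perm \<gamma> b) ?x ** \<gamma>"
    by (rule monomial_mat_eqI)
       (use assms nz inj x in \<open>auto simp: monomial_mat_mult monomial_mat_tref und_perm_mult und_perm_tref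
          entry_mult entry_tref Transposition.transpose_def\<close>)
  then show ?thesis using cinv_mult[OF \<gamma>] by (metis matrix_mul_assoc matrix_mul_rid)
qed

lemma conj_dref:
  fixes \<gamma> :: "complex ^ 'n ^ 'n"
  assumes \<gamma>: "monomial_mat \<gamma>" and "z \<noteq> 0"
  shows "\<gamma> ** dref a z ** cinv \<gamma> = dref (und_perm \<gamma> a) z"
proof -
  note inj = inj_eq[OF monomial_matD(2)[OF \<gamma>]]
  have "\<gamma> ** dref a z = dref (und_perm \<gamma> a) z ** \<gamma>"
    by (rule monomial_mat_eqI)
       (use assms inj in \<open>auto simp: monomial_mat_mult monomial_mat_dref und_perm_mult und_perm_dref
          entry_mult entry_dref\<close>)
  then show ?thesis using cinv_mult[OF \<gamma>] by (metis matrix_mul_assoc matrix_mul_rid)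
qed

lemma conj_bal:
  fixes \<gamma> :: "complex ^ 'n ^ 'n"
  assumes \<gamma>: "monomial_mat \<gamma>" and "h \<noteq> 0"
  shows "\<gamma> ** bal a b h ** cinv \<gamma> = bal (und_perm \<gamma> a) (und_perm \<gamma> b) h"
  using mult_bal_commute[OF assms, of a b] cinv_mult[OF \<gamma>] by (metis matrix_mul_assoc matrix_mul_rid)

lemma tref_mult_tref:
  fixes a b :: "'n::finite"
  assumes "a \<noteq> b" "x \<noteq> 0" "x' \<noteq> 0"
  shows "tref a b x ** tref a b x' = bal a b (x' / x)"
  using assms by (auto simp: tref_def bal_def cmat_mult fun_eq_iff transpose_comp_involutory
      Transposition.transpose_def intro!: arg_cong2[of _ _ _ _ cmat])

lemma dref_mult_dref_bal:
  fixes a b :: "'n::finite"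
  shows "dref a z ** dref b (1 / z) = bal a b z"
  by (auto simp: dref_def bal_def cmat_mult intro!: arg_cong2[of _ _ _ _ cmat])

lemma dref_mult_dref:
  fixes a :: "'n::finite"
  shows "dref a z ** dref a z' = dref a (z * z')"
  by (auto simp: dref_def cmat_mult intro!: arg_cong2[of _ _ _ _ cmat])

text \<open>
  Apply to the generators the homomorphism to \<open>S\<^sub>n\<close>, which kills the diagonal reflections, and the color homomorphism
  to \<open>G(m,p,1)\<close>, which kills the colored transpositions. If \<open>T\<close> is trivial modulo \<open>r\<close>, so is the whole group. For
  \<open>n \<ge> 2\<close> it contains a diagonal matrix with entries \<open>zeta m\<close> and \<open>1 / zeta m\<close>, whence \<open>r = 1\<close>.
\<close>

lemma fullness_necessary:
  fixes T :: "(complex ^ 'n ^ 'n) set"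
  assumes m: "m > 0" and p: "p > 0" "p dvd m" and n: "CARD('n) \<ge> 2 \<or> p = 1"
    and T: "T \<subseteq> reflections (Gmpn m p)"
    and gen: "generate (mat_group (Gmpn m p)) T = Gmpn m p"
  shows "generate (mat_group Sym_mats) (skel ` {t \<in> T. und_perm t \<noteq> id}) = Sym_mats"
    and "generate (mat_group (Gmpn m p)) (color_mat ` {t \<in> T. und_perm t = id}) = Gmpn m p"
    and "r dvd p \<Longrightarrow> trivial_mod m r T \<Longrightarrow> r = 1"
proof -
  have TG: "T \<subseteq> Gmpn m p" using T by (auto simp: reflections_def)
  have words: "Gmpn m p = mprods T" using generate_Gmpn_eq_mprods[OF m TG] gen by simp
  have mono: "monomial_mat t" if "t \<in> T" for t using that TG GmpnD(1) by blast
  let ?S = "skel ` {t \<in> T. und_perm t \<noteq> id}"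
  have S: "?S \<subseteq> Sym_mats"
    using mono by (auto simp: skel_def Gmpn_iff monomial_mat_perm_proj entry_perm_proj color_prod_def)
  have genS: "generate (mat_group Sym_mats) ?S = mprods ?S"
    by (rule generate_Gmpn_eq_mprods[OF _ S]) simp
  show "generate (mat_group Sym_mats) ?S = Sym_mats"
  proof
    show "generate (mat_group Sym_mats) ?S \<subseteq> Sym_mats" unfolding genS by (rule mprods_subset_Gmpn[OF S])
    show "Sym_mats \<subseteq> generate (mat_group Sym_mats) ?S" unfolding genS
    proof
      fix \<sigma> :: "complex ^ 'n ^ 'n" assume \<sigma>: "\<sigma> \<in> Sym_mats"
      then have e: "entry \<sigma> j = 1" for j using GmpnD(2) by fastforce
      then have "\<sigma> \<in> Gmpn m p" using \<sigma> by (simp add: Gmpn_iff color_prod_def)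
      then obtain vs where vs: "\<sigma> = mprod vs" "set vs \<subseteq> T" using words by blast
      have "entry \<sigma> = (\<lambda>_. 1)" using e by (rule ext)
      then have "\<sigma> = perm_proj \<sigma>"
        using monomial_matD(4)[OF GmpnD(1)[OF \<sigma>]] by (simp add: perm_proj_cmat)
      also have "\<dots> = mprod (map skel (moved vs))"
        unfolding vs(1) using vs(2) mono by (intro perm_proj_mprod) blast
      finally have "\<sigma> = mprod (map skel (moved vs))" .
      moreover have "set (map skel (moved vs)) \<subseteq> ?S" using vs(2) by auto
      ultimately show "\<sigma> \<in> mprods ?S" by blast
    qed
  qed
  let ?D = "color_mat ` {t \<in> T. und_perm t = id}"
  have D: "?D \<subseteq> Gmpn m p" using color_mat_diagonal_in_Gmpn[OF m] T by auto
  have genD: "generate (mat_group (Gmpn m p)) ?D = mprods ?D"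
    by (rule generate_Gmpn_eq_mprods[OF m D])
  show "generate (mat_group (Gmpn m p)) ?D = Gmpn m p"
  proof
    show "generate (mat_group (Gmpn m p)) ?D \<subseteq> Gmpn m p" unfolding genD by (rule mprods_subset_Gmpn[OF D])
    show "Gmpn m p \<subseteq> generate (mat_group (Gmpn m p)) ?D" unfolding genD
    proof
      fix w :: "complex ^ 1 ^ 1" assume "w \<in> Gmpn m p"
      then obtain z where z: "w = mat z" "z ^ m = 1" "z ^ (m div p) = 1"
        unfolding Gmpn_dim_1[OF m] by blast
      have nz: "z \<noteq> 0" using unity_roots_nonzero[OF m z(2)] .
      obtain a :: 'n where True by blast
      have "dref a z \<in> Gmpn m p"
        using z nz by (simp add: Gmpn_iff monomial_mat_dref entry_dref color_prod_dref)
      then obtain vs where vs: "dref a z = mprod vs" "set vs \<subseteq> T" using words by blast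
      have "w = color_mat (dref a z)" using z nz by (simp add: color_mat_def color_prod_dref)
      also have "\<dots> = mprod (map color_mat (diags vs))"
        unfolding vs(1) by (rule color_mat_mprod[OF m]) (use vs(2) T in blast)
      finally have "w = mprod (map color_mat (diags vs))" .
      moreover have "set (map color_mat (diags vs)) \<subseteq> ?D" using vs(2) by auto
      ultimately show "w \<in> mprods ?D" by blast
    qed
  qed
  show "r = 1" if r: "r dvd p" and trivial_mod: "trivial_mod m r T"
    using n
  proof
    assume "p = 1"
    then show ?thesis using r by simp
  next
    assume "CARD('n) \<ge> 2"
    then obtain a b :: 'n where ab: "a \<noteq> b"
      using card_2_iff' by (metis UNIV_I card_le_Suc0_iff_eq finite_class.finite_UNIV not_less_eq_eq numeral_2_eq_2)
    have rm: "r dvd m" using r p dvd_trans by blast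
    then have r0: "r > 0" using m by (auto intro: Nat.gr0I)
    obtain y where y: "\<And>j. y j ^ r = 1" "\<And>t. t \<in> T \<Longrightarrow> potential (m div r) y t"
      using trivial_mod by (auto simp: trivial_mod_def)
    have "zeta m ^ m = 1" using zeta_power_eq_1_iff[OF m, of m] by simp
    then have "bal a b (zeta m) \<in> Gmpn m p"
      using zeta_nonzero[of m] by (simp add: Gmpn_iff monomial_mat_bal entry_bal color_prod_bal power_mult_distrib power_divide)
    then obtain vs where vs: "bal a b (zeta m) = mprod vs" "set vs \<subseteq> T" using words by blast
    have "potential (m div r) y (mprod vs)"
      using vs(2) mono y(2) by (intro potential_mprod) blast
    then have "potential (m div r) y (bal a b (zeta m))" by (simp only: vs(1))
    then have "entry (bal a b (zeta m)) a ^ (m div r) * y a = y (und_perm (bal a b (zeta m)) a)"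
      unfolding potential_def by blast
    then have "zeta m ^ (m div r) = 1"
      using ab zeta_nonzero[of m] unity_roots_nonzero[OF r0 y(1)] by (simp add: entry_bal und_perm_bal)
    then have "m dvd m div r" using zeta_power_eq_1_iff[OF m] by simp
    moreover have "m div r > 0" using rm m by (auto elim: dvdE)
    ultimately have "m \<le> m div r" by (rule dvd_imp_le)
    then show ?thesis using div_less_dividend[of r m] r0 m by linarith
  qed
qed

text \<open>
  Let \<open>\<Gamma>\<close> be the generated group. It has elements over every permutation, so only the diagonal matrices of
  \<open>G(m,p,n)\<close> are at stake; these are products of balanced matrices and of diagonal reflections. The
  \<open>h\<close> for which \<open>bal a b h \<in> \<Gamma>\<close> form a group \<open>K\<close>, the same for all \<open>a\<close> and \<open>b\<close>. It contains the
  \<open>m/p\<close>-th roots of unity, as \<open>\<Gamma>\<close> contains all diagonal reflections; hence \<open>K\<close> is the group of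
  \<open>m/r\<close>-th roots of unity for some \<open>r\<close> dividing \<open>p\<close>. Modulo \<open>K\<close>, the color of a transposition in \<open>\<Gamma>\<close> depends only on its
  two points, and these colors form a coboundary. So \<open>T\<close> is trivial modulo \<open>r\<close>,
  and \<open>r = 1\<close>: all balanced matrices lie in \<open>\<Gamma>\<close>.
\<close>

lemma fullness_sufficient:
  fixes T :: "(complex ^ 'n ^ 'n) set"
  assumes m: "m > 0" and p: "p dvd m"
    and T: "T \<subseteq> reflections (Gmpn m p)"
    and genS: "generate (mat_group Sym_mats) (skel ` {t \<in> T. und_perm t \<noteq> id}) = Sym_mats"
    and genD: "generate (mat_group (Gmpn m p)) (color_mat ` {t \<in> T. und_perm t = id}) = Gmpn m p"
    and not_trivial_mod: "\<And>r. r dvd p \<Longrightarrow> trivial_mod m r T \<Longrightarrow> r = 1"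
  shows "generate (mat_group (Gmpn m p)) T = Gmpn m p"
proof -
  have p0: "p > 0" using m p by (auto intro: Nat.gr0I)
  have TG: "T \<subseteq> Gmpn m p" using T by (auto simp: reflections_def)
  define \<Gamma> where "\<Gamma> = mprods T"
  have \<Gamma>_mult: "v ** w \<in> \<Gamma>" if "v \<in> \<Gamma>" "w \<in> \<Gamma>" for v w
    using that unfolding \<Gamma>_def by (rule mprods_mult)
  have \<Gamma>_T: "t \<in> \<Gamma>" if "t \<in> T" for t using that unfolding \<Gamma>_def by (rule mprods_incl)
  have \<Gamma>_1: "mat 1 \<in> \<Gamma>" unfolding \<Gamma>_def by (rule mprods_1)
  have \<Gamma>_cinv: "cinv v \<in> \<Gamma>" if "v \<in> \<Gamma>" for v
    using that unfolding \<Gamma>_def by (rule mprods_cinv[OF m TG])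
  have \<Gamma>_conj: "v ** w ** cinv v \<in> \<Gamma>" if "v \<in> \<Gamma>" "w \<in> \<Gamma>" for v w
    using that \<Gamma>_mult \<Gamma>_cinv by blast
  have \<Gamma>_G: "\<Gamma> \<subseteq> Gmpn m p" unfolding \<Gamma>_def by (rule mprods_subset_Gmpn[OF TG])
  have \<Gamma>_mono: "monomial_mat v" if "v \<in> \<Gamma>" for v using that \<Gamma>_G GmpnD(1) by blast
  have \<Gamma>_root: "entry v j ^ m = 1" if "v \<in> \<Gamma>" for v j using that \<Gamma>_G GmpnD(2) by blast
  have mono: "monomial_mat t" if "t \<in> T" for t using that TG GmpnD(1) by blast

  let ?S = "skel ` {t \<in> T. und_perm t \<noteq> id}"
  have S: "?S \<subseteq> Sym_mats"
    using mono by (auto simp: skel_def Gmpn_iff monomial_mat_perm_proj entry_perm_proj color_prod_def)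
  have perm: "\<exists>v\<in>\<Gamma>. und_perm v = u" if u: "bij u" for u
  proof -
    obtain ws where ws: "set ws \<subseteq> ?S" "und_perm (mprod ws) = u"
      using Sym_mats_generated_perm[OF S genS u] by blast
    obtain ts where ts: "ws = map skel ts" "set ts \<subseteq> {t \<in> T. und_perm t \<noteq> id}"
      using map_preimage_list[OF ws(1)] by blast
    have "und_perm (mprod (map skel ts)) = und_perm (mprod ts)"
      using ts(2) mono by (intro und_perm_mprod_skel) blast
    then have "und_perm (mprod ts) = u" using ws(2) ts(1) by simp
    moreover have "mprod ts \<in> \<Gamma>" unfolding \<Gamma>_def using ts(2) by blast
    ultimately show ?thesis by (rule bexI)
  qed
  have move2: "\<exists>v\<in>\<Gamma>. und_perm v a = c \<and> und_perm v b = d" if ab: "a \<noteq> b" "c \<noteq> d" for a b c d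
  proof -
    define b' where "b' = Transposition.transpose a c b"
    have "b' \<noteq> c" using ab(1) unfolding b'_def by (metis transpose_apply_first transpose_involutory)
    let ?u = "Transposition.transpose b' d \<circ> Transposition.transpose a c"
    have "?u a = c" using \<open>b' \<noteq> c\<close> ab(2) by (auto simp: transpose_apply_other)
    moreover have "?u b = d" by (simp add: b'_def)
    moreover obtain v where v: "v \<in> \<Gamma>" "und_perm v = ?u"
      using perm[OF bij_comp[OF bij_transpose bij_transpose]] by blast
    ultimately have "und_perm v a = c \<and> und_perm v b = d" by simp
    then show ?thesis using v(1) by blast
  qed
  have move1: "\<exists>v\<in>\<Gamma>. und_perm v a = c" for a c
  proof -
    obtain v where v: "v \<in> \<Gamma>" "und_perm v = Transposition.transpose a c"
      using perm[OF bij_transpose] by blast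
    then have "und_perm v a = c" by simp
    then show ?thesis using v(1) by (rule bexI)
  qed

  \<comment> \<open>Some transposition lies in \<open>T\<close>; all others arise from it by conjugation, up to the color.\<close>
  have tref_ex: "\<exists>x. x ^ m = 1 \<and> tref a b x \<in> \<Gamma>" if ab: "a \<noteq> b" for a b
  proof -
    have "\<exists>t\<in>T. und_perm t \<noteq> id"
    proof (rule ccontr)
      assume "\<not> ?thesis"
      then have S_empty: "?S = {}" by blast
      obtain ws where ws: "set ws \<subseteq> ?S" "und_perm (mprod ws) = Transposition.transpose a b"
        using Sym_mats_generated_perm[OF S genS bij_transpose] by blast
      then have "ws = []" unfolding S_empty by simp
      then show False using ws(2) transpose_neq_id[OF ab] by (simp add: und_perm_1)
    qed
    then obtain t where t: "t \<in> T" "und_perm t \<noteq> id" by blast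
    then have "t \<in> reflections (Gmpn m p)" using T by blast
    with m obtain c d z where cd: "c \<noteq> d" "z \<noteq> 0" "t = tref c d z"
    proof (cases rule: reflections_Gmpn_cases)
      case (dref a z)
      then show ?thesis using t(2) by (simp add: und_perm_dref)
    qed (rule that)
    obtain v where v: "v \<in> \<Gamma>" "und_perm v c = a" "und_perm v d = b"
      using move2[OF cd(1) ab] by blast
    let ?x = "z * entry v d / entry v c"
    have "v ** t ** cinv v = tref a b ?x"
      using conj_tref[OF \<Gamma>_mono[OF v(1)] cd(1,2)] v cd(3) by simp
    then have x: "tref a b ?x \<in> \<Gamma>" using \<Gamma>_conj[OF v(1) \<Gamma>_T[OF t(1)]] by simp
    have "?x \<noteq> 0" using cd(2) monomial_matD(3)[OF \<Gamma>_mono[OF v(1)]] by simp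
    then have "?x ^ m = 1" using \<Gamma>_root[OF x, of a] by (simp add: entry_tref)
    then show ?thesis using x by blast
  qed

  define K where "K = {h. h ^ m = 1 \<and> (\<forall>a b. bal a b h \<in> \<Gamma>)}"
  have bal_K: "h \<in> K" if h: "h ^ m = 1" and ab: "a \<noteq> b" and mem: "bal a b h \<in> \<Gamma>" for a b h
  proof -
    have nz: "h \<noteq> 0" using unity_roots_nonzero[OF m h] .
    have "bal c d h \<in> \<Gamma>" for c d
    proof (cases "c = d")
      case True
      then show ?thesis using \<Gamma>_1 nz by (simp add: bal_same)
    next
      case False
      then obtain v where v: "v \<in> \<Gamma>" "und_perm v a = c" "und_perm v b = d"
        using move2[OF ab] by blast
      then show ?thesis using \<Gamma>_conj[OF v(1) mem] conj_bal[OF \<Gamma>_mono[OF v(1)] nz, of a b] by simp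
    qed
    then show ?thesis using h by (simp add: K_def)
  qed
  have "\<exists>k. k dvd m \<and> k > 0 \<and> K = unity_roots k"
  proof -
    have sub: "K \<subseteq> unity_roots m" by (auto simp: K_def)
    have "bal a b 1 = (mat 1 :: complex ^ 'n ^ 'n)" for a b
      by (auto simp: bal_def mat_1_eq_cmat intro!: arg_cong2[of _ _ _ _ cmat])
    then have one: "1 \<in> K" using \<Gamma>_1 by (simp add: K_def)
    have mult: "x * z \<in> K" if "x \<in> K" "z \<in> K" for x z
    proof -
      have "bal a b x ** bal a b z = (bal a b (x * z) :: complex ^ 'n ^ 'n)" for a b
        by (auto simp: bal_def cmat_mult intro!: arg_cong2[of _ _ _ _ cmat])
      then have "bal a b (x * z) \<in> \<Gamma>" for a b using that \<Gamma>_mult[of "bal a b x" "bal a b z"] by (simp add: K_def)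
      then show ?thesis using that by (simp add: K_def power_mult_distrib)
    qed
    show ?thesis using unity_roots_closed_subset[OF m sub one mult] by metis
  qed
  then obtain k where k: "k dvd m" "k > 0" "K = unity_roots k" by blast

  \<comment> \<open>Conjugation moves a diagonal reflection to any position, and the colors of those in \<open>T\<close>
    generate all \<open>m/p\<close>-th roots of unity.\<close>
  have dref_mem: "dref a z \<in> \<Gamma>" if z: "z ^ m = 1" "z ^ (m div p) = 1" for a z
  proof -
    let ?D = "color_mat ` {t \<in> T. und_perm t = id}"
    have D: "?D \<subseteq> Gmpn m p" using color_mat_diagonal_in_Gmpn[OF m] T by auto
    have "mat z \<in> mprods ?D"
      using generate_Gmpn_eq_mprods[OF m D] genD Gmpn_dim_1[OF m] z by blast
    then obtain ws where ws: "mat z = mprod ws" "set ws \<subseteq> ?D" by blast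
    obtain ts where ts: "ws = map color_mat ts" "set ts \<subseteq> {t \<in> T. und_perm t = id}"
      using map_preimage_list[OF ws(2)] by blast
    have letter: "dref a (color_prod t) \<in> \<Gamma>" if t: "t \<in> T" "und_perm t = id" for t
    proof -
      obtain b z' where z': "z' \<noteq> 0" "t = dref b z'"
        using diagonal_reflection[OF m _ t(2)] t(1) T by blast
      obtain v where v: "v \<in> \<Gamma>" "und_perm v b = a" using move1 by blast
      have "dref a z' = v ** t ** cinv v"
        using conj_dref[OF \<Gamma>_mono[OF v(1)] z'(1)] v z' by simp
      then show ?thesis using \<Gamma>_conj[OF v(1) \<Gamma>_T[OF t(1)]] z' by (simp add: color_prod_dref)
    qed
    have "\<exists>x. mprod (map color_mat ts) = mat x \<and> dref a x \<in> \<Gamma>"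
      using ts(2)
    proof (induction ts)
      case Nil
      have "dref a 1 = mat 1"
        by (auto simp: dref_def mat_1_eq_cmat intro!: arg_cong2[of _ _ _ _ cmat])
      then show ?case using \<Gamma>_1 by (intro exI[of _ 1]) simp
    next
      case (Cons t ts)
      then obtain x where x: "mprod (map color_mat ts) = mat x" "dref a x \<in> \<Gamma>" by auto
      have "dref a (color_prod t * x) \<in> \<Gamma>"
      proof -
        have "t \<in> T" "und_perm t = id" using Cons.prems by auto
        from \<Gamma>_mult[OF letter[OF this] x(2)] show ?thesis by (simp add: dref_mult_dref)
      qed
      moreover have "mprod (map color_mat (t # ts)) = mat (color_prod t * x)"
        by (simp only: list.map mprod_Cons x(1) color_mat_def[of t] mat_1_mult)
      ultimately show ?case by blast
    qed
    then show ?thesis using ws(1) ts(1) by (auto simp: mat_1_inj)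
  qed
  have "unity_roots (m div p) \<subseteq> unity_roots k"
  proof
    fix z assume "z \<in> unity_roots (m div p)"
    then have z: "z ^ (m div p) = 1" by simp
    have zm: "z ^ m = 1" using z p by (metis dvd_div_mult_self power_mult power_one)
    have "bal a b z \<in> \<Gamma>" for a b
      using \<Gamma>_mult[OF dref_mem[OF zm z, of a] dref_mem[of "1 / z" b]] z zm
      by (simp add: dref_mult_dref_bal power_divide)
    then show "z \<in> unity_roots k" using zm unfolding k(3)[symmetric] by (simp add: K_def)
  qed
  moreover have "m div p > 0" using p m by (auto elim: dvdE)
  ultimately have mpk: "m div p dvd k" by (simp add: unity_roots_subset_iff)
  define r where "r = m div k"
  have kr: "k * r = m" using k by (simp add: r_def)
  have r0: "r > 0" using kr m by (auto intro: Nat.gr0I)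
  have rp: "r dvd p"
  proof -
    obtain s where s: "k = m div p * s" using mpk by blast
    have "(m div p) * p = m" using p by simp
    also have "m = (m div p) * (s * r)" using kr s by simp
    finally have "p = s * r" using \<open>m div p > 0\<close> by simp
    then show ?thesis by simp
  qed
  have mdr: "m div r = k" using kr r0 by (metis nonzero_mult_div_cancel_right neq0_conv)

  \<comment> \<open>Two transpositions of \<open>\<Gamma>\<close> on the same two points differ by a balanced matrix, hence by an element of \<open>K\<close>.
    So the color of the transposition of \<open>i0\<close> and \<open>j\<close>, to the power \<open>k\<close>, is a well-defined \<open>y j\<close>.\<close>
  obtain i0 :: 'n where True by blast
  define X where "X j = (SOME x. x ^ m = 1 \<and> tref i0 j x \<in> \<Gamma>)" for j
  have X: "X j ^ m = 1 \<and> tref i0 j (X j) \<in> \<Gamma>" if "j \<noteq> i0" for j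
    unfolding X_def by (rule someI_ex) (use tref_ex[of i0 j] that in blast)
  have X_unique: "x ^ k = X j ^ k" if j: "j \<noteq> i0" and x: "x ^ m = 1" "tref i0 j x \<in> \<Gamma>" for j x
  proof -
    have nz: "x \<noteq> 0" "X j \<noteq> 0" using unity_roots_nonzero[OF m] x X[OF j] by auto
    have "bal i0 j (X j / x) = tref i0 j x ** tref i0 j (X j)"
      using tref_mult_tref[of i0 j x "X j"] j nz by auto
    then have "bal i0 j (X j / x) \<in> \<Gamma>" using \<Gamma>_mult[OF x(2)] X[OF j] by simp
    then have "X j / x \<in> K" using j x(1) X[OF j] by (intro bal_K[of _ i0 j]) (auto simp: power_divide)
    then have "(X j / x) ^ k = 1" by (simp add: k(3))
    then show ?thesis using nz by (simp add: power_divide)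
  qed
  define y where "y j = (if j = i0 then 1 else X j ^ k)" for j
  have "y j ^ r = 1" for j using X[of j] by (simp add: y_def power_mult[symmetric] kr)
  moreover have "potential (m div r) y t" if t: "t \<in> T" for t
  proof -
    have "t \<in> reflections (Gmpn m p)" using t T by blast
    with m show ?thesis
    proof (cases rule: reflections_Gmpn_cases)
      case (tref a b x)
      have t\<Gamma>: "tref a b x \<in> \<Gamma>" using \<Gamma>_T[OF t] tref by simp
      have main: "x ^ k * y a = y b"
      proof -
        consider "a = i0" | "b = i0" | "a \<noteq> i0" "b \<noteq> i0" by blast
        then show ?thesis
        proof cases
          case 1
          then show ?thesis using X_unique[of b x] tref t\<Gamma> by (simp add: y_def)
        next
          case 2
          then have "tref i0 a (1 / x) \<in> \<Gamma>" using tref_swap[of i0 a x] tref t\<Gamma> by simp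
          then have "(1 / x) ^ k = X a ^ k" using 2 tref by (intro X_unique) (auto simp: power_divide)
          then show ?thesis using 2 tref by (simp add: y_def power_divide field_simps)
        next
          case 3
          have Xa: "X a ^ m = 1" "tref i0 a (X a) \<in> \<Gamma>" "X a \<noteq> 0"
            using X[OF 3(1)] unity_roots_nonzero[OF m] by auto
          \<comment> \<open>Conjugation moves the transposition of \<open>i0\<close> and \<open>a\<close> to that of \<open>i0\<close> and \<open>b\<close>.\<close>
          have "tref a b x ** tref i0 a (X a) ** cinv (tref a b x)
              = tref (und_perm (tref a b x) i0) (und_perm (tref a b x) a)
                  (X a * entry (tref a b x) a / entry (tref a b x) i0)"
            by (rule conj_tref[OF monomial_mat_tref[OF tref(3)]]) (use 3 Xa in auto)
          also have "\<dots> = tref i0 b (X a * x)"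
            using 3 tref by (simp add: und_perm_tref entry_tref transpose_apply_other)
          finally have "tref i0 b (X a * x) \<in> \<Gamma>" using \<Gamma>_conj[OF t\<Gamma> Xa(2)] by simp
          then have "(X a * x) ^ k = X b ^ k"
            using 3 Xa tref by (intro X_unique) (auto simp: power_mult_distrib)
          then show ?thesis using 3 by (simp add: y_def power_mult_distrib mult.commute)
        qed
      qed
      have "entry t j ^ k * y j = y (und_perm t j)" for j
      proof -
        consider "j = a" | "j = b" | "j \<noteq> a" "j \<noteq> b" by blast
        then show ?thesis
        proof cases
          case 1
          then show ?thesis using main tref by (simp add: entry_tref und_perm_tref)
        next
          case 2
          then show ?thesis using main tref by (simp add: entry_tref und_perm_tref power_divide field_simps)
        next
          case 3
          then show ?thesis using tref by (simp add: entry_tref und_perm_tref transpose_apply_other)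
        qed
      qed
      then show ?thesis by (simp add: potential_def mdr)
    next
      case (dref a z)
      have "z ^ k = 1" using dref(4) mpk by (metis dvdE power_mult power_one)
      then show ?thesis using dref by (simp add: potential_def mdr entry_dref und_perm_dref)
    qed
  qed
  ultimately have "trivial_mod m r T" unfolding trivial_mod_def by blast
  then have "r = 1" using not_trivial_mod rp by blast
  then have K: "K = unity_roots m" using k(3) kr by simp

  have "Gmpn m p \<subseteq> \<Gamma>"
  proof
    fix w :: "complex ^ 'n ^ 'n" assume w: "w \<in> Gmpn m p"
    obtain \<gamma> where \<gamma>: "\<gamma> \<in> \<Gamma>" "und_perm \<gamma> = und_perm w"
      using perm[OF monomial_matD(1)[OF GmpnD(1)[OF w]]] by blast
    define v where "v = w ** cinv \<gamma>"
    have v: "v \<in> Gmpn m p" unfolding v_def using w \<gamma> \<Gamma>_G by (intro Gmpn_mult Gmpn_cinv) auto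
    have w_eq: "w = v ** \<gamma>"
      unfolding v_def using cinv_mult[OF \<Gamma>_mono[OF \<gamma>(1)]] by (metis matrix_mul_assoc matrix_mul_rid)
    have uv: "und_perm v = id"
      using und_perm_mult[OF GmpnD(1)[OF w] monomial_mat_cinv[OF \<Gamma>_mono[OF \<gamma>(1)]]]
        und_perm_cinv[OF \<Gamma>_mono[OF \<gamma>(1)]] \<gamma>(2) monomial_matD(1)[OF GmpnD(1)[OF w]]
      by (simp add: v_def bij_is_surj surj_iff[symmetric])
    define z where "z = color_prod v"
    have vnz: "entry v j \<noteq> 0" for j using monomial_matD(3)[OF GmpnD(1)[OF v]] .
    have z: "z ^ (m div p) = 1" "z ^ m = 1"
    proof -
      show "z ^ (m div p) = 1" using GmpnD(3)[OF v] by (simp add: z_def)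
      then show "z ^ m = 1" using p by (metis dvd_div_mult_self power_mult power_one)
    qed
    have znz: "z \<noteq> 0" using unity_roots_nonzero[OF m z(2)] .
    define c where "c j = entry v j * (if j = i0 then 1 / z else 1)" for j
    have "cmat id c \<in> \<Gamma>"
    proof (rule diagonal_mem_of_balanced[OF \<Gamma>_1])
      show "c j \<noteq> 0" for j using vnz znz by (simp add: c_def)
      show "(\<Prod>j\<in>UNIV. c j) = 1"
        using znz by (simp add: c_def prod.distrib z_def[unfolded color_prod_def, symmetric])
      fix a b :: 'n and u assume "u \<in> \<Gamma>" "a \<noteq> b"
      moreover have "c a ^ m = 1" using GmpnD(2)[OF v] z(2) by (simp add: c_def power_mult_distrib power_divide)
      then have "c a \<in> K" by (simp add: K)
      ultimately show "bal a b (c a) ** u \<in> \<Gamma>" by (intro \<Gamma>_mult) (simp_all add: K_def)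
    qed
    then have "dref i0 z ** cmat id c \<in> \<Gamma>" using dref_mem[OF z(2,1)] \<Gamma>_mult by blast
    moreover have "dref i0 z ** cmat id c = cmat id (entry v)"
      using znz by (auto simp: dref_def cmat_mult c_def intro!: arg_cong2[of _ _ _ _ cmat])
    moreover have "cmat id (entry v) = v" using monomial_matD(4)[OF GmpnD(1)[OF v]] uv by simp
    ultimately have "v \<in> \<Gamma>" by simp
    then show "w \<in> \<Gamma>" using w_eq \<gamma>(1) \<Gamma>_mult by simp
  qed
  then show ?thesis using generate_Gmpn_eq_mprods[OF m TG] \<Gamma>_G by (simp add: \<Gamma>_def)
qed

section \<open>Skeletons of full factorizations\<close>

lemma zeta_power_entry_exp:
  fixes w :: "complex ^ 'n ^ 'n"
  assumes m: "m > 0" and w: "w \<in> Gmpn m p"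
  shows "zeta m ^ entry_exp m w j = entry w j"
proof -
  have z: "zeta m ^ b = exp (2 * of_real pi * \<i> * of_nat b / of_nat m)" for b
    unfolding zeta_def by (simp add: exp_of_nat_mult[symmetric] algebra_simps)
  have inj: "b = b'" if "zeta m ^ b = zeta m ^ b'" "b < m" "b' < m" for b b'
    using that complex_root_unity_eq[of m b b'] m by (simp add: z cong_def)
  have "\<exists>b. b < m \<and> zeta m ^ b = entry w j"
  proof -
    have "card ((\<lambda>b. zeta m ^ b) ` {..<m}) = m"
      using inj by (subst card_image) (auto simp: inj_on_def)
    moreover have "(\<lambda>b. zeta m ^ b) ` {..<m} \<subseteq> unity_roots m"
      using zeta_power_eq_1_iff[OF m] by (auto simp: power_mult[symmetric])
    ultimately have "(\<lambda>b. zeta m ^ b) ` {..<m} = unity_roots m"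
      using card_roots_unity_eq[OF m] finite_roots_unity[of m] m by (intro card_subset_eq) auto
    moreover have "entry w j \<in> unity_roots m" using GmpnD(2)[OF w] by simp
    ultimately have "entry w j \<in> (\<lambda>b. zeta m ^ b) ` {..<m}" by (simp only:)
    then show ?thesis by auto
  qed
  then obtain b where b: "b < m" "zeta m ^ b = entry w j" by blast
  have "entry_exp m w j = b"
    unfolding entry_exp_def entry_def[symmetric] using b inj by (intro the_equality) auto
  then show ?thesis using b by simp
qed

lemma zeta_color_on:
  fixes g :: "complex ^ 'n ^ 'n"
  assumes m: "m > 0" and g: "g \<in> Gmpn m p"
  shows "zeta m ^ color_on m g S = (\<Prod>j\<in>S. entry g j)"
proof -
  have period: "zeta m ^ (a mod m) = zeta m ^ a" for a
  proof -
    have "zeta m ^ a = zeta m ^ (m * (a div m) + a mod m)" by simp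
    also have "\<dots> = (zeta m ^ m) ^ (a div m) * zeta m ^ (a mod m)" by (simp only: power_add power_mult)
    also have "zeta m ^ m = 1" using zeta_power_eq_1_iff[OF m] by simp
    finally show ?thesis by simp
  qed
  have "zeta m ^ color_on m g S = (\<Prod>j\<in>S. zeta m ^ entry_exp m g j)"
    by (simp add: color_on_def period power_sum)
  then show ?thesis by (simp add: zeta_power_entry_exp[OF m g])
qed

lemma color_root_iff_dvd:
  fixes g :: "complex ^ 'n ^ 'n"
  assumes m: "m > 0" and g: "g \<in> Gmpn m p" and r: "r dvd m"
  shows "(\<Prod>j\<in>S. entry g j) ^ (m div r) = 1 \<longleftrightarrow> r dvd color_on m g S"
proof -
  have qr: "(m div r) * r = m" and q: "m div r > 0" using r m by (auto elim: dvdE)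
  have "(\<Prod>j\<in>S. entry g j) ^ (m div r) = zeta m ^ (color_on m g S * (m div r))"
    by (simp add: zeta_color_on[OF m g, symmetric] power_mult)
  then have "(\<Prod>j\<in>S. entry g j) ^ (m div r) = 1 \<longleftrightarrow> m dvd color_on m g S * (m div r)"
    using zeta_power_eq_1_iff[OF m] by simp
  also have "\<dots> \<longleftrightarrow> (m div r) * r dvd (m div r) * color_on m g S" by (subst qr) (simp only: mult.commute)
  also have "\<dots> \<longleftrightarrow> r dvd color_on m g S" using q by simp
  finally show ?thesis .
qed

lemma filter_skel:
  fixes ts :: "(complex ^ 'n ^ 'n) list"
  assumes "\<And>t. t \<in> set ts \<Longrightarrow> monomial_mat t"
  shows "moved (map skel ts) = map skel (moved ts)" "diags (map skel ts) = diags ts"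
proof -
  have u: "und_perm (skel t) = und_perm t" if "t \<in> set ts" for t using assms that und_perm_skel by blast
  show "moved (map skel ts) = map skel (moved ts)"
    unfolding filter_map by (intro arg_cong[of _ _ "map skel"] filter_cong) (simp_all add: u)
  have "diags (map skel ts) = map skel (diags ts)"
    unfolding filter_map by (intro arg_cong[of _ _ "map skel"] filter_cong) (simp_all add: u)
  also have "\<dots> = diags ts" by (rule map_idI) (auto simp: skel_def)
  finally show "diags (map skel ts) = diags ts" .
qed

lemma reflections_Sym_mats:
  "reflections (Sym_mats :: (complex ^ 'n ^ 'n) set) = {tref a b 1 | a b. a \<noteq> b}"
  unfolding reflections_Gmpn[OF zero_less_one] by auto

text \<open>
  The skeletons of the full factorizations of \<open>g\<close> are the words in \<open>skeletons N\<close>: their diagonal letters form a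
  word in \<open>diag_words\<close> and their transpositions one in \<open>transp_words\<close>.
\<close>

context
  fixes m p :: nat and g :: "complex ^ 'n ^ 'n"
  assumes m: "m > 0" and p: "p > 0" "p dvd m" and n: "CARD('n) \<ge> 2 \<or> p = 1" and g: "g \<in> Gmpn m p"
begin

abbreviation (input) "W_refl \<equiv> reflections (Gmpn m p) :: (complex ^ 'n ^ 'n) set"
abbreviation (input) "transp_letters \<equiv> reflections Sym_mats :: (complex ^ 'n ^ 'n) set"

definition diag_letters :: "(complex ^ 'n ^ 'n) set" where "diag_letters = {t \<in> W_refl. und_perm t = id}"

definition diag_words :: "nat \<Rightarrow> (complex ^ 'n ^ 'n) list set" where
  "diag_words L = {ds. set ds \<subseteq> diag_letters \<and> map color_mat ds \<in> full_refl_facts (Gmpn m p) (color_mat g) L}"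

definition transp_words :: "nat \<Rightarrow> (complex ^ 'n ^ 'n) list set" where
  "transp_words M = full_refl_facts Sym_mats (perm_proj g) M"

definition skeletons :: "nat \<Rightarrow> (complex ^ 'n ^ 'n) list set" where
  "skeletons N = {ws. length ws = N \<and> set ws \<subseteq> diag_letters \<union> transp_letters \<and> diags ws \<in> diag_words (length (diags ws)) \<and> moved ws \<in> transp_words (length (moved ws))}"

lemma transp_letters_neq_id: "w \<in> transp_letters \<Longrightarrow> und_perm w \<noteq> id" and transp_letters_refl: "w \<in> transp_letters \<Longrightarrow> w \<in> W_refl" and transp_letters_skel: "w \<in> transp_letters \<Longrightarrow> skel w = w"
proof -
  assume "w \<in> transp_letters"
  then obtain a b where ab: "w = tref a b 1" "a \<noteq> b" unfolding reflections_Sym_mats by blast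
  show "und_perm w \<noteq> id" using ab transpose_neq_id[of a b] by (simp add: und_perm_tref)
  show "skel w = w" using ab by (simp add: skel_tref)
  have "(1 :: complex) ^ m = 1" by simp
  then show "w \<in> W_refl" using ab unfolding reflections_Gmpn[OF m] by blast
qed

lemma diag_letters_refl: "w \<in> diag_letters \<Longrightarrow> w \<in> W_refl" and diag_letters_id: "w \<in> diag_letters \<Longrightarrow> und_perm w = id"
  by (auto simp: diag_letters_def)

lemma diag_letters_skel: "w \<in> diag_letters \<Longrightarrow> skel w = w"
  by (simp add: skel_def diag_letters_id)

lemma skel_in_letters: "t \<in> W_refl \<Longrightarrow> skel t \<in> diag_letters \<union> transp_letters"
proof -
  assume t: "t \<in> W_refl"
  show ?thesis
  proof (cases "und_perm t = id")
    case True
    then show ?thesis using t by (simp add: diag_letters_def skel_def)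
  next
    case False
    from m t show ?thesis
    proof (cases rule: reflections_Gmpn_cases)
      case (tref a b x)
      then have "skel t = tref a b 1" by (simp add: skel_tref)
      then show ?thesis using tref unfolding reflections_Sym_mats by auto
    next
      case (dref a z)
      then show ?thesis using False by (simp add: und_perm_dref)
    qed
  qed
qed

lemma filter_letters:
  assumes "set ws \<subseteq> diag_letters \<union> transp_letters"
  shows "filter (\<lambda>w. w \<in> diag_letters) ws = diags ws" "filter (\<lambda>w. w \<in> transp_letters) ws = moved ws"
proof -
  have "w \<in> diag_letters \<longleftrightarrow> und_perm w = id" "w \<in> transp_letters \<longleftrightarrow> und_perm w \<noteq> id" if "w \<in> set ws" for w
    using assms that diag_letters_id transp_letters_neq_id by blast+
  then show "filter (\<lambda>w. w \<in> diag_letters) ws = diags ws" "filter (\<lambda>w. w \<in> transp_letters) ws = moved ws"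
    by (auto intro!: filter_cong)
qed

lemma length_diags_moved: "length (diags ws) + length (moved ws) = length ws"
  by (rule sum_length_filter_compl)

lemma W_refl_monomial: "t \<in> W_refl \<Longrightarrow> monomial_mat t"
  by (rule monomial_reflection)

lemma full_skeleton:
  assumes ts: "ts \<in> full_refl_facts (Gmpn m p) g N"
  shows "map skel ts \<in> skeletons N"
proof -
  have t: "length ts = N" "set ts \<subseteq> W_refl" "mprod ts = g" "generate (mat_group (Gmpn m p)) (set ts) = Gmpn m p"
    using ts by (auto simp: full_refl_facts_def)
  have mono: "monomial_mat t" if "t \<in> set ts" for t using that t(2) W_refl_monomial by blast
  note nec = fullness_necessary[OF m p n t(2,4)]
  have filt: "moved (map skel ts) = map skel (moved ts)" "diags (map skel ts) = diags ts"
    by (rule filter_skel, rule mono, assumption)+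
  have sub: "set (map skel ts) \<subseteq> diag_letters \<union> transp_letters" using t(2) skel_in_letters by auto
  have dsub: "set (diags ts) \<subseteq> diag_letters" using t(2) by (auto simp: diag_letters_def)
  have "map color_mat (diags ts) \<in> full_refl_facts (Gmpn m p) (color_mat g) (length (diags ts))"
    unfolding full_refl_facts_def
  proof (intro CollectI conjI)
    show "length (map color_mat (diags ts)) = length (diags ts)" by simp
    show "set (map color_mat (diags ts)) \<subseteq> reflections (Gmpn m p)"
    proof
      fix w assume "w \<in> set (map color_mat (diags ts))"
      then obtain t where "t \<in> diag_letters" "w = color_mat t" using dsub by auto
      then obtain a z where "z \<noteq> 1" "z \<noteq> 0" "z ^ m = 1" "z ^ (m div p) = 1" "w = color_mat (dref a z :: complex ^ 'n ^ 'n)"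
        using diagonal_reflection[OF m diag_letters_refl diag_letters_id] by metis
      then show "w \<in> reflections (Gmpn m p)"
        unfolding reflections_dim_1[OF m] by (auto simp: color_mat_def color_prod_dref)
    qed
    show "mprod (map color_mat (diags ts)) = color_mat g"
      using color_mat_mprod[OF m t(2)] t(3) by (simp only:)
    have "set (map color_mat (diags ts)) = color_mat ` {t \<in> set ts. und_perm t = id}" by auto
    then show "generate (mat_group (Gmpn m p)) (set (map color_mat (diags ts))) = Gmpn m p"
      using nec(2) by (simp only:)
  qed
  then have X: "diags ts \<in> diag_words (length (diags ts))" using dsub by (simp add: diag_words_def)
  have "map skel (moved ts) \<in> full_refl_facts Sym_mats (perm_proj g) (length (map skel (moved ts)))"
    unfolding full_refl_facts_def
  proof (intro CollectI conjI)
    show "set (map skel (moved ts)) \<subseteq> reflections Sym_mats"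
    proof
      fix w assume "w \<in> set (map skel (moved ts))"
      then obtain t where tt: "t \<in> set ts" "und_perm t \<noteq> id" "w = skel t" by auto
      then have "und_perm w \<noteq> id" using und_perm_skel[OF mono] by simp
      then show "w \<in> reflections Sym_mats" using skel_in_letters[of t] diag_letters_id tt t(2) by blast
    qed
    show "mprod (map skel (moved ts)) = perm_proj g"
      using perm_proj_mprod[of ts, OF mono] t(3) by (simp only:)
    have "set (map skel (moved ts)) = skel ` {t \<in> set ts. und_perm t \<noteq> id}" by auto
    then show "generate (mat_group Sym_mats) (set (map skel (moved ts))) = Sym_mats"
      using nec(1) by (simp only:)
  qed simp
  then have Y: "map skel (moved ts) \<in> transp_words (length (map skel (moved ts)))" by (simp add: transp_words_def)
  show ?thesis
    unfolding skeletons_def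
  proof (intro CollectI conjI)
    show "length (map skel ts) = N" using t(1) by simp
    show "diags (map skel ts) \<in> diag_words (length (diags (map skel ts)))" unfolding filt by (rule X)
    show "moved (map skel ts) \<in> transp_words (length (moved (map skel ts)))" unfolding filt by (rule Y)
  qed (rule sub)
qed

lemma full_iff_not_trivial_mod:
  assumes ws: "ws \<in> skeletons N" and ts: "set ts \<subseteq> W_refl" "map skel ts = ws" "mprod ts = g"
  shows "ts \<in> full_refl_facts (Gmpn m p) g N \<longleftrightarrow> (\<forall>r. r dvd p \<longrightarrow> trivial_mod m r (set ts) \<longrightarrow> r = 1)"
proof
  assume "ts \<in> full_refl_facts (Gmpn m p) g N"
  then have "generate (mat_group (Gmpn m p)) (set ts) = Gmpn m p" by (simp add: full_refl_facts_def)
  then show "\<forall>r. r dvd p \<longrightarrow> trivial_mod m r (set ts) \<longrightarrow> r = 1"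
    using fullness_necessary(3)[OF m p n ts(1)] by blast
next
  assume not_trivial_mod: "\<forall>r. r dvd p \<longrightarrow> trivial_mod m r (set ts) \<longrightarrow> r = 1"
  have mono: "monomial_mat t" if "t \<in> set ts" for t using that ts(1) W_refl_monomial by blast
  have "moved (map skel ts) = map skel (moved ts)" "diags (map skel ts) = diags ts"
    by (rule filter_skel, rule mono, assumption)+
  then have filt: "moved ws = map skel (moved ts)" "diags ws = diags ts" by (simp_all only: ts(2))
  have wX: "diags ws \<in> diag_words (length (diags ws))" and wY: "moved ws \<in> transp_words (length (moved ws))"
    using ws by (simp_all add: skeletons_def)
  have "set (moved ws) = skel ` {t \<in> set ts. und_perm t \<noteq> id}" unfolding filt by auto
  moreover have "generate (mat_group Sym_mats) (set (moved ws)) = Sym_mats"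
    using wY unfolding transp_words_def full_refl_facts_def by blast
  ultimately have genS: "generate (mat_group Sym_mats) (skel ` {t \<in> set ts. und_perm t \<noteq> id}) = Sym_mats"
    by (simp only:)
  have "set (map color_mat (diags ws)) = color_mat ` {t \<in> set ts. und_perm t = id}" unfolding filt by auto
  moreover have "generate (mat_group (Gmpn m p)) (set (map color_mat (diags ws))) = Gmpn m p"
    using wX unfolding diag_words_def full_refl_facts_def by blast
  ultimately have genD: "generate (mat_group (Gmpn m p)) (color_mat ` {t \<in> set ts. und_perm t = id}) = Gmpn m p"
    by (simp only:)
  have "generate (mat_group (Gmpn m p)) (set ts) = Gmpn m p"
    using not_trivial_mod by (intro fullness_sufficient[OF m p(2) ts(1) genS genD]) blast
  moreover have "length ts = N" using ws ts(2) by (auto simp: skeletons_def)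
  ultimately show "ts \<in> full_refl_facts (Gmpn m p) g N"
    using ts by (simp add: full_refl_facts_def)
qed

lemma skeleton_projections:
  assumes ws: "ws \<in> skeletons N"
  shows "set ws \<subseteq> W_refl" "map skel ws = ws" "und_perm g = und_perm (mprod ws)" "color_prod g = color_prod (mprod ws)"
    "generate (mat_group Sym_mats) (set (moved ws)) = Sym_mats"
proof -
  have sub: "set ws \<subseteq> diag_letters \<union> transp_letters" and wX: "diags ws \<in> diag_words (length (diags ws))"
    and wY: "moved ws \<in> transp_words (length (moved ws))"
    using ws by (simp_all add: skeletons_def)
  show W_refl: "set ws \<subseteq> W_refl" using sub diag_letters_refl transp_letters_refl by blast
  show skel: "map skel ws = ws" using sub diag_letters_skel transp_letters_skel by (intro map_idI) blast
  have mono: "monomial_mat w" if "w \<in> set ws" for w using that W_refl W_refl_monomial by blast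
  have "moved ws = map skel (moved ws)" using filter_skel(1)[of ws, OF mono] skel by simp
  then have "perm_proj (mprod ws) = mprod (moved ws)" using perm_proj_mprod[of ws, OF mono] by (simp only:)
  also have "\<dots> = perm_proj g" using wY unfolding transp_words_def full_refl_facts_def by blast
  finally have "und_perm (perm_proj (mprod ws)) = und_perm (perm_proj g)" by simp
  then show "und_perm g = und_perm (mprod ws)"
    by (simp only: und_perm_perm_proj[OF GmpnD(1)[OF g]] und_perm_perm_proj[OF monomial_mat_mprod[of ws, OF mono]])
  have "color_mat (mprod ws) = mprod (map color_mat (diags ws))" by (rule color_mat_mprod[OF m W_refl])
  also have "\<dots> = color_mat g" using wX unfolding diag_words_def full_refl_facts_def by blast
  finally show "color_prod g = color_prod (mprod ws)" by (simp add: color_mat_def mat_1_inj)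
  show "generate (mat_group Sym_mats) (set (moved ws)) = Sym_mats"
    using wY unfolding transp_words_def full_refl_facts_def by blast
qed

text \<open>
  Over a skeleton, the full factorizations are the colorings with product \<open>g\<close> that are not trivial modulo any
  \<open>r > 1\<close> dividing \<open>p\<close>. Moebius inversion reduces this to the colorings that are trivial modulo \<open>r\<close>, of which
  \<open>card_trivial_mod_colorings\<close> gives the number.
\<close>

lemma card_full_over_skeleton:
  fixes d k :: nat
  assumes ws: "ws \<in> skeletons N"
    and k: "k = card (cycle_supports g)"
    and d: "d = Gcd (insert p (color_on m g ` cycle_supports g))"
  shows "of_nat (card {ts \<in> full_refl_facts (Gmpn m p) g N. map skel ts = ws})
    = (\<Sum>r | r dvd d. moebius_mu r * of_nat r ^ (CARD('n) + k - 2) * (of_nat m / of_nat r) ^ length (moved ws))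
      / of_nat m ^ (CARD('n) - 1)"
proof -
  note proj = skeleton_projections[OF ws]
  let ?L = "{ts. set ts \<subseteq> W_refl \<and> map skel ts = ws \<and> mprod ts = g}"
  let ?ok = "\<lambda>ts. \<forall>r. r dvd p \<longrightarrow> trivial_mod m r (set ts) \<longrightarrow> r = 1"
  let ?M = "length (moved ws)"
  let ?n1 = "CARD('n) - 1"
  let ?term = "\<lambda>r. moebius_mu r * of_nat r ^ (CARD('n) + k - 2) * (of_nat m / of_nat r) ^ ?M / of_nat m ^ ?n1"
  have finL: "finite ?L"
    by (rule finite_subset[OF _ finite_lists_map_eq[OF finite_reflections[OF m, of p], of skel ws]]) auto
  have k1: "k \<ge> 1"
  proof -
    have "cycle_supports g \<noteq> {}" by (simp add: cycle_supports_def)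
    then show ?thesis by (simp add: k Suc_le_eq card_gt_0_iff)
  qed
  have "{ts \<in> full_refl_facts (Gmpn m p) g N. map skel ts = ws}
      = {ts \<in> ?L. ?ok ts}"
  proof (intro equalityI subsetI)
    fix ts assume ts: "ts \<in> {ts \<in> full_refl_facts (Gmpn m p) g N. map skel ts = ws}"
    then have "set ts \<subseteq> W_refl" "map skel ts = ws" "mprod ts = g" by (auto simp: full_refl_facts_def)
    then show "ts \<in> {ts \<in> ?L. ?ok ts}"
      using full_iff_not_trivial_mod[OF ws] ts by blast
  next
    fix ts assume "ts \<in> {ts \<in> ?L. ?ok ts}"
    then show "ts \<in> {ts \<in> full_refl_facts (Gmpn m p) g N. map skel ts = ws}"
      using full_iff_not_trivial_mod[OF ws] by blast
  qed
  then have "rat_of_nat (card {ts \<in> full_refl_facts (Gmpn m p) g N. map skel ts = ws})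
      = of_nat (card {ts \<in> ?L. ?ok ts})" by (simp only:)
  also have "\<dots> = (\<Sum>ts\<in>{ts \<in> ?L. ?ok ts}. 1)" by simp
  also have "\<dots> = (\<Sum>ts\<in>?L. if ?ok ts then 1 else 0)"
    by (rule sum.inter_filter[OF finL])
  also have "\<dots> = (\<Sum>ts\<in>?L. \<Sum>r | r dvd p \<and> trivial_mod m r (set ts). moebius_mu r)"
  proof (rule sum.cong[OF refl])
    fix ts assume ts: "ts \<in> ?L"
    have T: "set ts \<subseteq> Gmpn m 1"
      using ts by (auto simp: reflections_def Gmpn_iff color_prod_def prod_power_distrib intro!: prod.neutral)
    have "transitive_on_indices (set ts)"
    proof (rule transitive_of_skeleton)
      show "monomial_mat t" if "t \<in> set ts" for t using that ts W_refl_monomial by blast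
      show "generate (mat_group Sym_mats) (set (moved (map skel ts))) = Sym_mats" using ts proj(5) by blast
    qed
    then show "(if ?ok ts then 1 else 0)
        = (\<Sum>r | r dvd p \<and> trivial_mod m r (set ts). moebius_mu r)"
      by (rule sum_moebius_trivial_mod[OF m p(2) T, symmetric])
  qed
  also have "\<dots> = (\<Sum>ts\<in>?L. \<Sum>r\<in>{r \<in> {r. r dvd p}. trivial_mod m r (set ts)}. moebius_mu r)" by simp
  also have "\<dots> = (\<Sum>r | r dvd p. \<Sum>ts\<in>{ts \<in> ?L. trivial_mod m r (set ts)}. moebius_mu r)"
    using finL p(1) by (intro sum.swap_restrict) simp_all
  also have "\<dots> = (\<Sum>r | r dvd p. if r dvd d then ?term r else 0)"
  proof (rule sum.cong[OF refl])
    fix r assume "r \<in> {r. r dvd p}"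
    then have rp: "r dvd p" by simp
    then have rm: "r dvd m" using p dvd_trans by blast
    have r0: "r > 0" using rm m by (auto intro: Nat.gr0I)
    define q where "q = m div r"
    have qr: "q * r = m" using rm by (simp add: q_def)
    have q0: "q > 0" using qr m by (auto intro: Nat.gr0I)
    let ?c = "card {ts \<in> ?L. trivial_mod m r (set ts)}"
    have eq: "{ts \<in> ?L. trivial_mod m r (set ts)} = {ts. set ts \<subseteq> W_refl \<and> map skel ts = ws \<and> mprod ts = g \<and> trivial_mod m r (set ts)}"
      by auto
    have skR: "set ws \<subseteq> skel ` W_refl"
    proof -
      have "set ws = skel ` set ws" using arg_cong[OF proj(2), of set] by simp
      then show ?thesis using proj(1) by blast
    qed
    have cond: "(\<forall>S\<in>cycle_supports g. (\<Prod>j\<in>S. entry g j) ^ q = 1) \<longleftrightarrow> r dvd d"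
      using color_root_iff_dvd[OF m g rm] rp by (auto simp: d q_def dvd_Gcd_iff)
    have "?c * r * q ^ ?n1 = (if r dvd d then r ^ k * q ^ ?M else 0)"
      unfolding eq k cond[symmetric] unfolding q_def
      by (rule card_trivial_mod_colorings[OF m p(2) rp g skR proj(5,3,4)])
    then have "rat_of_nat (?c * r * q ^ ?n1) = of_nat (if r dvd d then r ^ k * q ^ ?M else 0)" by (simp only:)
    then have c: "rat_of_nat ?c * of_nat r * of_nat q ^ ?n1 = (if r dvd d then of_nat r ^ k * of_nat q ^ ?M else 0)"
      by (simp only: of_nat_mult of_nat_power if_distrib[of rat_of_nat] of_nat_0)
    have mq: "rat_of_nat m = of_nat q * of_nat r" using qr by (metis of_nat_mult)
    have nz: "rat_of_nat r \<noteq> 0" "rat_of_nat q \<noteq> 0" using r0 q0 by simp_all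
    have "rat_of_nat ?c = (if r dvd d then of_nat r ^ (CARD('n) + k - 2) * (of_nat m / of_nat r) ^ ?M / of_nat m ^ ?n1 else 0)"
    proof (cases "r dvd d")
      case True
      have m1: "rat_of_nat m ^ ?n1 = of_nat q ^ ?n1 * of_nat r ^ ?n1"
        by (simp only: mq power_mult_distrib)
      have "k + ?n1 = Suc (CARD('n) + k - 2)" using k1 zero_less_card_finite[where ?'a = 'n] by linarith
      then have r1: "rat_of_nat r ^ k * of_nat r ^ ?n1 = of_nat r ^ (CARD('n) + k - 2) * of_nat r"
        by (simp only: power_add[symmetric] power_Suc2)
      have "rat_of_nat ?c * (of_nat m ^ ?n1) * of_nat r
          = (rat_of_nat ?c * of_nat r * of_nat q ^ ?n1) * of_nat r ^ ?n1"
        by (simp only: m1 mult_ac)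
      also have "\<dots> = (of_nat r ^ k * of_nat r ^ ?n1) * of_nat q ^ ?M"
        using c True by (simp only: if_True mult_ac)
      also have "\<dots> = of_nat r ^ (CARD('n) + k - 2) * of_nat q ^ ?M * of_nat r"
        by (simp only: r1 mult_ac)
      finally have "rat_of_nat ?c * (of_nat m ^ ?n1) * of_nat r
          = of_nat r ^ (CARD('n) + k - 2) * of_nat q ^ ?M * of_nat r" .
      then have "rat_of_nat ?c * (of_nat m ^ ?n1) = of_nat r ^ (CARD('n) + k - 2) * of_nat q ^ ?M"
        using nz by simp
      then show ?thesis using True nz by (simp add: field_simps mq)
    next
      case False
      then show ?thesis using c nz by simp
    qed
    then show "(\<Sum>ts\<in>{ts \<in> ?L. trivial_mod m r (set ts)}. moebius_mu r)
        = (if r dvd d then ?term r else 0)"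
      by (simp add: mult.commute)
  qed
  also have "\<dots> = (\<Sum>r\<in>{r \<in> {r. r dvd p}. r dvd d}. ?term r)"
    using p(1) by (intro sum.inter_filter[symmetric]) simp
  also have "{r \<in> {r. r dvd p}. r dvd d} = {r. r dvd d}"
    by (auto simp: d dvd_Gcd_iff)
  finally show ?thesis by (simp only: sum_divide_distrib)
qed

lemma finite_diag_letters: "finite diag_letters"
  by (rule finite_subset[OF _ finite_reflections[OF m, of p]]) (auto simp: diag_letters_def)

lemma finite_full_refl_facts:
  "m' > 0 \<Longrightarrow> finite (full_refl_facts (Gmpn m' p') (h :: complex ^ 'l ^ 'l) N)"
  by (rule finite_subset[OF _ finite_lists_length_eq[OF finite_reflections[of m' p'], of N]])
     (auto simp: full_refl_facts_def)

text \<open>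
  A diagonal reflection is given by its color, a reflection of \<open>G(m,p,1)\<close>, and one of \<open>n\<close> positions.
\<close>

lemma card_diag_words: "card (diag_words L) = CARD('n) ^ L * card (full_refl_facts (Gmpn m p) (color_mat g) L)"
  and finite_diag_words: "finite (diag_words L)"
proof -
  let ?F = "full_refl_facts (Gmpn m p) (color_mat g) L"
  have finF: "finite ?F" by (rule finite_full_refl_facts[OF m])
  have fibre: "card {x \<in> diag_letters. color_mat x = w} = CARD('n)" if w: "w \<in> reflections (Gmpn m p)" for w
  proof -
    obtain z where z: "w = mat z" "z \<noteq> 1" "z ^ m = 1" "z ^ (m div p) = 1"
      using w unfolding reflections_dim_1[OF m] by blast
    have nz: "z \<noteq> 0" using unity_roots_nonzero[OF m z(3)] .
    have "{x \<in> diag_letters. color_mat x = w} = (\<lambda>a. dref a z) ` UNIV"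
    proof (intro equalityI subsetI)
      fix x assume x: "x \<in> {x \<in> diag_letters. color_mat x = w}"
      then obtain a z' where "z' \<noteq> 0" "x = dref a z'" using diagonal_reflection[OF m diag_letters_refl diag_letters_id] by blast
      then show "x \<in> (\<lambda>a. dref a z) ` UNIV" using x z(1) by (auto simp: color_mat_def color_prod_dref mat_1_inj)
    next
      fix x :: "complex ^ 'n ^ 'n" assume "x \<in> (\<lambda>a. dref a z) ` UNIV"
      then obtain a where a: "x = dref a z" by blast
      have "x \<in> W_refl" using a z unfolding reflections_Gmpn[OF m] by blast
      then show "x \<in> {x \<in> diag_letters. color_mat x = w}"
        using a z nz by (simp add: diag_letters_def und_perm_dref color_mat_def color_prod_dref)
    qed
    moreover have "inj (\<lambda>a :: 'n. dref a z)"
    proof (rule injI)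
      fix a b :: 'n assume "dref a z = dref b z"
      then have "entry (dref a z) a = entry (dref b z) a" by simp
      then show "a = b" using nz z(2) by (simp add: entry_dref split: if_splits)
    qed
    ultimately show ?thesis by (simp add: card_image)
  qed
  have diag_words_eq: "diag_words L = (\<Union>ys\<in>?F. {ds. set ds \<subseteq> diag_letters \<and> map color_mat ds = ys})"
    by (auto simp: diag_words_def)
  have fin: "finite {ds. set ds \<subseteq> diag_letters \<and> map color_mat ds = ys}" for ys
    by (rule finite_lists_map_eq[OF finite_diag_letters])
  show "finite (diag_words L)" unfolding diag_words_eq using finF fin by blast
  have "card (diag_words L) = (\<Sum>ys\<in>?F. card {ds. set ds \<subseteq> diag_letters \<and> map color_mat ds = ys})"
    unfolding diag_words_eq by (rule card_UN_disjoint[OF finF]) (use fin in auto)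
  also have "\<dots> = (\<Sum>ys\<in>?F. CARD('n) ^ L)"
  proof (rule sum.cong[OF refl])
    fix ys assume ys: "ys \<in> ?F"
    have "(\<Prod>w\<leftarrow>ys. card {x \<in> diag_letters. color_mat x = w}) = CARD('n) ^ length ys"
      if "set ys \<subseteq> reflections (Gmpn m p)" for ys
      using that by (induction ys) (simp_all add: fibre)
    then show "card {ds. set ds \<subseteq> diag_letters \<and> map color_mat ds = ys} = CARD('n) ^ L"
      using ys card_lists_map_eq[OF finite_diag_letters, of color_mat ys] by (simp add: full_refl_facts_def)
  qed
  finally show "card (diag_words L) = CARD('n) ^ L * card ?F" by simp
qed

lemma card_skeletons_split:
  assumes "L \<le> N"
  shows "card {ws \<in> skeletons N. length (diags ws) = L} = (N choose L) * card (diag_words L) * card (transp_words (N - L))"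
proof -
  let ?W = "{ws. set ws \<subseteq> diag_letters \<union> transp_letters \<and> filter (\<lambda>w. w \<in> diag_letters) ws \<in> diag_words L \<and> filter (\<lambda>w. w \<in> transp_letters) ws \<in> transp_words (N - L)}"
  have disj: "diag_letters \<inter> transp_letters = {}" using diag_letters_id transp_letters_neq_id by blast
  have "{ws \<in> skeletons N. length (diags ws) = L}
      = ?W"
  proof (intro equalityI subsetI)
    fix ws assume ws: "ws \<in> {ws \<in> skeletons N. length (diags ws) = L}"
    then have sub: "set ws \<subseteq> diag_letters \<union> transp_letters" and "diags ws \<in> diag_words L" "moved ws \<in> transp_words (length (moved ws))" "length ws = N"
      by (auto simp: skeletons_def)
    moreover have "length (moved ws) = N - L"
      using length_diags_moved[of ws] ws by (simp add: skeletons_def)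
    ultimately show "ws \<in> ?W"
      using filter_letters[OF sub] by simp
  next
    fix ws assume "ws \<in> ?W"
    then have sub: "set ws \<subseteq> diag_letters \<union> transp_letters" and "filter (\<lambda>w. w \<in> diag_letters) ws \<in> diag_words L" "filter (\<lambda>w. w \<in> transp_letters) ws \<in> transp_words (N - L)"
      by auto
    then have f: "diags ws \<in> diag_words L" "moved ws \<in> transp_words (N - L)" using filter_letters[OF sub] by (simp_all only:)
    then have l: "length (diags ws) = L" "length (moved ws) = N - L"
      by (auto simp: diag_words_def transp_words_def full_refl_facts_def)
    then have "length ws = N" using length_diags_moved[of ws] assms by simp
    then show "ws \<in> {ws \<in> skeletons N. length (diags ws) = L}" unfolding skeletons_def using sub f l by auto
  qed
  also have "card \<dots> = ((L + (N - L)) choose L) * card (diag_words L) * card (transp_words (N - L))"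
  proof (rule card_shuffled_lists[OF disj finite_diag_words])
    show "finite (transp_words (N - L))" unfolding transp_words_def by (rule finite_full_refl_facts) simp
  qed (auto simp: diag_words_def transp_words_def full_refl_facts_def)
  finally show ?thesis using assms by simp
qed

lemma card_full_refl_facts:
  fixes d k :: nat
  assumes k: "k = card (cycle_supports g)"
    and d: "d = Gcd (insert p (color_on m g ` cycle_supports g))"
  shows "rat_of_nat (card (full_refl_facts (Gmpn m p) g N))
    = (\<Sum>L\<le>N. of_nat (N choose L) * (of_nat CARD('n) ^ L * of_nat (card (full_refl_facts (Gmpn m p) (color_mat g) L)))
        * of_nat (card (full_refl_facts Sym_mats (perm_proj g) (N - L)))
        * ((\<Sum>r | r dvd d. moebius_mu r * of_nat r ^ (CARD('n) + k - 2) * (of_nat m / of_nat r) ^ (N - L))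
          / of_nat m ^ (CARD('n) - 1)))"
proof -
  let ?F = "full_refl_facts (Gmpn m p) g N"
  define \<kappa> where "\<kappa> M = (\<Sum>r | r dvd d. moebius_mu r * of_nat r ^ (CARD('n) + k - 2) * (of_nat m / of_nat r) ^ M)
      / of_nat m ^ (CARD('n) - 1)" for M
  have finF: "finite ?F" by (rule finite_full_refl_facts[OF m])
  have fin_skeletons: "finite (skeletons N)"
  proof (rule finite_subset)
    show "skeletons N \<subseteq> {ws. set ws \<subseteq> diag_letters \<union> transp_letters \<and> length ws = N}" by (auto simp: skeletons_def)
    show "finite {ws. set ws \<subseteq> diag_letters \<union> transp_letters \<and> length ws = N}"
      using finite_diag_letters finite_reflections[of 1 1] by (intro finite_lists_length_eq finite_UnI) simp_all
  qed
  have "card ?F = (\<Sum>ws\<in>skeletons N. card {ts \<in> ?F. map skel ts = ws})"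
    using sum.group[OF finF fin_skeletons, of "map skel" "\<lambda>_. 1 :: nat"] full_skeleton by (simp add: image_subset_iff)
  then have "rat_of_nat (card ?F) = (\<Sum>ws\<in>skeletons N. of_nat (card {ts \<in> ?F. map skel ts = ws}))" by simp
  also have "\<dots> = (\<Sum>ws\<in>skeletons N. \<kappa> (length (moved ws)))"
    unfolding \<kappa>_def by (rule sum.cong[OF refl card_full_over_skeleton[OF _ k d]])
  also have "\<dots> = (\<Sum>L\<le>N. \<Sum>ws\<in>{ws \<in> skeletons N. length (diags ws) = L}. \<kappa> (length (moved ws)))"
  proof (rule sum.group[symmetric, OF fin_skeletons])
    show "(\<lambda>ws. length (diags ws)) ` skeletons N \<subseteq> {..N}"
    proof (rule image_subsetI)
      fix ws assume "ws \<in> skeletons N"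
      then have "length ws = N" by (simp add: skeletons_def)
      then show "length (diags ws) \<in> {..N}" using length_diags_moved[of ws] by simp
    qed
  qed simp
  also have "\<dots> = (\<Sum>L\<le>N. of_nat (card {ws \<in> skeletons N. length (diags ws) = L}) * \<kappa> (N - L))"
  proof (rule sum.cong[OF refl])
    fix L
    have "(\<Sum>ws\<in>{ws \<in> skeletons N. length (diags ws) = L}. \<kappa> (length (moved ws)))
        = (\<Sum>ws\<in>{ws \<in> skeletons N. length (diags ws) = L}. \<kappa> (N - L))"
    proof (rule sum.cong[OF refl])
      fix ws assume "ws \<in> {ws \<in> skeletons N. length (diags ws) = L}"
      then have "length (moved ws) = N - L" using length_diags_moved[of ws] by (simp add: skeletons_def)
      then show "\<kappa> (length (moved ws)) = \<kappa> (N - L)" by (simp only:)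
    qed
    then show "(\<Sum>ws\<in>{ws \<in> skeletons N. length (diags ws) = L}. \<kappa> (length (moved ws)))
        = of_nat (card {ws \<in> skeletons N. length (diags ws) = L}) * \<kappa> (N - L)" by (simp only: sum_constant)
  qed
  also have "\<dots> = (\<Sum>L\<le>N. of_nat (N choose L) * (of_nat CARD('n) ^ L * of_nat (card (full_refl_facts (Gmpn m p) (color_mat g) L)))
        * of_nat (card (full_refl_facts Sym_mats (perm_proj g) (N - L))) * \<kappa> (N - L))"
  proof (rule sum.cong[OF refl])
    fix L assume "L \<in> {..N}"
    then have "card {ws \<in> skeletons N. length (diags ws) = L} = (N choose L) * card (diag_words L) * card (transp_words (N - L))"
      by (intro card_skeletons_split) simp
    then show "of_nat (card {ws \<in> skeletons N. length (diags ws) = L}) * \<kappa> (N - L)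
      = of_nat (N choose L) * (of_nat CARD('n) ^ L * of_nat (card (full_refl_facts (Gmpn m p) (color_mat g) L)))
        * of_nat (card (full_refl_facts Sym_mats (perm_proj g) (N - L))) * \<kappa> (N - L)"
      by (simp only: card_diag_words transp_words_def of_nat_mult of_nat_power)
  qed
  finally show ?thesis unfolding \<kappa>_def .
qed

end

theorem theorem4p1:
  fixes m p k d :: nat and g :: "complex ^ 'n ^ 'n"
  assumes "m > 0" and "p > 0" and "p dvd m"
    and "CARD('n) \<ge> 2 \<or> p = 1"
    and "g \<in> Gmpn m p"
    and "k = card (cycle_supports g)"
    and "d = Gcd (insert p (color_on m g ` cycle_supports g))"
  shows "F_full (Gmpn m p) g =
           fps_const (1 / of_nat m ^ (CARD('n) - 1)) *
           fps_scale_arg (of_nat CARD('n))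
             (F_full (Gmpn m p) (mat (zeta m ^ col m g) :: complex ^ 1 ^ 1)) *
           (\<Sum>r | r dvd d.
              fps_const (moebius_mu r * of_nat r ^ (CARD('n) + k - 2)) *
              fps_scale_arg (of_nat m / of_nat r) (F_full Sym_mats (perm_proj g)))"
proof (rule fps_ext)
  fix N
  have col: "(mat (zeta m ^ col m g) :: complex ^ 1 ^ 1) = color_mat g"
    using zeta_color_on[OF assms(1,5), of UNIV] by (simp add: color_mat_def color_prod_def)
  define A where "A L = rat_of_nat (card (full_refl_facts (Gmpn m p) (color_mat g) L))" for L
  define B where "B M = rat_of_nat (card (full_refl_facts Sym_mats (perm_proj g) M))" for M
  define \<mu> where "\<mu> r = moebius_mu r * of_nat r ^ (CARD('n) + k - 2)" for r
  define c where "c = (of_nat m :: rat) ^ (CARD('n) - 1)"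
  have "fps_nth (F_full (Gmpn m p) g) N
      = (\<Sum>L\<le>N. of_nat (N choose L) * (of_nat CARD('n) ^ L * A L) * B (N - L)
        * ((\<Sum>r | r dvd d. \<mu> r * (of_nat m / of_nat r) ^ (N - L)) / c)) / fact N"
    unfolding A_def B_def c_def \<mu>_def
    by (simp only: F_full_def fps_nth_Abs_fps card_full_refl_facts[OF assms])
  also have "\<dots> = (\<Sum>L\<le>N. (1 / c * (of_nat CARD('n) ^ L * (A L / fact L)))
      * (\<Sum>r | r dvd d. \<mu> r * ((of_nat m / of_nat r) ^ (N - L) * (B (N - L) / fact (N - L)))))"
    unfolding sum_divide_distrib[of _ _ "fact N"]
  proof (rule sum.cong[OF refl])
    fix L assume "L \<in> {..N}"
    then have "rat_of_nat (N choose L) / fact N = 1 / (fact L * fact (N - L))"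
      by (simp add: binomial_fact)
    moreover have "(\<Sum>r | r dvd d. \<mu> r * ((of_nat m / of_nat r) ^ (N - L) * (B (N - L) / fact (N - L))))
        = (\<Sum>r | r dvd d. \<mu> r * (of_nat m / of_nat r) ^ (N - L)) * (B (N - L) / fact (N - L))"
      unfolding sum_distrib_right by (rule sum.cong) (simp_all add: mult.assoc)
    moreover have "b * (x * a) * B' * (s / c) / f = (b / f) * (x * a * B' * s / c)" for b x a B' s f :: rat
      by (simp add: mult.commute)
    ultimately show "of_nat (N choose L) * (of_nat CARD('n) ^ L * A L) * B (N - L)
        * ((\<Sum>r | r dvd d. \<mu> r * (of_nat m / of_nat r) ^ (N - L)) / c) / fact N
      = (1 / c * (of_nat CARD('n) ^ L * (A L / fact L)))
        * (\<Sum>r | r dvd d. \<mu> r * ((of_nat m / of_nat r) ^ (N - L) * (B (N - L) / fact (N - L))))"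
      by (simp only:) (simp add: mult_ac)
  qed
  also have "\<dots> = fps_nth (fps_const (1 / c) * fps_scale_arg (of_nat CARD('n)) (F_full (Gmpn m p) (color_mat g)) *
      (\<Sum>r | r dvd d. fps_const (\<mu> r) * fps_scale_arg (of_nat m / of_nat r) (F_full Sym_mats (perm_proj g)))) N"
    by (simp add: fps_mult_nth[of _ _ N] atLeast0AtMost fps_sum_nth fps_compose_linear F_full_def A_def B_def
        fps_mult_left_const_nth)
  finally show "fps_nth (F_full (Gmpn m p) g) N = fps_nth (fps_const (1 / of_nat m ^ (CARD('n) - 1)) *
           fps_scale_arg (of_nat CARD('n))
             (F_full (Gmpn m p) (mat (zeta m ^ col m g) :: complex ^ 1 ^ 1)) *
           (\<Sum>r | r dvd d.
              fps_const (moebius_mu r * of_nat r ^ (CARD('n) + k - 2)) *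
              fps_scale_arg (of_nat m / of_nat r) (F_full Sym_mats (perm_proj g)))) N"
    unfolding col \<mu>_def c_def .
qed

end
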